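(* Let $(n,A,V)$ be the solution on $(0,T)$ of the quantum drift-diffusion system described in the context, let $\varrho=\exp(-(H+A))$, and let $\varrho_\infty$ be the equilibrium with $\mathrm{Tr}(\varrho_\infty)=\|n_0\|_{L^1}$. Then there is a constant $C$, independent of $t$, such that for almost every $t\in(0,T)$ $$F(\varrho(t))-F(\varrho_\infty)\le C\,\big\|\sqrt{n(t)}\,\nabla(A(t)-V(t))\big\|_{L^2(\Omega)}^2 .$$
   Context: Notation. $\Omega=[0,1]$ is the 1-torus, $\nabla=d/dx$, $\Delta=d^2/dx^2$. $H^1_{per}=\{u\in H^1(\Omega):u(0)=u(1)\}$, with dual $H^{-1}_{per}$. $V_{ext}\in L^\infty(\Omega)$ is a fixed real exterior potential. $H_0=-\Delta$ and $H=-\Delta+V_{ext}$, both with domain $\{u\in H^2(\Omega):u(0)=u(1),\nabla u(0)=\nabla u(1)\}$. $\mathcal J_1$ is the space of trace class operators on $L^2(\Omega)$. $\mathcal E=\{\varrho\in\mathcal J_1:\sqrt{H_0}|\varrho|\sqrt{H_0}\in\mathcal J_1\}$ with norm $\|\varrho\|_{\mathcal E}=\mathrm{Tr}(|\varrho|)+\mathrm{Tr}(\sqrt{H_0}|\varrho|\sqrt{H_0})$, and $\mathcal E_+=\{\varrho\in\mathcal E:\varrho\ge0\}$. The local density $n[\varrho]$ is defined by $\mathrm{Tr}(\phi\varrho)=\int_\Omega\phi\,n[\varrho]\,dx$ for all $\phi\in L^\infty(\Omega)$. $V[n]$ is the Poisson potential: $-\Delta V[n]=n$, $V[n](0)=V[n](1)=0$.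 With $\beta(x)=x\log x-x$ ($\beta(0)=0$), for $\varrho\in\mathcal E_+$, $$F(\varrho)=\mathrm{Tr}(\beta(\varrho))+\mathrm{Tr}(\sqrt{H_0}\varrho\sqrt{H_0})+\mathrm{Tr}(V_{ext}\varrho)+\tfrac12\|\nabla V[n[\varrho]]\|_{L^2}^2 .$$ Equilibrium (known): for $N>0$, $\varrho_\infty$ is the unique minimizer of $F$ over $\{\varrho\in\mathcal E_+:\mathrm{Tr}(\varrho)=N\}$. It has the form $\varrho_\infty=\exp(-(H+A_\infty))$, $A_\infty=V_\infty-\epsilon_F\in H^1_{per}$, $\epsilon_F$ a constant, $V_\infty=V[n_\infty]$, $n_\infty=n[\varrho_\infty]$. The solution: $(n,A,V)$ is a weak solution on $(0,T)$, with nonnegative initial datum $n_0\in H^1_{per}$ of mass $N=\|n_0\|_{L^1}>0$, of $\partial_t n+\nabla\cdot(n\nabla(A-V))=0$, $-\Delta V=n$ with $V$ vanishing at $0,1$, and $n=n[e^{-(H+A)}]$, with $n\in L^\infty(0,T,H^1_{per})$, $\partial_t n\in L^2(0,T,H^{-1}_{per})$, $A\in L^2(0,T,H^1_{per})$, $V\in L^\infty(0,T,H^1_0(\Omega))$, $\varrho=\exp(-(H+A))\in L^\infty(0,T,\mathcal E_+)$, $\|n(t)\|_{L^1}=\|n_0\|_{L^1}$ for a.e. $t$, and $n\ge\underline n$ a.e. in $(0,T)\times\Omega$ for a constant $\underline n>0$ (these are properties of the solutions constructed in the paper for initial data sufficiently close to equilibrium). *)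

theory Defs
  imports "HOL-Analysis.Analysis"
begin

text \<open>
  Functions on \<open>\<Omega> = [0,1]\<close> are total functions on the reals that are only looked at almost everywhere
  in \<open>\<Omega>\<close>. Only the Hilbert space carrying the operators is made into a type (of classes modulo
  a.e. equality). Unbounded operators on it are identified with their graphs.
\<close>

section \<open>Functions on the unit interval\<close>

abbreviation Omega :: "real measure" where
  "Omega \<equiv> lebesgue_on {0..1}"

definition L2_fun :: "(real \<Rightarrow> 'a::{banach,second_countable_topology}) set" where
  "L2_fun = {f. f \<in> borel_measurable Omega \<and> integrable Omega (\<lambda>x. (norm (f x))\<^sup>2)}"

definition L2_norm :: "(real \<Rightarrow> 'a::{banach,second_countable_topology}) \<Rightarrow> real" where
  "L2_norm f = sqrt (LINT x|Omega. (norm (f x))\<^sup>2)"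

definition L1_norm :: "(real \<Rightarrow> real) \<Rightarrow> real" where
  "L1_norm f = (LINT x|Omega. \<bar>f x\<bar>)"

definition Linf_fun :: "(real \<Rightarrow> real) set" where
  "Linf_fun = {f. f \<in> borel_measurable Omega \<and> (\<exists>C. AE x in Omega. \<bar>f x\<bar> \<le> C)}"

text \<open>Weak derivative on the open interval \<open>(a,b)\<close>, tested with \<open>C\<^sup>1\<close> functions of compact support.\<close>

definition weak_deriv ::
  "real \<Rightarrow> real \<Rightarrow> (real \<Rightarrow> 'a::{banach,second_countable_topology}) \<Rightarrow> (real \<Rightarrow> 'a) \<Rightarrow> bool" where
  "weak_deriv a b u g \<longleftrightarrow>
    (\<forall>\<phi> \<phi>' c d. (\<forall>x. (\<phi> has_real_derivative \<phi>' x) (at x)) \<and> continuous_on UNIV \<phi>'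
        \<and> a < c \<and> d < b \<and> (\<forall>x. x \<notin> {c..d} \<longrightarrow> \<phi> x = 0) \<longrightarrow>
      (LINT x|lebesgue_on {a<..<b}. \<phi>' x *\<^sub>R u x) = - (LINT x|lebesgue_on {a<..<b}. \<phi> x *\<^sub>R g x))"

definition grad :: "(real \<Rightarrow> 'a::{banach,second_countable_topology}) \<Rightarrow> real \<Rightarrow> 'a" where
  "grad u = (SOME g. g \<in> L2_fun \<and> weak_deriv 0 1 u g)"

definition H1 :: "(real \<Rightarrow> 'a::{banach,second_countable_topology}) set" where
  "H1 = {u \<in> L2_fun. \<exists>g\<in>L2_fun. weak_deriv 0 1 u g}"

definition H1_norm :: "(real \<Rightarrow> 'a::{banach,second_countable_topology}) \<Rightarrow> real" where
  "H1_norm u = sqrt ((L2_norm u)\<^sup>2 + (L2_norm (grad u))\<^sup>2)"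

text \<open>Boundary values are those of the continuous representative.\<close>

definition H1_per :: "(real \<Rightarrow> 'a::{banach,second_countable_topology}) set" where
  "H1_per = {u \<in> H1. \<exists>v. continuous_on {0..1} v \<and> (AE x in Omega. u x = v x) \<and> v 0 = v 1}"

definition H1_0 :: "(real \<Rightarrow> 'a::{banach,second_countable_topology}) set" where
  "H1_0 = {u \<in> H1. \<exists>v. continuous_on {0..1} v \<and> (AE x in Omega. u x = v x) \<and> v 0 = 0 \<and> v 1 = 0}"

definition Hm1_per :: "((real \<Rightarrow> real) \<Rightarrow> real) set" where
  "Hm1_per = {w. (\<forall>\<phi>\<in>H1_per. \<forall>\<psi>\<in>H1_per. w (\<lambda>x. \<phi> x + \<psi> x) = w \<phi> + w \<psi>)
      \<and> (\<forall>c. \<forall>\<phi>\<in>H1_per. w (\<lambda>x. c * \<phi> x) = c * w \<phi>)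
      \<and> (\<exists>C. \<forall>\<phi>\<in>H1_per. \<bar>w \<phi>\<bar> \<le> C * H1_norm \<phi>)}"

definition Hm1_norm :: "((real \<Rightarrow> real) \<Rightarrow> real) \<Rightarrow> real" where
  "Hm1_norm w = (SUP \<phi>\<in>{\<phi> \<in> H1_per. H1_norm \<phi> \<le> 1}. \<bar>w \<phi>\<bar>)"

definition poisson_solution :: "(real \<Rightarrow> real) \<Rightarrow> (real \<Rightarrow> real) \<Rightarrow> bool" where
  "poisson_solution n V \<longleftrightarrow> V \<in> H1_0 \<and> weak_deriv 0 1 (grad V) (\<lambda>x. - n x)"

definition poisson_potential :: "(real \<Rightarrow> real) \<Rightarrow> real \<Rightarrow> real" where
  "poisson_potential n = (SOME V. poisson_solution n V)"


section \<open>Functions of time with values in a normed space\<close>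

text \<open>
  The space is given by its carrier \<open>X\<close> and its (semi)norm \<open>nrm\<close>. Strong measurability is Bochner's:
  a.e. approximability by simple functions.
\<close>

definition strongly_measurable ::
  "real \<Rightarrow> 'a::minus set \<Rightarrow> ('a \<Rightarrow> real) \<Rightarrow> (real \<Rightarrow> 'a) \<Rightarrow> bool" where
  "strongly_measurable T X nrm f \<longleftrightarrow>
    (\<exists>s. (\<forall>k::nat. simple_function (lebesgue_on {0<..<T}) (s k) \<and> (\<forall>t\<in>{0<..<T}. s k t \<in> X))
       \<and> (AE t in lebesgue_on {0<..<T}. (\<lambda>k. nrm (s k t - f t)) \<longlonglongrightarrow> 0))"

definition L2_time :: "real \<Rightarrow> 'a::minus set \<Rightarrow> ('a \<Rightarrow> real) \<Rightarrow> (real \<Rightarrow> 'a) set" where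
  "L2_time T X nrm = {f. (AE t in lebesgue_on {0<..<T}. f t \<in> X) \<and> strongly_measurable T X nrm f
      \<and> integrable (lebesgue_on {0<..<T}) (\<lambda>t. (nrm (f t))\<^sup>2)}"

definition Linf_time :: "real \<Rightarrow> 'a::minus set \<Rightarrow> ('a \<Rightarrow> real) \<Rightarrow> (real \<Rightarrow> 'a) set" where
  "Linf_time T X nrm = {f. (AE t in lebesgue_on {0<..<T}. f t \<in> X) \<and> strongly_measurable T X nrm f
      \<and> (\<exists>C. AE t in lebesgue_on {0<..<T}. nrm (f t) \<le> C)}"

definition time_derivative ::
  "real \<Rightarrow> (real \<Rightarrow> real \<Rightarrow> real) \<Rightarrow> (real \<Rightarrow> (real \<Rightarrow> real) \<Rightarrow> real) \<Rightarrow> bool" where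
  "time_derivative T n dn \<longleftrightarrow>
    (\<forall>\<phi>\<in>H1_per. weak_deriv 0 T (\<lambda>t. LINT x|Omega. n t x * \<phi> x) (\<lambda>t. dn t \<phi>))"

text \<open>
  The initial value is that of the representative in \<open>C([0,T], L\<^sup>2)\<close>, which exists when
  \<open>n \<in> L\<^sup>2(0,T,H\<^sup>1\<^sub>p\<^sub>e\<^sub>r)\<close> and \<open>\<partial>\<^sub>t n \<in> L\<^sup>2(0,T,H\<^sup>-\<^sup>1\<^sub>p\<^sub>e\<^sub>r)\<close>.
\<close>

definition has_initial_value :: "real \<Rightarrow> (real \<Rightarrow> real \<Rightarrow> real) \<Rightarrow> (real \<Rightarrow> real) \<Rightarrow> bool" where
  "has_initial_value T n n0 \<longleftrightarrow>
    (\<exists>m. (\<forall>t\<in>{0..T}. m t \<in> L2_fun)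
       \<and> (\<forall>s\<in>{0..T}. ((\<lambda>t. L2_norm (m t - m s)) \<longlongrightarrow> 0) (at s within {0..T}))
       \<and> (AE t in lebesgue_on {0<..<T}. AE x in Omega. n t x = m t x)
       \<and> (AE x in Omega. m 0 x = n0 x))"


section \<open>The Hilbert space of complex square integrable functions\<close>

lemma L2_fun_add:
  assumes "f \<in> L2_fun" "g \<in> L2_fun"
  shows "(\<lambda>x. f x + g x) \<in> L2_fun"
proof -
  have [measurable]: "f \<in> borel_measurable Omega" "g \<in> borel_measurable Omega"
    using assms by (auto simp: L2_fun_def)
  have b: "(norm (f x + g x))\<^sup>2 \<le> 2 * (norm (f x))\<^sup>2 + 2 * (norm (g x))\<^sup>2" for x
  proof -
    have "(norm (f x + g x))\<^sup>2 \<le> (norm (f x) + norm (g x))\<^sup>2"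
      by (intro power_mono norm_triangle_ineq) simp
    also have "\<dots> \<le> 2 * (norm (f x))\<^sup>2 + 2 * (norm (g x))\<^sup>2"
      using sum_squares_bound[of "norm (f x)" "norm (g x)"] by (simp add: power2_sum)
    finally show ?thesis .
  qed
  have "integrable Omega (\<lambda>x. 2 * (norm (f x))\<^sup>2 + 2 * (norm (g x))\<^sup>2)"
    using assms by (auto simp: L2_fun_def)
  then have "integrable Omega (\<lambda>x. (norm (f x + g x))\<^sup>2)"
    by (rule Bochner_Integration.integrable_bound) (use b in \<open>auto intro!: AE_I2\<close>)
  then show ?thesis by (simp add: L2_fun_def)
qed

lemma L2_fun_scaleR: "f \<in> L2_fun \<Longrightarrow> (\<lambda>x. c *\<^sub>R f x) \<in> L2_fun"
  by (auto simp: L2_fun_def power_mult_distrib)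

lemma L2_fun_scaleC: "f \<in> L2_fun \<Longrightarrow> (\<lambda>x. (c::complex) * f x) \<in> L2_fun"
  by (auto simp: L2_fun_def power_mult_distrib norm_mult)

lemma L2_fun_zero: "(\<lambda>x. 0) \<in> L2_fun"
  by (auto simp: L2_fun_def)

lemma L2_fun_uminus: "f \<in> L2_fun \<Longrightarrow> (\<lambda>x. - f x) \<in> L2_fun"
  using L2_fun_scaleR[of f "-1"] by simp

lemma L2_fun_diff: "f \<in> L2_fun \<Longrightarrow> g \<in> L2_fun \<Longrightarrow> (\<lambda>x. f x - g x) \<in> L2_fun"
  using L2_fun_add[of f "\<lambda>x. - g x"] L2_fun_uminus[of g] by simp

lemma L2_fun_integrable_mult:
  fixes f g :: "real \<Rightarrow> complex"
  assumes "f \<in> L2_fun" "g \<in> L2_fun"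
  shows "integrable Omega (\<lambda>x. cnj (f x) * g x)"
proof -
  have [measurable]: "f \<in> borel_measurable Omega" "g \<in> borel_measurable Omega"
    using assms by (auto simp: L2_fun_def)
  have m: "(\<lambda>x. cnj (f x)) \<in> borel_measurable Omega"
    using borel_measurable_continuous_on[OF continuous_on_cnj[OF continuous_on_id], of f Omega]
    by simp
  have "integrable Omega (\<lambda>x. (norm (f x))\<^sup>2 + (norm (g x))\<^sup>2)"
    using assms by (auto simp: L2_fun_def)
  then show ?thesis
  proof (rule Bochner_Integration.integrable_bound)
    show "(\<lambda>x. cnj (f x) * g x) \<in> borel_measurable Omega"
      using m by measurable
    have "norm (f x) * norm (g x) \<le> (norm (f x))\<^sup>2 + (norm (g x))\<^sup>2" for x
      using sum_squares_bound[of "norm (f x)" "norm (g x)"]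
        mult_nonneg_nonneg[OF norm_ge_zero[of "f x"] norm_ge_zero[of "g x"]] by linarith
    then show "AE x in Omega. norm (cnj (f x) * g x) \<le> norm ((norm (f x))\<^sup>2 + (norm (g x))\<^sup>2)"
      by (auto intro!: AE_I2 simp: norm_mult)
  qed
qed

quotient_type L2 = "real \<Rightarrow> complex" / partial:
  "\<lambda>f g. f \<in> L2_fun \<and> g \<in> L2_fun \<and> (AE x in Omega. f x = g x)"
proof (rule part_equivpI)
  show "\<exists>f::real \<Rightarrow> complex. f \<in> L2_fun \<and> f \<in> L2_fun \<and> (AE x in Omega. f x = f x)"
    using L2_fun_zero by auto
qed (auto intro!: sympI transpI elim: AE_mp)

lift_definition scaleC_L2 :: "complex \<Rightarrow> L2 \<Rightarrow> L2" is "\<lambda>c f x. c * f x"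
  by (auto intro: L2_fun_scaleC)

lift_definition cinner :: "L2 \<Rightarrow> L2 \<Rightarrow> complex" is "\<lambda>f g. LINT x|Omega. cnj (f x) * g x"
proof -
  fix f f' g g' :: "real \<Rightarrow> complex"
  assume f: "f \<in> L2_fun \<and> f' \<in> L2_fun \<and> (AE x in Omega. f x = f' x)"
    and g: "g \<in> L2_fun \<and> g' \<in> L2_fun \<and> (AE x in Omega. g x = g' x)"
  show "(LINT x|Omega. cnj (f x) * g x) = (LINT x|Omega. cnj (f' x) * g' x)"
  proof (rule integral_cong_AE)
    show "AE x in Omega. cnj (f x) * g x = cnj (f' x) * g' x"
      using f g by auto
  qed (use f g in \<open>auto intro: borel_measurable_integrable L2_fun_integrable_mult\<close>)
qed

instantiation L2 :: real_vector
begin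

lift_definition zero_L2 :: L2 is "\<lambda>x. 0"
  by (simp add: L2_fun_zero)

lift_definition plus_L2 :: "L2 \<Rightarrow> L2 \<Rightarrow> L2" is "\<lambda>f g x. f x + g x"
  by (auto intro: L2_fun_add)

lift_definition minus_L2 :: "L2 \<Rightarrow> L2 \<Rightarrow> L2" is "\<lambda>f g x. f x - g x"
  by (auto intro: L2_fun_diff)

lift_definition uminus_L2 :: "L2 \<Rightarrow> L2" is "\<lambda>f x. - f x"
  by (auto intro: L2_fun_uminus)

lift_definition scaleR_L2 :: "real \<Rightarrow> L2 \<Rightarrow> L2" is "\<lambda>c f x. c *\<^sub>R f x"
  by (auto intro: L2_fun_scaleR)

instance
proof
  fix u v w :: L2 and a b :: real
  show "u + v + w = u + (v + w)"
    by transfer (auto simp: algebra_simps intro!: L2_fun_add)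
  show "u + v = v + u"
    by transfer (auto simp: algebra_simps intro!: L2_fun_add)
  show "0 + u = u"
    by transfer auto
  show "- u + u = 0"
    by transfer (auto simp: L2_fun_zero)
  show "u - v = u + - v"
    by transfer (auto intro: L2_fun_diff)
  show "a *\<^sub>R (u + v) = a *\<^sub>R u + a *\<^sub>R v"
    by transfer (auto simp: scaleR_add_right intro!: L2_fun_add L2_fun_scaleR[unfolded scaleR_conv_of_real])
  show "(a + b) *\<^sub>R u = a *\<^sub>R u + b *\<^sub>R u"
    by transfer (auto simp: scaleR_add_left intro!: L2_fun_add L2_fun_scaleR[unfolded scaleR_conv_of_real])
  show "a *\<^sub>R b *\<^sub>R u = (a * b) *\<^sub>R u"
    by transfer (auto simp: mult.assoc intro!: L2_fun_scaleR[unfolded scaleR_conv_of_real] L2_fun_scaleC)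
  show "1 *\<^sub>R u = u"
    by transfer auto
qed

end

lemma cinner_self_L2:
  fixes f :: "real \<Rightarrow> complex"
  shows "(LINT x|Omega. cnj (f x) * f x) = complex_of_real (LINT x|Omega. (norm (f x))\<^sup>2)"
proof -
  have "cnj (f x) * f x = complex_of_real ((norm (f x))\<^sup>2)" for x
    by (metis complex_norm_square mult.commute)
  then show ?thesis by (simp only: integral_complex_of_real)
qed

instantiation L2 :: real_inner
begin

definition inner_L2 :: "L2 \<Rightarrow> L2 \<Rightarrow> real" where
  "inner_L2 u v = Re (cinner u v)"

definition norm_L2 :: "L2 \<Rightarrow> real" where
  "norm_L2 u = sqrt (inner u u)"

definition sgn_L2 :: "L2 \<Rightarrow> L2" where
  "sgn_L2 u = u /\<^sub>R norm u"

definition dist_L2 :: "L2 \<Rightarrow> L2 \<Rightarrow> real" where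
  "dist_L2 u v = norm (u - v)"

definition uniformity_L2 :: "(L2 \<times> L2) filter" where
  "uniformity_L2 = (INF e\<in>{0<..}. principal {(x, y). dist x y < e})"

definition open_L2 :: "L2 set \<Rightarrow> bool" where
  "open_L2 U \<longleftrightarrow> (\<forall>x\<in>U. eventually (\<lambda>(x', y). x' = x \<longrightarrow> y \<in> U) uniformity)"

instance
proof
  fix u v w :: L2 and a :: real
  show "dist u v = norm (u - v)"
    by (rule dist_L2_def)
  show "sgn u = u /\<^sub>R norm u"
    by (rule sgn_L2_def)
  show "uniformity = (INF e\<in>{0<..}. principal {(x::L2, y). dist x y < e})"
    by (rule uniformity_L2_def)
  show "norm u = sqrt (inner u u)"
    by (rule norm_L2_def)
  show "inner u v = inner v u"
  proof -
    have "cinner u v = cnj (cinner v u)"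
    proof (transfer, goal_cases)
      case (1 f g)
      have "cnj (LINT x|Omega. cnj (g x) * f x) = (LINT x|Omega. cnj (cnj (g x) * f x))"
        by (rule Bochner_Integration.integral_cnj[symmetric])
      then show ?case by (simp add: mult.commute)
    qed
    then show ?thesis by (simp add: inner_L2_def)
  qed
  show "inner (u + v) w = inner u w + inner v w"
  proof -
    have "cinner (u + v) w = cinner u w + cinner v w"
      by transfer (auto simp: distrib_right L2_fun_integrable_mult)
    then show ?thesis by (simp add: inner_L2_def)
  qed
  show "inner (a *\<^sub>R u) v = a * inner u v"
  proof -
    have "cinner (a *\<^sub>R u) v = of_real a * cinner u v"
      by transfer (auto simp: mult.assoc scaleR_conv_of_real)
    then show ?thesis by (simp add: inner_L2_def)
  qed
  show "0 \<le> inner u u"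
    unfolding inner_L2_def by transfer (auto simp: cinner_self_L2)
  show "(inner u u = 0) = (u = 0)"
    unfolding inner_L2_def
  proof (transfer, safe, goal_cases)
    case (1 f)
    then show ?case by (simp add: L2_fun_zero)
  next
    case (2 f)
    then have "integrable Omega (\<lambda>x. (norm (f x))\<^sup>2)" by (simp add: L2_fun_def)
    moreover have "(LINT x|Omega. (norm (f x))\<^sup>2) = 0"
      using 2 by (simp add: cinner_self_L2)
    ultimately have "AE x in Omega. (norm (f x))\<^sup>2 = 0"
      using integral_nonneg_eq_0_iff_AE[of Omega "\<lambda>x. (norm (f x))\<^sup>2"] by auto
    then show ?case by auto
  next
    case (3 f)
    have "(LINT x|Omega. (norm (f x))\<^sup>2) = (LINT x|Omega. 0)"
      by (rule integral_cong_AE) (use 3 in \<open>auto simp: L2_fun_def\<close>)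
    then show ?case using 3 by (simp add: cinner_self_L2)
  qed
next
  fix U :: "L2 set"
  show "open U = (\<forall>x\<in>U. eventually (\<lambda>(x', y). x' = x \<longrightarrow> y \<in> U) uniformity)"
    by (rule open_L2_def)
qed

end


section \<open>Operators\<close>

text \<open>
  \<open>L2 \<Rightarrow>\<^sub>L L2\<close> is the space of bounded real-linear operators, so complex linearity is asked for separately.
\<close>

definition clinear_op :: "(L2 \<Rightarrow>\<^sub>L L2) \<Rightarrow> bool" where
  "clinear_op P \<longleftrightarrow> (\<forall>c u. P (scaleC_L2 c u) = scaleC_L2 c (P u))"

definition positive_op :: "(L2 \<Rightarrow>\<^sub>L L2) \<Rightarrow> bool" where
  "positive_op P \<longleftrightarrow> clinear_op P \<and> (\<forall>u. Im (cinner u (P u)) = 0 \<and> 0 \<le> Re (cinner u (P u)))"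

definition onb :: "L2 set \<Rightarrow> bool" where
  "onb B \<longleftrightarrow> (\<forall>e\<in>B. \<forall>f\<in>B. cinner e f = (if e = f then 1 else 0))
     \<and> (\<forall>u. (\<forall>e\<in>B. cinner e u = 0) \<longrightarrow> u = 0)"

definition op_trace :: "(L2 \<Rightarrow> L2) \<Rightarrow> complex" where
  "op_trace P = (THE z. \<forall>B. onb B \<longrightarrow> ((\<lambda>e. cinner e (P e)) has_sum z) B)"

text \<open>\<open>|P|\<close> is the positive square root of \<open>P\<^sup>*P\<close>; the equation \<open>|P|\<^sup>2 = P\<^sup>*P\<close> is written weakly.\<close>

definition op_abs :: "(L2 \<Rightarrow>\<^sub>L L2) \<Rightarrow> (L2 \<Rightarrow>\<^sub>L L2)" where
  "op_abs P = (THE Q. positive_op Q \<and> (\<forall>u v. cinner u (Q (Q v)) = cinner (P u) (P v)))"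

definition trace_class :: "(L2 \<Rightarrow>\<^sub>L L2) \<Rightarrow> bool" where
  "trace_class P \<longleftrightarrow> clinear_op P \<and>
     (\<forall>B. onb B \<longrightarrow> (\<lambda>e. cinner e (op_abs P e)) summable_on B)"

definition op_graph :: "(L2 \<Rightarrow>\<^sub>L L2) \<Rightarrow> (L2 \<times> L2) set" where
  "op_graph P = {(u, P u) | u. True}"

text \<open>
  Functional calculus \<open>f(R)\<close> for a self-adjoint operator (given by its graph \<open>R\<close>) that has an orthonormal
  basis \<open>B\<close> of eigenvectors with real eigenvalues \<open>\<lambda>\<close>, such as a Schroedinger operator on \<open>\<Omega>\<close> or a
  self-adjoint compact operator: \<open>f(R) u = \<Sum>\<^bsub>e\<in>B\<^esub> f(\<lambda>\<^sub>e) \<langle>e,u\<rangle> e\<close>, on the domain where this series converges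
  in \<open>L\<^sup>2\<close>, i.e. where some \<open>v\<close> has the coefficients \<open>f(\<lambda>\<^sub>e) \<langle>e,u\<rangle>\<close>.
\<close>

definition fun_calc :: "(real \<Rightarrow> real) \<Rightarrow> (L2 \<times> L2) set \<Rightarrow> (L2 \<times> L2) set" where
  "fun_calc f R = {(u, v). \<exists>B l. onb B \<and>
     (\<forall>e\<in>B. (e, l e *\<^sub>R e) \<in> R \<and> cinner e v = of_real (f (l e)) * cinner e u)}"

definition graph_apply :: "(L2 \<times> L2) set \<Rightarrow> L2 \<Rightarrow> L2" where
  "graph_apply R u = (THE v. (u, v) \<in> R)"

definition mult_op :: "(real \<Rightarrow> real) \<Rightarrow> L2 \<Rightarrow> L2" where
  "mult_op \<phi> u = abs_L2 (\<lambda>x. of_real (\<phi> x) * rep_L2 u x)"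

text \<open>\<open>-\<Delta> + W\<close> with domain \<open>{u \<in> H\<^sup>2. u(0) = u(1), \<nabla>u(0) = \<nabla>u(1)}\<close>, for bounded \<open>W\<close>.\<close>

definition schroedinger :: "(real \<Rightarrow> real) \<Rightarrow> (L2 \<times> L2) set" where
  "schroedinger W = {(abs_L2 f, abs_L2 (\<lambda>x. - grad (grad f) x + of_real (W x) * f x)) | f.
     f \<in> H1_per \<and> grad f \<in> H1_per}"

definition sqrt_H0 :: "(L2 \<times> L2) set" where
  "sqrt_H0 = fun_calc sqrt (schroedinger (\<lambda>x. 0))"

text \<open>
  \<open>\<surd>H\<^sub>0 P \<surd>H\<^sub>0\<close> belongs to \<open>J\<^sub>1\<close> means: it is defined on the (dense) domain of \<open>\<surd>H\<^sub>0\<close>, and its bounded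
  extension \<open>S\<close> to \<open>L\<^sup>2\<close> is trace class.
\<close>

definition sandwich_ext :: "(L2 \<Rightarrow>\<^sub>L L2) \<Rightarrow> (L2 \<Rightarrow>\<^sub>L L2) \<Rightarrow> bool" where
  "sandwich_ext P S \<longleftrightarrow> (\<forall>u v. (u, v) \<in> sqrt_H0 \<longrightarrow> (P v, S u) \<in> sqrt_H0)"

definition sandwich :: "(L2 \<Rightarrow>\<^sub>L L2) \<Rightarrow> (L2 \<Rightarrow>\<^sub>L L2)" where
  "sandwich P = (THE S. sandwich_ext P S)"

definition energy_space :: "(L2 \<Rightarrow>\<^sub>L L2) set" where
  "energy_space = {P. trace_class P \<and> (\<exists>S. sandwich_ext (op_abs P) S \<and> trace_class S)}"

definition energy_norm :: "(L2 \<Rightarrow>\<^sub>L L2) \<Rightarrow> real" where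
  "energy_norm P = Re (op_trace (op_abs P)) + Re (op_trace (sandwich (op_abs P)))"

definition energy_space_pos :: "(L2 \<Rightarrow>\<^sub>L L2) set" where
  "energy_space_pos = {P \<in> energy_space. positive_op P}"

text \<open>The local density of a self-adjoint trace class operator, which is real valued.\<close>

definition is_density :: "(L2 \<Rightarrow>\<^sub>L L2) \<Rightarrow> (real \<Rightarrow> real) \<Rightarrow> bool" where
  "is_density P n \<longleftrightarrow> integrable Omega n \<and>
     (\<forall>\<phi>\<in>Linf_fun. op_trace (\<lambda>u. mult_op \<phi> (P u)) = of_real (LINT x|Omega. \<phi> x * n x))"

definition density :: "(L2 \<Rightarrow>\<^sub>L L2) \<Rightarrow> real \<Rightarrow> real" where
  "density P = (SOME n. is_density P n)"


section \<open>Free energy and equilibrium\<close>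

definition entropy_fun :: "real \<Rightarrow> real" where
  "entropy_fun x = (if x = 0 then 0 else x * ln x - x)"

definition free_energy :: "(real \<Rightarrow> real) \<Rightarrow> (L2 \<Rightarrow>\<^sub>L L2) \<Rightarrow> real" where
  "free_energy Vext P =
     Re (op_trace (graph_apply (fun_calc entropy_fun (op_graph P))))
     + Re (op_trace (sandwich P))
     + Re (op_trace (\<lambda>u. mult_op Vext (P u)))
     + 1/2 * (L2_norm (grad (poisson_potential (density P))))\<^sup>2"

definition equilibrium :: "(real \<Rightarrow> real) \<Rightarrow> real \<Rightarrow> (L2 \<Rightarrow>\<^sub>L L2) \<Rightarrow> bool" where
  "equilibrium Vext N P \<longleftrightarrow>
     P \<in> energy_space_pos \<and> op_trace (blinfun_apply P) = of_real N \<and>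
     (\<forall>Q\<in>energy_space_pos. op_trace (blinfun_apply Q) = of_real N \<longrightarrow> free_energy Vext P \<le> free_energy Vext Q)"

end

(*
  Let W = Vext + A(t), so that the logarithm of rho is -(H + A). Convexity of the entropy (Klein's inequality)
  bounds F(rho) - F(rho_inf) by the integral of (V - A)(n - n_inf) minus half the squared L2-norm of
  grad(V - V_inf). Since n - n_inf = -Laplace(V - V_inf) and V - A takes equal values at 0 and 1, an integration
  by parts without boundary terms turns this into
    int grad(V - A) grad(V - V_inf) - 1/2 |grad(V - V_inf)|^2  <=  1/2 |grad(A - V)|^2,
  and n >= n_low gives C = 1/(2 n_low).

  Klein's inequality is the scalar tangent inequality beta(x) + l x + exp(-l) >= 0, summed with the weights
  |<f,e>|^2 over the eigenvectors e of the competitor and f of H + A; the sum over f of l_f |<f,e>|^2 is at most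
  the energy of e by Bessel's inequality for the quadratic form of H + A.
*)
theory Submission
  imports Defs
begin

section \<open>The Hilbert space\<close>

text \<open>Two obstacles shape the development. Every trace is a \<open>THE\<close> over all
  orthonormal bases, while densities, gradients and potentials are \<open>SOME\<close> choices. So
  each trace is evaluated in an eigenbasis and shown to be the same in all bases, and each chosen
  function is pinned down almost everywhere. The competitor comes without an eigenbasis, hence the
  spectral theorem for positive operators of finite trace, started from the Fourier basis; for
  \<open>H + A\<close> an eigenbasis is contained in the existential of \<open>fun_calc\<close>.
  Moreover, an eigenvector of the competitor need not lie in the operator domain of
  \<open>H + A\<close>; it is only known to lie in the form domain, and this only if its eigenvalue
  is nonzero. Its energy is therefore the sum of the \<open>kinetic\<close> terms over the Fourier
  modes plus the potential term. The tangent inequality is an equality at x = exp(-l), so the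
  entropy of \<open>\<rho>\<close> is computed exactly. Inserted in the free energies, the two
  results cancel the kinetic and the \<open>Vext\<close> terms, and the trace of
  \<open>\<rho>\<close> drops out of the difference. Equal mass then removes the boundary value of
  \<open>A\<close>.\<close>

lemma abs_L2_eq_iff:
  assumes "f \<in> L2_fun" "g \<in> L2_fun"
  shows "abs_L2 f = abs_L2 g \<longleftrightarrow> (AE x in Omega. f x = g x)"
  using Quotient3_rel[OF Quotient3_L2, of f g] assms by auto

lemma rep_L2_mem [simp]: "rep_L2 u \<in> L2_fun"
  using Quotient3_rep_reflp[OF Quotient3_L2, of u] by auto

lemma abs_rep_L2 [simp]: "abs_L2 (rep_L2 u) = u"
  by (rule Quotient3_abs_rep[OF Quotient3_L2])

lemma rep_abs_L2: "f \<in> L2_fun \<Longrightarrow> AE x in Omega. rep_L2 (abs_L2 f) x = f x"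
  by (metis abs_L2_eq_iff abs_rep_L2 rep_L2_mem)

lemma cinner_abs:
  "f \<in> L2_fun \<Longrightarrow> g \<in> L2_fun \<Longrightarrow> cinner (abs_L2 f) (abs_L2 g) = (LINT x|Omega. cnj (f x) * g x)"
  by (simp add: cinner.abs_eq)

lemma scaleC_abs: "f \<in> L2_fun \<Longrightarrow> scaleC_L2 c (abs_L2 f) = abs_L2 (\<lambda>x. c * f x)"
  by (simp add: scaleC_L2.abs_eq)

lemma scaleR_abs: "f \<in> L2_fun \<Longrightarrow> c *\<^sub>R abs_L2 f = abs_L2 (\<lambda>x. c *\<^sub>R f x)"
  by (simp add: scaleR_L2.abs_eq)

lemma plus_abs: "f \<in> L2_fun \<Longrightarrow> g \<in> L2_fun \<Longrightarrow> abs_L2 f + abs_L2 g = abs_L2 (\<lambda>x. f x + g x)"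
  by (simp add: plus_L2.abs_eq)

lemma minus_abs: "f \<in> L2_fun \<Longrightarrow> g \<in> L2_fun \<Longrightarrow> abs_L2 f - abs_L2 g = abs_L2 (\<lambda>x. f x - g x)"
  by (simp add: minus_L2.abs_eq)

lemma cinner_rep: "cinner u v = (LINT x|Omega. cnj (rep_L2 u x) * rep_L2 v x)"
  using cinner_abs[of "rep_L2 u" "rep_L2 v"] by simp

lemma cinner_commute: "cinner v u = cnj (cinner u v)"
proof -
  have "cnj (cinner u v) = (LINT x|Omega. cnj (cnj (rep_L2 u x) * rep_L2 v x))"
    unfolding cinner_rep by (rule Bochner_Integration.integral_cnj[symmetric])
  then show ?thesis by (simp add: cinner_rep mult.commute)
qed

lemma cinner_add_right: "cinner u (v + w) = cinner u v + cinner u w"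
  by transfer (simp add: distrib_left L2_fun_integrable_mult)

lemma cinner_scaleC_right: "cinner u (scaleC_L2 c v) = c * cinner u v"
proof transfer
  fix c :: complex and f g :: "real \<Rightarrow> complex"
  have "(LINT x|Omega. cnj (f x) * (c * g x)) = (LINT x|Omega. c * (cnj (f x) * g x))"
    by (intro Bochner_Integration.integral_cong) auto
  then show "(LINT x|Omega. cnj (f x) * (c * g x)) = c * (LINT x|Omega. cnj (f x) * g x)"
    by simp
qed

lemma cinner_add_left: "cinner (u + v) w = cinner u w + cinner v w"
  by (metis cinner_add_right cinner_commute complex_cnj_add)

lemma cinner_scaleC_left: "cinner (scaleC_L2 c u) v = cnj c * cinner u v"
  by (metis cinner_scaleC_right cinner_commute complex_cnj_mult)

lemma scaleC_of_real: "scaleC_L2 (complex_of_real r) u = r *\<^sub>R u"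
  by transfer (auto simp: scaleR_conv_of_real intro!: L2_fun_scaleC)

lemma cinner_scaleR_right: "cinner u (r *\<^sub>R v) = of_real r * cinner u v"
  by (metis cinner_scaleC_right scaleC_of_real)

lemma cinner_scaleR_left: "cinner (r *\<^sub>R u) v = of_real r * cinner u v"
  by (metis cinner_scaleC_left scaleC_of_real complex_cnj_complex_of_real)

lemma cinner_zero_right [simp]: "cinner u 0 = 0"
  using cinner_scaleR_right[of u 0 0] by simp

lemma cinner_zero_left [simp]: "cinner 0 u = 0"
  using cinner_scaleR_left[of 0 0 u] by simp

lemma cinner_minus_right: "cinner u (- v) = - cinner u v"
  using cinner_scaleR_right[of u "-1" v] by simp

lemma cinner_diff_right: "cinner u (v - w) = cinner u v - cinner u w"
  using cinner_add_right[of u v "-w"] by (simp add: cinner_minus_right)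

lemma cinner_diff_left: "cinner (u - v) w = cinner u w - cinner v w"
  by (metis cinner_diff_right cinner_commute complex_cnj_diff)

lemma cinner_sum_right: "cinner u (\<Sum>i\<in>F. g i) = (\<Sum>i\<in>F. cinner u (g i))"
  by (induction F rule: infinite_finite_induct) (auto simp: cinner_add_right)

lemma cinner_sum_left: "cinner (\<Sum>i\<in>F. g i) u = (\<Sum>i\<in>F. cinner (g i) u)"
  by (induction F rule: infinite_finite_induct) (auto simp: cinner_add_left)

lemma cinner_self: "cinner u u = complex_of_real ((norm u)\<^sup>2)"
proof -
  have "Im (cinner u u) = 0"
    using cinner_commute[of u u] by (metis cnj.simps(2) neg_equal_zero)
  moreover have "Re (cinner u u) = (norm u)\<^sup>2"
    by (simp add: power2_norm_eq_inner inner_L2_def)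
  ultimately show ?thesis by (simp add: complex_eq_iff)
qed

lemma norm_abs_L2:
  assumes "f \<in> L2_fun" shows "(norm (abs_L2 f))\<^sup>2 = (LINT x|Omega. (norm (f x))\<^sup>2)"
proof -
  have "complex_of_real ((norm (abs_L2 f))\<^sup>2) = complex_of_real (LINT x|Omega. (norm (f x))\<^sup>2)"
    by (simp only: cinner_self[symmetric] cinner_abs[OF assms assms] cinner_self_L2)
  then show ?thesis by (simp only: of_real_eq_iff)
qed

lemma norm_scaleC [simp]: "norm (scaleC_L2 c u) = cmod c * norm u"
proof -
  have "complex_of_real ((norm (scaleC_L2 c u))\<^sup>2) = complex_of_real ((cmod c * norm u)\<^sup>2)"
    unfolding cinner_self[symmetric] cinner_scaleC_left cinner_scaleC_right
    by (simp add: cinner_self power_mult_distrib complex_norm_square mult_ac del: of_real_power)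
  then have "(norm (scaleC_L2 c u))\<^sup>2 = (cmod c * norm u)\<^sup>2" by (simp only: of_real_eq_iff)
  then show ?thesis by (simp add: power2_eq_iff_nonneg)
qed

text \<open>The real inner product already satisfies Cauchy-Schwarz; multiplying \<open>u\<close> by
  a unit phase turns \<open>cinner u v\<close> into its modulus and keeps the norms.\<close>

lemma norm_cinner_le: "cmod (cinner u v) \<le> norm u * norm v"
proof (cases "cinner u v = 0")
  case False
  define c where "c = cinner u v / cmod (cinner u v)"
  have c: "cmod c = 1" using False by (simp add: c_def norm_divide)
  have "cinner (scaleC_L2 c u) v = cnj (cinner u v) * cinner u v / cmod (cinner u v)"
    by (simp add: cinner_scaleC_left c_def)
  also have "\<dots> = complex_of_real ((cmod (cinner u v))\<^sup>2) / complex_of_real (cmod (cinner u v))"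
    by (simp only: complex_norm_square mult.commute)
  also have "\<dots> = complex_of_real (cmod (cinner u v))"
    using False by (simp add: power2_eq_square)
  finally have "cmod (cinner u v) = inner (scaleC_L2 c u) v" by (simp add: inner_L2_def)
  also have "\<dots> \<le> norm (scaleC_L2 c u) * norm v" by (rule norm_cauchy_schwarz)
  finally show ?thesis by (simp add: c)
qed simp

lemma bounded_linear_cinner_right: "bounded_linear (cinner u)"
  by (rule bounded_linear_intro[where K="norm u"])
     (simp_all add: cinner_add_right cinner_scaleR_right scaleR_conv_of_real norm_cinner_le[THEN order_trans])

lemma bounded_bilinear_cinner: "bounded_bilinear cinner"
proof
  show "\<exists>K. \<forall>a b. cmod (cinner a b) \<le> norm a * norm b * K"
    by (rule exI[of _ 1]) (simp add: norm_cinner_le)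
qed (simp_all add: cinner_add_left cinner_add_right cinner_scaleR_left cinner_scaleR_right scaleR_conv_of_real)

lemmas tendsto_cinner [tendsto_intros] = bounded_bilinear.tendsto[OF bounded_bilinear_cinner]

lemma scaleC_add_left: "scaleC_L2 (a + b) u = scaleC_L2 a u + scaleC_L2 b u"
  by transfer (auto simp: distrib_right intro!: L2_fun_add L2_fun_scaleC)

lemma scaleC_add_right: "scaleC_L2 a (u + v) = scaleC_L2 a u + scaleC_L2 a v"
  by transfer (auto simp: distrib_left intro!: L2_fun_add L2_fun_scaleC)

lemma scaleC_scaleC: "scaleC_L2 a (scaleC_L2 b u) = scaleC_L2 (a * b) u"
  by transfer (auto simp: mult.assoc intro!: L2_fun_scaleC)

lemma scaleC_one [simp]: "scaleC_L2 1 u = u"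
  using scaleC_of_real[of 1 u] by simp

lemma scaleC_zero_left [simp]: "scaleC_L2 0 u = 0"
  using scaleC_of_real[of 0 u] by simp

lemma scaleC_zero_right [simp]: "scaleC_L2 c 0 = 0"
  using scaleC_scaleC[of c 0 0] by simp

lemma scaleC_scaleR_left: "scaleC_L2 (r *\<^sub>R c) u = r *\<^sub>R scaleC_L2 c u"
  by (simp add: scaleR_conv_of_real scaleC_scaleC[symmetric] scaleC_of_real)

lemma bounded_linear_scaleC_left: "bounded_linear (\<lambda>c. scaleC_L2 c u)"
  by (rule bounded_linear_intro[where K="norm u"]) (auto simp: scaleC_add_left scaleC_scaleR_left)

lemma cinner_eqI:
  assumes "\<And>w. cinner w u = cinner w v" shows "u = v"
proof -
  have "cinner (u - v) (u - v) = 0" using assms by (simp add: cinner_diff_right)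
  then show ?thesis by (simp add: cinner_self)
qed

section \<open>Completeness of \<open>L2\<close>\<close>

lemma L2_fun_integrable_norm:
  assumes "f \<in> (L2_fun :: (real \<Rightarrow> 'a::{banach,second_countable_topology}) set)"
  shows "integrable Omega (\<lambda>x. norm (f x))" "(LINT x|Omega. norm (f x)) \<le> sqrt (LINT x|Omega. (norm (f x))\<^sup>2)"
proof -
  have m[measurable]: "f \<in> borel_measurable Omega" using assms by (simp add: L2_fun_def)
  have i2: "integrable Omega (\<lambda>x. (norm (f x))\<^sup>2)" using assms by (simp add: L2_fun_def)
  have i1: "integrable Omega (\<lambda>x. 1 + (norm (f x))\<^sup>2)"
    using i2 by (intro Bochner_Integration.integrable_add) auto
  show i: "integrable Omega (\<lambda>x. norm (f x))"
  proof (rule Bochner_Integration.integrable_bound[OF i1])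
    have "norm (f x) \<le> 1 + (norm (f x))\<^sup>2" for x
      using sum_squares_bound[of "norm (f x)" 1] norm_ge_zero[of "f x"] unfolding power_one mult_1_right by linarith
    then show "AE x in Omega. norm (norm (f x)) \<le> norm (1 + (norm (f x))\<^sup>2)"
      by (auto intro!: AE_I2)
  qed measurable
  \<comment> \<open>The variance around the mean \<open>m\<close> is nonnegative;
    \<open>Omega\<close> has total measure 1.\<close>
  define m where "m = (LINT x|Omega. norm (f x))"
  have "0 \<le> (LINT x|Omega. (norm (f x) - m)\<^sup>2)" by simp
  also have "\<dots> = (LINT x|Omega. ((norm (f x))\<^sup>2 - 2 * m * norm (f x)) + m\<^sup>2)"
    by (intro Bochner_Integration.integral_cong) (auto simp: power2_diff)
  also have "\<dots> = (LINT x|Omega. (norm (f x))\<^sup>2) - 2 * m * m + m\<^sup>2"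
    using i i2 by (simp add: m_def measure_restrict_space)
  finally have "m\<^sup>2 \<le> (LINT x|Omega. (norm (f x))\<^sup>2)" by (simp add: power2_eq_square)
  then show "(LINT x|Omega. norm (f x)) \<le> sqrt (LINT x|Omega. (norm (f x))\<^sup>2)"
    unfolding m_def[symmetric] by (rule real_le_rsqrt)
qed

text \<open>Riesz-Fischer: on a space of measure 1 an L2-Cauchy sequence is L1-Cauchy and so has a
  subsequence converging almost everywhere; by Fatou its pointwise limit is the L2 limit of the
  whole sequence.\<close>

instance L2 :: banach
proof
  fix X :: "nat \<Rightarrow> L2" assume X: "Cauchy X"
  define s where "s n = rep_L2 (X n)" for n
  have sm: "s n \<in> L2_fun" for n by (simp add: s_def)
  have [measurable]: "s n \<in> borel_measurable Omega" for n using sm[of n] by (simp add: L2_fun_def)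
  have d: "(norm (X i - X j))\<^sup>2 = (LINT x|Omega. (norm (s i x - s j x))\<^sup>2)" for i j
    using norm_abs_L2[OF L2_fun_diff[OF sm[of i] sm[of j]]]
    by (simp add: minus_abs[symmetric] sm) (simp add: s_def)
  have c: "\<exists>N. \<forall>i\<ge>N. \<forall>j\<ge>N. (LINT x|Omega. norm (s i x - s j x)) < e" if "0 < e" for e
  proof -
    obtain N where N: "\<forall>i\<ge>N. \<forall>j\<ge>N. norm (X i - X j) < e"
      using CauchyD[OF X \<open>0 < e\<close>] ..
    have "(LINT x|Omega. norm (s i x - s j x)) \<le> norm (X i - X j)" for i j
      using L2_fun_integrable_norm(2)[OF L2_fun_diff[OF sm[of i] sm[of j]]] by (simp add: d[symmetric])
    with N show ?thesis using le_less_trans by blast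
  qed
  have "integrable Omega (s n)" for n
    using L2_fun_integrable_norm(1)[OF sm] by (simp add: integrable_norm_iff)
  then obtain r where r: "strict_mono r" "AE x in Omega. Cauchy (\<lambda>i. s (r i) x)"
    using c by (rule cauchy_L1_AE_cauchy_subseq)
  define f where "f x = lim (\<lambda>i. s (r i) x)" for x
  have lim: "AE x in Omega. (\<lambda>i. s (r i) x) \<longlonglongrightarrow> f x"
    using r(2) by eventually_elim (simp add: f_def Cauchy_convergent_iff convergent_LIMSEQ_iff)
  have fm[measurable]: "f \<in> borel_measurable Omega" unfolding f_def by measurable
  \<comment> \<open>Fatou in the subsequence index with \<open>j\<close> fixed; \<open>r i\<close>
    is at least \<open>i\<close>, so it stays in the Cauchy range.\<close>
  have key: "\<exists>N. \<forall>j\<ge>N. (\<lambda>x. f x - s j x) \<in> L2_fun \<and> (LINT x|Omega. (norm (f x - s j x))\<^sup>2) \<le> e\<^sup>2" if "0 < e" for e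
  proof -
    obtain N where N: "\<forall>i\<ge>N. \<forall>j\<ge>N. norm (X i - X j) < e"
      using CauchyD[OF X \<open>0 < e\<close>] ..
    have "(\<lambda>x. f x - s j x) \<in> L2_fun \<and> (LINT x|Omega. (norm (f x - s j x))\<^sup>2) \<le> e\<^sup>2" if "j \<ge> N" for j
    proof -
      have "(\<integral>\<^sup>+x. ennreal ((norm (f x - s j x))\<^sup>2) \<partial>Omega)
          = (\<integral>\<^sup>+x. liminf (\<lambda>i. ennreal ((norm (s (r i) x - s j x))\<^sup>2)) \<partial>Omega)"
      proof (rule nn_integral_cong_AE, use lim in eventually_elim)
        fix x assume "(\<lambda>i. s (r i) x) \<longlonglongrightarrow> f x"
        then have "(\<lambda>i. ennreal ((norm (s (r i) x - s j x))\<^sup>2)) \<longlonglongrightarrow> ennreal ((norm (f x - s j x))\<^sup>2)"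
          by (intro tendsto_intros tendsto_ennrealI)
        then show "ennreal ((norm (f x - s j x))\<^sup>2) = liminf (\<lambda>i. ennreal ((norm (s (r i) x - s j x))\<^sup>2))"
          by (rule lim_imp_Liminf[OF sequentially_bot, symmetric])
      qed
      also have "\<dots> \<le> liminf (\<lambda>i. \<integral>\<^sup>+x. ennreal ((norm (s (r i) x - s j x))\<^sup>2) \<partial>Omega)"
        by (rule nn_integral_liminf) measurable
      also have "\<dots> \<le> ennreal (e\<^sup>2)"
      proof (rule Liminf_le)
        have "(\<integral>\<^sup>+x. ennreal ((norm (s (r i) x - s j x))\<^sup>2) \<partial>Omega) \<le> ennreal (e\<^sup>2)" if "i \<ge> N" for i
        proof -
          have "(\<integral>\<^sup>+x. ennreal ((norm (s (r i) x - s j x))\<^sup>2) \<partial>Omega) = ennreal (LINT x|Omega. (norm (s (r i) x - s j x))\<^sup>2)"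
            using L2_fun_diff[OF sm[of "r i"] sm[of j]] by (intro nn_integral_eq_integral) (auto simp: L2_fun_def)
          also have "\<dots> \<le> ennreal (e\<^sup>2)"
            unfolding d[symmetric]
            using N[rule_format, of "r i" j] \<open>j \<ge> N\<close> that seq_suble[OF r(1), of i]
            by (intro ennreal_leI power_mono) auto
          finally show ?thesis .
        qed
        then show "\<forall>\<^sub>F i in sequentially. (\<integral>\<^sup>+x. ennreal ((norm (s (r i) x - s j x))\<^sup>2) \<partial>Omega) \<le> ennreal (e\<^sup>2)"
          by (auto simp: eventually_sequentially)
      qed simp
      finally have *: "(\<integral>\<^sup>+x. ennreal ((norm (f x - s j x))\<^sup>2) \<partial>Omega) \<le> ennreal (e\<^sup>2)" .
      have i: "integrable Omega (\<lambda>x. (norm (f x - s j x))\<^sup>2)"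
        by (rule integrableI_bounded) (use * in \<open>auto simp: le_less_trans\<close>)
      moreover have "(LINT x|Omega. (norm (f x - s j x))\<^sup>2) \<le> e\<^sup>2"
        using * nn_integral_eq_integral[OF i] by (simp add: ennreal_le_iff)
      ultimately show ?thesis by (auto simp: L2_fun_def)
    qed
    then show ?thesis by blast
  qed
  obtain j where "(\<lambda>x. f x - s j x) \<in> L2_fun" using key[of 1] by auto
  from L2_fun_add[OF this sm[of j]] have f: "f \<in> L2_fun" by simp
  have "X \<longlonglongrightarrow> abs_L2 f"
  proof (rule LIMSEQ_I)
    fix e :: real assume "0 < e"
    obtain N where N: "\<And>j. j \<ge> N \<Longrightarrow> (LINT x|Omega. (norm (f x - s j x))\<^sup>2) \<le> (e/2)\<^sup>2"
      using key[of "e/2"] \<open>0 < e\<close> by auto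
    have "norm (X j - abs_L2 f) < e" if "j \<ge> N" for j
    proof -
      have "(norm (abs_L2 f - X j))\<^sup>2 = (LINT x|Omega. (norm (f x - s j x))\<^sup>2)"
        using norm_abs_L2[OF L2_fun_diff[OF f sm[of j]]]
        by (simp add: minus_abs[symmetric] sm f) (simp add: s_def)
      then have "norm (abs_L2 f - X j) \<le> e/2"
        using N[OF that] \<open>0 < e\<close> by (metis half_gt_zero less_imp_le power2_le_imp_le)
      then show ?thesis using \<open>0 < e\<close> by (simp add: norm_minus_commute)
    qed
    then show "\<exists>no. \<forall>n\<ge>no. norm (X n - abs_L2 f) < e" by blast
  qed
  then show "convergent X" by (auto simp: convergent_def)
qed

section \<open>Orthonormal bases\<close>

text \<open>\<open>onb\<close> without totality: what Bessel's inequality requires, and what is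
  preserved under unions of chains in the Zorn argument.\<close>

definition orthonormal :: "L2 set \<Rightarrow> bool" where
  "orthonormal B \<longleftrightarrow> (\<forall>e\<in>B. \<forall>f\<in>B. cinner e f = (if e = f then 1 else 0))"

lemma onb_orthonormal: "onb B \<Longrightarrow> orthonormal B"
  by (simp add: onb_def orthonormal_def)

lemma orthonormal_norm: "orthonormal B \<Longrightarrow> e \<in> B \<Longrightarrow> norm e = 1"
proof -
  assume "orthonormal B" "e \<in> B"
  then have "complex_of_real ((norm e)\<^sup>2) = 1"
    unfolding cinner_self[symmetric] by (auto simp: orthonormal_def)
  then have "(norm e)\<^sup>2 = 1" by (metis of_real_eq_1_iff)
  then show ?thesis using norm_ge_zero[of e] by (simp add: power2_eq_1_iff)
qed

lemma orthonormal_cinner_sum: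
  assumes "orthonormal B" "finite F" "F \<subseteq> B" "e \<in> B"
  shows "cinner e (\<Sum>f\<in>F. scaleC_L2 (c f) f) = (if e \<in> F then c e else 0)"
proof -
  have "cinner e (\<Sum>f\<in>F. scaleC_L2 (c f) f) = (\<Sum>f\<in>F. if f = e then c f else 0)"
    unfolding cinner_sum_right cinner_scaleC_right
    by (intro sum.cong) (use assms in \<open>auto simp: orthonormal_def subset_eq\<close>)
  then show ?thesis using assms(2) by simp
qed

lemma orthonormal_norm_sum:
  assumes "orthonormal B" "finite F" "F \<subseteq> B"
  shows "(norm (\<Sum>f\<in>F. scaleC_L2 (c f) f))\<^sup>2 = (\<Sum>f\<in>F. (cmod (c f))\<^sup>2)"
proof -
  have "complex_of_real ((norm (\<Sum>f\<in>F. scaleC_L2 (c f) f))\<^sup>2)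
      = (\<Sum>e\<in>F. cnj (c e) * cinner e (\<Sum>f\<in>F. scaleC_L2 (c f) f))"
    unfolding cinner_self[symmetric] by (subst cinner_sum_left) (simp add: cinner_scaleC_left)
  also have "\<dots> = (\<Sum>e\<in>F. cnj (c e) * c e)"
    by (intro sum.cong refl) (use orthonormal_cinner_sum[OF assms] assms(3) in auto)
  also have "\<dots> = complex_of_real (\<Sum>f\<in>F. (cmod (c f))\<^sup>2)"
    unfolding of_real_sum by (intro sum.cong refl) (simp only: complex_norm_square mult.commute)
  finally show ?thesis by (simp only: of_real_eq_iff)
qed

text \<open>Pythagoras for the projection onto the span of \<open>F\<close>. The remainder is kept
  as an equality because the compactness estimate and the form version of Bessel's inequality need
  its exact norm.\<close>

lemma bessel_finite:
  assumes "orthonormal B" "finite F" "F \<subseteq> B"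
  shows "(\<Sum>f\<in>F. (cmod (cinner f u))\<^sup>2) = (norm u)\<^sup>2 - (norm (u - (\<Sum>f\<in>F. scaleC_L2 (cinner f u) f)))\<^sup>2"
proof -
  define p where "p = (\<Sum>f\<in>F. scaleC_L2 (cinner f u) f)"
  have pu: "cinner p u = complex_of_real (\<Sum>f\<in>F. (cmod (cinner f u))\<^sup>2)"
    unfolding p_def cinner_sum_left cinner_scaleC_left of_real_sum
    by (intro sum.cong refl) (simp only: complex_norm_square mult.commute)
  have up: "cinner u p = complex_of_real (\<Sum>f\<in>F. (cmod (cinner f u))\<^sup>2)"
    by (subst cinner_commute) (simp only: pu complex_cnj_complex_of_real)
  have pp: "cinner p p = complex_of_real (\<Sum>f\<in>F. (cmod (cinner f u))\<^sup>2)"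
    using orthonormal_norm_sum[OF assms, of "\<lambda>f. cinner f u"] by (simp only: cinner_self p_def)
  have "complex_of_real ((norm (u - p))\<^sup>2) = complex_of_real ((norm u)\<^sup>2 - (\<Sum>f\<in>F. (cmod (cinner f u))\<^sup>2))"
    unfolding cinner_self[symmetric] cinner_diff_left cinner_diff_right pu up pp
    by (simp add: cinner_self)
  then have "(norm (u - p))\<^sup>2 = (norm u)\<^sup>2 - (\<Sum>f\<in>F. (cmod (cinner f u))\<^sup>2)"
    by (simp only: of_real_eq_iff)
  then show ?thesis by (simp add: p_def)
qed

lemma bessel_summable:
  assumes "orthonormal B"
  shows "(\<lambda>f. (cmod (cinner f u))\<^sup>2) summable_on B"
proof (rule nonneg_bdd_above_summable_on)
  show "bdd_above (sum (\<lambda>f. (cmod (cinner f u))\<^sup>2) ` {F. F \<subseteq> B \<and> finite F})"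
    by (rule bdd_aboveI2[where M="(norm u)\<^sup>2"]) (use bessel_finite[OF assms] in auto)
qed auto

text \<open>The squared norm of a finite block of the vector sum is the same block of the
  coefficient sum. Hence the partial sums over finite subsets form a Cauchy filter, and completeness
  applies.\<close>

lemma orthonormal_summable:
  assumes B: "orthonormal B" and c: "(\<lambda>f. (cmod (c f))\<^sup>2) summable_on B"
  shows "(\<lambda>f. scaleC_L2 (c f) f) summable_on B"
proof -
  define g where "g f = (cmod (c f))\<^sup>2" for f
  have "cauchy_filter (filtermap (sum (\<lambda>f. scaleC_L2 (c f) f)) (finite_subsets_at_top B))"
    unfolding cauchy_filter_iff
  proof safe
    fix P :: "L2 \<times> L2 \<Rightarrow> bool" assume "eventually P uniformity"
    then obtain e where e: "0 < e" "\<And>x y. dist x y < e \<Longrightarrow> P (x, y)"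
      unfolding eventually_uniformity_metric by blast
    \<comment> \<open>The tail bound e^2/8 is strictly below (e/2)^2, so every later partial sum is
      within e/2 of the one over \<open>F\<close>.\<close>
    obtain F where F: "finite F" "F \<subseteq> B" "dist (sum g F) (infsum g B) \<le> e\<^sup>2 / 8"
      using infsum_finite_approximation[of g B "e\<^sup>2/8"] c e(1) by (auto simp: g_def[abs_def])
    have tail: "sum g (G - F) \<le> e\<^sup>2 / 8" if "finite G" "F \<subseteq> G" "G \<subseteq> B" for G
    proof -
      have "sum g F + sum g (G - F) = sum g G" using that F(1)
        by (metis add.commute sum.subset_diff)
      moreover have "sum g G \<le> infsum g B"
        using that c by (intro finite_sum_le_infsum) (auto simp: g_def[abs_def])
      ultimately show ?thesis using F(3) unfolding dist_real_def by linarith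
    qed
    let ?S = "sum (\<lambda>f. scaleC_L2 (c f) f)"
    have near: "dist (?S G) (?S F) < e / 2" if "finite G" "F \<subseteq> G" "G \<subseteq> B" for G
    proof -
      have "?S G - ?S F = ?S (G - F)" using that F(1) by (simp add: sum_diff)
      then have "(dist (?S G) (?S F))\<^sup>2 = sum g (G - F)"
        using orthonormal_norm_sum[OF B, of "G - F" c] that by (simp add: dist_norm g_def subset_eq)
      also have "\<dots> \<le> e\<^sup>2 / 8" using tail that by blast
      also have "\<dots> < (e/2)\<^sup>2" using e(1) by (simp add: power2_eq_square)
      finally show ?thesis using e(1) by (meson power2_less_imp_less less_imp_le half_gt_zero)
    qed
    show "\<exists>X. (\<forall>\<^sub>F x in filtermap ?S (finite_subsets_at_top B). x \<in> X) \<and> (\<forall>z\<in>X \<times> X. P z)"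
    proof (intro exI conjI)
      show "\<forall>\<^sub>F x in filtermap ?S (finite_subsets_at_top B). x \<in> ball (?S F) (e/2)"
        unfolding eventually_filtermap eventually_finite_subsets_at_top
        using near F by (auto simp: dist_commute)
      show "\<forall>z\<in>ball (?S F) (e/2) \<times> ball (?S F) (e/2). P z"
      proof
        fix z assume "z \<in> ball (?S F) (e/2) \<times> ball (?S F) (e/2)"
        then have "dist (?S F) (fst z) < e / 2" "dist (?S F) (snd z) < e / 2" by auto
        then have "dist (fst z) (snd z) < e" by (rule dist_triangle_half_r)
        then show "P z" using e(2)[of "fst z" "snd z"] by simp
      qed
    qed
  qed
  then have "convergent_filter (filtermap (sum (\<lambda>f. scaleC_L2 (c f) f)) (finite_subsets_at_top B))"
    by (rule cauchy_filter_convergent)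
  then show ?thesis by (simp add: convergent_filter_iff summable_on_def has_sum_def filterlim_def)
qed

lemma orthonormal_infsum_coeff:
  assumes B: "orthonormal B" and c: "(\<lambda>f. (cmod (c f))\<^sup>2) summable_on B" and e: "e \<in> B"
  shows "cinner e (\<Sum>\<^sub>\<infinity>f\<in>B. scaleC_L2 (c f) f) = c e"
proof -
  have "((\<lambda>f. cinner e (scaleC_L2 (c f) f)) has_sum cinner e (\<Sum>\<^sub>\<infinity>f\<in>B. scaleC_L2 (c f) f)) B"
    by (rule has_sum_bounded_linear[OF bounded_linear_cinner_right has_sum_infsum[OF orthonormal_summable[OF B c]]])
  moreover have "((\<lambda>f. cinner e (scaleC_L2 (c f) f)) has_sum c e) B"
    by (rule has_sum_finite_neutralI[of "{e}"])
       (use B e in \<open>auto simp: orthonormal_def cinner_scaleC_right\<close>)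
  ultimately show ?thesis by (rule has_sum_unique)
qed

text \<open>The series and \<open>u\<close> have the same coefficients, so totality of the basis
  makes their difference zero.\<close>

lemma onb_expansion:
  assumes "onb B"
  shows "((\<lambda>e. scaleC_L2 (cinner e u) e) has_sum u) B"
proof -
  have B: "orthonormal B" using assms by (rule onb_orthonormal)
  let ?s = "\<Sum>\<^sub>\<infinity>e\<in>B. scaleC_L2 (cinner e u) e"
  have "cinner e (u - ?s) = 0" if "e \<in> B" for e
    using orthonormal_infsum_coeff[OF B bessel_summable[OF B] that] by (simp add: cinner_diff_right)
  then have "u - ?s = 0" using assms unfolding onb_def by metis
  then show ?thesis using has_sum_infsum[OF orthonormal_summable[OF B bessel_summable[OF B, of u]]] by simp
qed

text \<open>Surjectivity of the coefficient map; it produces the values of a functional calculus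
  from prescribed coefficients.\<close>

lemma onb_exists_coeff:
  assumes "onb B" "(\<lambda>f. (cmod (c f))\<^sup>2) summable_on B"
  obtains u where "\<And>e. e \<in> B \<Longrightarrow> cinner e u = c e"
  using orthonormal_infsum_coeff[OF onb_orthonormal[OF assms(1)] assms(2)] by blast

lemma onb_norm: "onb B \<Longrightarrow> e \<in> B \<Longrightarrow> norm e = 1"
  by (rule orthonormal_norm[OF onb_orthonormal])

lemma parseval:
  assumes "onb B"
  shows "((\<lambda>e. cinner u e * cinner e v) has_sum cinner u v) B"
  using has_sum_bounded_linear[OF bounded_linear_cinner_right onb_expansion[OF assms, of v], of u]
  by (simp add: cinner_scaleC_right mult.commute)

lemma cinner_mult_commute: "cinner u e * cinner e u = complex_of_real ((cmod (cinner e u))\<^sup>2)"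
  by (metis cinner_commute complex_norm_square mult.commute)

lemma parseval_norm:
  assumes "onb B"
  shows "((\<lambda>e. (cmod (cinner e u))\<^sup>2) has_sum (norm u)\<^sup>2) B"
  using parseval[OF assms, of u u]
  unfolding cinner_self cinner_mult_commute has_sum_of_real_iff .

lemma onb_eqI:
  assumes "onb B" "\<And>e. e \<in> B \<Longrightarrow> cinner e u = cinner e v"
  shows "u = v"
proof -
  have "\<forall>e\<in>B. cinner e (u - v) = 0" using assms(2) by (simp add: cinner_diff_right)
  then show ?thesis using assms(1) by (auto simp: onb_def)
qed

section \<open>Positive operators\<close>

lemma positive_clinear: "positive_op P \<Longrightarrow> P (scaleC_L2 c u) = scaleC_L2 c (P u)"
  by (simp add: positive_op_def clinear_op_def)

lemma positive_op_Re: "positive_op P \<Longrightarrow> 0 \<le> Re (cinner u (P u))"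
  by (simp add: positive_op_def)

text \<open>Polarisation: the expectation values are real at u + v and at u + iv, which gives the
  imaginary and the real part of the identity. The second vector is where complex linearity
  enters.\<close>

lemma positive_op_symmetric:
  assumes "positive_op P"
  shows "cinner (P u) v = cinner u (P v)"
proof -
  have Im0: "Im (cinner w (P w)) = 0" for w using assms by (simp add: positive_op_def)
  have 1: "Im (cinner u (P v)) + Im (cinner v (P u)) = 0"
    using Im0[of "u + v"] Im0[of u] Im0[of v]
    by (simp add: blinfun.add_right cinner_add_left cinner_add_right)
  have 2: "Re (cinner u (P v)) - Re (cinner v (P u)) = 0"
    using Im0[of "u + scaleC_L2 \<i> v"] Im0[of u] Im0[of v]
    by (simp add: blinfun.add_right cinner_add_left cinner_add_right positive_clinear[OF assms]
        cinner_scaleC_left cinner_scaleC_right)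
  have "cinner u (P v) = cnj (cinner v (P u))"
    using 1 2 by (simp add: complex_eq_iff)
  then show ?thesis by (metis cinner_commute)
qed

lemma positive_op_cauchy_schwarz:
  assumes P: "positive_op P"
  shows "(Re (cinner u (P v)))\<^sup>2 \<le> Re (cinner u (P u)) * Re (cinner v (P v))"
proof -
  define a where "a = Re (cinner v (P v))"
  define b where "b = Re (cinner u (P v))"
  define c where "c = Re (cinner u (P u))"
  have b': "Re (cinner v (P u)) = b"
    unfolding b_def by (metis P cinner_commute cnj.simps(1) positive_op_symmetric)
  have nn: "0 \<le> c + 2 * t * b + t\<^sup>2 * a" for t
    using positive_op_Re[OF P, of "u + t *\<^sub>R v"] b'
    by (simp add: blinfun.add_right blinfun.scaleR_right cinner_add_left cinner_add_right
        cinner_scaleR_left cinner_scaleR_right a_def[symmetric] b_def[symmetric] c_def[symmetric]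
        algebra_simps power2_eq_square)
  have a0: "0 \<le> a" "0 \<le> c" using positive_op_Re[OF P] by (auto simp: a_def c_def)
  have "b\<^sup>2 \<le> c * a"
  proof (cases "a = 0")
    case True
    have "b = 0"
    proof (rule ccontr)
      assume "b \<noteq> 0"
      \<comment> \<open>For \<open>a = 0\<close> the quadratic is affine in t, and this t gives it
        the value -1.\<close>
      then show False using nn[of "-(c+1)/(2*b)"] True by (simp add: field_simps)
    qed
    then show ?thesis using True by simp
  next
    case False
    \<comment> \<open>The minimiser t = -b/a; after multiplication by \<open>a\<close> its value is
      the discriminant bound.\<close>
    then have "0 \<le> (c + 2 * (-b/a) * b + (-b/a)\<^sup>2 * a) * a" using nn[of "-b/a"] a0 by simp
    also have "\<dots> = c * a - b\<^sup>2" using False by (simp add: field_simps power2_eq_square)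
    finally show ?thesis by simp
  qed
  then show ?thesis by (simp add: a_def b_def c_def)
qed

text \<open>Cauchy-Schwarz for the form of \<open>P\<close> with the second vector
  \<open>P u\<close>. The bound \<open>K\<close> is asked for at \<open>P u\<close> alone, so that
  \<open>K\<close> may be the supremum of the form on an invariant subspace as well as the operator
  norm.\<close>

lemma positive_op_norm_bound:
  assumes P: "positive_op P" and K: "Re (cinner (P u) (P (P u))) \<le> K * (norm (P u))\<^sup>2"
  shows "(norm (P u))\<^sup>2 \<le> K * Re (cinner u (P u))"
proof (cases "P u = 0")
  case True
  then show ?thesis by simp
next
  case False
  have "((norm (P u))\<^sup>2)\<^sup>2 = (Re (cinner u (P (P u))))\<^sup>2"
    by (simp add: positive_op_symmetric[OF P, symmetric] cinner_self del: of_real_power)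
  also have "\<dots> \<le> Re (cinner u (P u)) * Re (cinner (P u) (P (P u)))"
    by (rule positive_op_cauchy_schwarz[OF P])
  also have "\<dots> \<le> Re (cinner u (P u)) * (K * (norm (P u))\<^sup>2)"
    by (rule mult_left_mono[OF K positive_op_Re[OF P]])
  finally have "(norm (P u))\<^sup>2 * (norm (P u))\<^sup>2 \<le> (K * Re (cinner u (P u))) * (norm (P u))\<^sup>2"
    by (simp add: power2_eq_square mult_ac)
  then show ?thesis by (rule mult_right_le_imp_le) (use False in simp)
qed

lemma Re_cinner_blinfun_le:
  fixes P :: "L2 \<Rightarrow>\<^sub>L L2"
  shows "Re (cinner u (P u)) \<le> norm P * (norm u)\<^sup>2"
proof -
  have "Re (cinner u (P u)) \<le> norm u * norm (P u)"
    using complex_Re_le_cmod norm_cinner_le order_trans by blast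
  also have "\<dots> \<le> norm u * (norm P * norm u)"
    by (intro mult_left_mono norm_blinfun) auto
  finally show ?thesis by (simp add: power2_eq_square mult_ac)
qed

lemma positive_op_norm_square_le:
  "positive_op P \<Longrightarrow> (norm (P u))\<^sup>2 \<le> norm P * Re (cinner u (P u))"
  by (rule positive_op_norm_bound[OF _ Re_cinner_blinfun_le])

lemma positive_op_eq_0: "positive_op P \<Longrightarrow> Re (cinner u (P u)) = 0 \<Longrightarrow> P u = 0"
  using positive_op_norm_square_le[of P u] by simp

lemma positive_op_add: "positive_op P \<Longrightarrow> positive_op Q \<Longrightarrow> positive_op (P + Q)"
  by (auto simp: positive_op_def clinear_op_def blinfun.add_left cinner_add_right scaleC_add_right)

text \<open>
  With \<open>S = P + Q\<close> and \<open>D = P - Q\<close>, the equality of the squares says \<open>S D = - D S\<close>. So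
  \<open>(1 + r S)\<^sup>k D = D (1 - r S)\<^sup>k\<close> stays bounded in \<open>k\<close>, which forces \<open>\<langle>D x, S D x\<rangle> = 0\<close>.
\<close>

lemma positive_sqrt_unique:
  assumes P: "positive_op P" and Q: "positive_op Q" and sq: "\<And>u. P (P u) = Q (Q u)"
  shows "P = Q"
proof (rule blinfun_eqI)
  fix x
  define S where "S = P + Q"
  define D where "D = P - Q"
  have S: "positive_op S" unfolding S_def by (rule positive_op_add[OF P Q])
  have SD: "S (D u) = - D (S u)" for u
    using sq[of u] by (simp add: S_def D_def blinfun.add_left blinfun.diff_left blinfun.add_right blinfun.diff_right)
  have Dsym: "cinner (D u) v = cinner u (D v)" for u v
    by (simp add: D_def blinfun.diff_left cinner_diff_left cinner_diff_right
        positive_op_symmetric[OF P] positive_op_symmetric[OF Q])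
  \<comment> \<open>Small enough that 1 - r S is a contraction; the summand 1 covers
    \<open>S = 0\<close>.\<close>
  define r where "r = 1 / (norm S + 1)"
  have r: "0 < r" "r * norm S \<le> 1"
    using add_nonneg_pos[OF norm_ge_zero[of S] zero_less_one] by (simp_all add: r_def divide_simps)
  define a where "a u = u + r *\<^sub>R S u" for u
  define b where "b u = u - r *\<^sub>R S u" for u
  define q where "q u = Re (cinner u (S u))" for u
  have q0: "0 \<le> q u" for u unfolding q_def by (rule positive_op_Re[OF S])
  have nq: "(norm (u + t *\<^sub>R S u))\<^sup>2 = (norm u)\<^sup>2 + 2 * t * q u + t\<^sup>2 * (norm (S u))\<^sup>2" for u t
  proof -
    have "inner (S u) u = q u" "inner u (S u) = q u"
      by (simp_all add: q_def inner_L2_def positive_op_symmetric[OF S])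
    then show ?thesis unfolding power2_norm_eq_inner
      by (simp add: inner_add_left inner_add_right algebra_simps power2_eq_square)
  qed
  have b: "norm (b u) \<le> norm u" for u
  proof -
    have "r * (norm (S u))\<^sup>2 \<le> r * (norm S * q u)"
      using r(1) positive_op_norm_square_le[OF S, of u] by (simp add: q_def)
    also have "\<dots> \<le> 1 * q u" unfolding mult.assoc[symmetric] by (rule mult_right_mono[OF r(2) q0])
    finally have "r * (r * (norm (S u))\<^sup>2) \<le> r * q u" using r(1) by simp
    then have "(norm (b u))\<^sup>2 \<le> (norm u)\<^sup>2 - r * q u"
      using nq[of u "-r"] by (simp add: b_def power2_eq_square algebra_simps)
    also have "\<dots> \<le> (norm u)\<^sup>2" using r(1) q0[of u] by simp
    finally show ?thesis by simp
  qed
  have bk: "norm ((b ^^ k) u) \<le> norm u" for k u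
    by (induction k) (auto intro: order_trans[OF b])
  have a: "(norm (a u))\<^sup>2 \<ge> (norm u)\<^sup>2 + 2 * r * q u" for u
    using nq[of u r] by (simp add: a_def)
  have qa: "q (a u) \<ge> q u" for u
  proof -
    have "q (a u) = q u + 2 * r * (norm (S u))\<^sup>2 + r\<^sup>2 * q (S u)"
    proof -
      have "Re (cinner (S u) (S u)) = (norm (S u))\<^sup>2" by (simp add: cinner_self del: of_real_power)
      moreover from this have "Re (cinner u (S (S u))) = (norm (S u))\<^sup>2"
        by (simp add: positive_op_symmetric[OF S])
      ultimately show ?thesis
        by (simp add: q_def a_def blinfun.add_right blinfun.scaleR_right cinner_add_left cinner_add_right
          cinner_scaleR_left cinner_scaleR_right algebra_simps) (simp add: power2_eq_square)
    qed
    then show ?thesis using q0[of "S u"] r(1) by simp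
  qed
  \<comment> \<open>The squared norm gains at least 2 r \<open>q u\<close> in each step, because
    \<open>q\<close> does not decrease along the iteration: linear growth unless \<open>q u\<close>
    vanishes.\<close>
  have ak: "(norm ((a ^^ k) u))\<^sup>2 \<ge> (norm u)\<^sup>2 + 2 * real k * r * q u \<and> q ((a ^^ k) u) \<ge> q u" for k u
  proof (induction k)
    case (Suc k)
    have "(norm u)\<^sup>2 + 2 * real k * r * q u + 2 * r * q u \<le> (norm ((a ^^ k) u))\<^sup>2 + 2 * r * q ((a ^^ k) u)"
      using Suc r(1) by (intro add_mono) auto
    also have "\<dots> \<le> (norm ((a ^^ Suc k) u))\<^sup>2" using a[of "(a ^^ k) u"] by simp
    finally show ?case using Suc qa[of "(a ^^ k) u"] by (simp add: algebra_simps)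
  qed simp
  have aD: "(a ^^ k) (D u) = D ((b ^^ k) u)" for k u
    by (induction k) (auto simp: a_def b_def SD blinfun.diff_right blinfun.scaleR_right)
  define y where "y = D x"
  have "q y = 0"
  proof (rule ccontr)
    assume "q y \<noteq> 0"
    then have qy: "0 < 2 * r * q y" using q0[of y] r(1) by simp
    obtain k :: nat where k: "(norm D * norm x)\<^sup>2 < real k * (2 * r * q y)"
      using reals_Archimedean3[OF qy] by blast
    have "norm ((a ^^ k) y) \<le> norm D * norm ((b ^^ k) x)"
      unfolding y_def aD by (rule norm_blinfun)
    also have "\<dots> \<le> norm D * norm x" by (intro mult_left_mono bk) auto
    finally have "(norm ((a ^^ k) y))\<^sup>2 \<le> (norm D * norm x)\<^sup>2" by (intro power_mono) auto
    moreover have "real k * (2 * r * q y) \<le> (norm ((a ^^ k) y))\<^sup>2"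
      proof -
      have "real k * (2 * r * q y) = 2 * real k * r * q y" by simp
      then show ?thesis using conjunct1[OF ak[where k=k and u=y]] zero_le_power2[of "norm y"] by linarith
    qed
    ultimately show False using k by linarith
  qed
  \<comment> \<open>Two nonnegative terms with sum 0, so \<open>P y\<close> and \<open>Q y\<close>
    vanish and with them \<open>D y\<close>; then the squared norm of \<open>y = D x\<close> is the
    inner product of \<open>x\<close> with \<open>D y\<close>.\<close>
  then have "Re (cinner y (P y)) + Re (cinner y (Q y)) = 0"
    by (simp add: q_def S_def blinfun.add_left cinner_add_right)
  then have "Re (cinner y (P y)) = 0" "Re (cinner y (Q y)) = 0"
    using positive_op_Re[OF P, of y] positive_op_Re[OF Q, of y] by linarith+
  then have "D y = 0"
    using positive_op_eq_0[OF P, of y] positive_op_eq_0[OF Q, of y] by (simp add: D_def blinfun.diff_left)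
  then have "cinner y y = 0" unfolding y_def by (simp add: Dsym)
  then have "y = 0" by (simp add: cinner_self)
  then show "P x = Q x" by (simp add: y_def D_def blinfun.diff_left)
qed

text \<open>\<open>op_abs\<close> is a \<open>THE\<close>, so this rests on the uniqueness of the
  positive square root.\<close>

lemma op_abs_positive:
  assumes P: "positive_op P" shows "op_abs P = P"
  unfolding op_abs_def
proof (rule the_equality)
  show "positive_op P \<and> (\<forall>u v. cinner u (P (P v)) = cinner (P u) (P v))"
    using P by (simp add: positive_op_symmetric)
next
  fix Q assume Q: "positive_op Q \<and> (\<forall>u v. cinner u (Q (Q v)) = cinner (P u) (P v))"
  have "P (P u) = Q (Q u)" for u
    by (rule cinner_eqI) (use Q in \<open>simp add: positive_op_symmetric[OF P]\<close>)
  then show "Q = P" using positive_sqrt_unique[OF P] Q by metis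
qed

section \<open>The spectral theorem for positive operators of finite trace\<close>

text \<open>Bounded combinations of finitely many vectors stay in a Minkowski sum of images of
  complex discs. This replaces Heine-Borel, which fails in the infinite-dimensional
  \<open>L2\<close>.\<close>

lemma compact_coeff_sums:
  assumes "finite F"
  shows "\<exists>K::L2 set. compact K \<and> (\<forall>z. (\<forall>c\<in>F. cmod (z c) \<le> R) \<longrightarrow> (\<Sum>c\<in>F. scaleC_L2 (z c) c) \<in> K)"
  using assms
proof induction
  case empty
  show ?case by (rule exI[of _ "{0}"]) simp
next
  case (insert c F)
  then obtain K where K: "compact K" "\<And>z. (\<forall>c\<in>F. cmod (z c) \<le> R) \<Longrightarrow> (\<Sum>c\<in>F. scaleC_L2 (z c) c) \<in> K"
    by blast
  have "compact ((\<lambda>z. scaleC_L2 z c) ` cball 0 R)"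
    by (intro compact_continuous_image compact_cball linear_continuous_on bounded_linear_scaleC_left)
  from compact_sums[OF this K(1)]
  have "compact {x + y |x y. x \<in> (\<lambda>z. scaleC_L2 z c) ` cball 0 R \<and> y \<in> K}" .
  moreover have "(\<Sum>c\<in>insert c F. scaleC_L2 (z c) c) \<in> {x + y |x y. x \<in> (\<lambda>z. scaleC_L2 z c) ` cball 0 R \<and> y \<in> K}"
    if "\<forall>c\<in>insert c F. cmod (z c) \<le> R" for z
    using that K(2)[of z] insert.hyps
    by (intro CollectI exI[of _ "scaleC_L2 (z c) c"] exI[of _ "\<Sum>c\<in>F. scaleC_L2 (z c) c"]) auto
  ultimately show ?case by blast
qed

text \<open>Finite trace makes \<open>P\<close> Hilbert-Schmidt: the squared norms of the
  \<open>P c\<close> are bounded by \<open>norm P\<close> times the summable expectation values. So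
  cutting \<open>P u\<close> off to finitely many coordinates is accurate uniformly on the unit
  ball, and the cut-off vectors lie in a compact set.\<close>

lemma compact_image_ball:
  assumes P: "positive_op P" and B: "onb B" and sum: "(\<lambda>e. Re (cinner e (P e))) summable_on B"
  shows "compact (closure (P ` cball 0 1))"
  unfolding compact_eq_totally_bounded
proof (intro conjI allI impI)
  show "complete (closure (P ` cball 0 1))" by (simp add: complete_eq_closed)
  fix \<epsilon> :: real assume \<epsilon>: "0 < \<epsilon>"
  have oB: "orthonormal B" using B by (rule onb_orthonormal)
  define g where "g c = (norm (P c))\<^sup>2" for c
  have g: "g summable_on B"
  proof (rule summable_on_comparison_test)
    show "(\<lambda>c. norm P * Re (cinner c (P c))) summable_on B" by (intro summable_on_cmult_right sum)
  qed (auto simp: g_def positive_op_norm_square_le[OF P])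
  obtain F where F: "finite F" "F \<subseteq> B" "dist (sum g F) (infsum g B) \<le> (\<epsilon>/3)\<^sup>2"
    using infsum_finite_approximation[OF g, of "(\<epsilon>/3)\<^sup>2"] \<epsilon> by auto
  obtain K where K: "compact K" "\<And>z. (\<forall>c\<in>F. cmod (z c) \<le> norm P) \<Longrightarrow> (\<Sum>c\<in>F. scaleC_L2 (z c) c) \<in> K"
    using compact_coeff_sums[OF F(1), of "norm P"] by blast
  have near: "\<exists>y\<in>K. dist y (P u) \<le> \<epsilon> / 3" if u: "norm u \<le> 1" for u
  proof
    let ?y = "\<Sum>c\<in>F. scaleC_L2 (cinner c (P u)) c"
    have Pu: "norm (P u) \<le> norm P"
      using norm_blinfun[of P u] u mult_left_mono[OF u norm_ge_zero[of P]] by simp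
    show "?y \<in> K"
    proof (rule K(2), safe)
      fix c assume "c \<in> F"
      then show "cmod (cinner c (P u)) \<le> norm P"
        using norm_cinner_le[of c "P u"] Pu orthonormal_norm[OF oB, of c] F(2) by auto
    qed
    have "(norm (P u - ?y))\<^sup>2 = (norm (P u))\<^sup>2 - (\<Sum>c\<in>F. (cmod (cinner c (P u)))\<^sup>2)"
      using bessel_finite[OF oB F(1,2), of "P u"] by simp
    also have "\<dots> = (\<Sum>\<^sub>\<infinity>c\<in>B - F. (cmod (cinner c (P u)))\<^sup>2)"
    proof -
      have "((\<lambda>e. (cmod (cinner e (P u)))\<^sup>2) has_sum ((norm (P u))\<^sup>2 - (\<Sum>c\<in>F. (cmod (cinner c (P u)))\<^sup>2))) (B - F)"
        using parseval_norm[OF B, of "P u"] F(1,2) by (intro has_sum_Diff) auto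
      then show ?thesis by (simp add: infsumI)
    qed
    also have "\<dots> \<le> (\<Sum>\<^sub>\<infinity>c\<in>B - F. g c)"
    proof (rule infsum_mono)
      show "(\<lambda>c. (cmod (cinner c (P u)))\<^sup>2) summable_on B - F"
        by (rule summable_on_subset[OF bessel_summable[OF oB]]) auto
      show "g summable_on B - F" by (rule summable_on_subset[OF g]) auto
      fix c assume "c \<in> B - F"
      have "cmod (cinner c (P u)) \<le> norm (P c) * norm u"
        unfolding positive_op_symmetric[OF P, symmetric] by (rule norm_cinner_le)
      also have "\<dots> \<le> norm (P c)" using mult_left_mono[OF u norm_ge_zero[of "P c"]] by simp
      finally show "(cmod (cinner c (P u)))\<^sup>2 \<le> g c" unfolding g_def by (intro power_mono) auto
    qed
    also have "\<dots> = infsum g B - sum g F"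
      using F g by (simp add: infsum_Diff infsum_finite)
    also have "\<dots> \<le> (\<epsilon>/3)\<^sup>2" using F(3) by (simp add: dist_real_def abs_le_iff)
    finally have "norm (P u - ?y) \<le> \<epsilon> / 3"
      by (rule power2_le_imp_le) (use \<epsilon> in simp)
    then show "dist ?y (P u) \<le> \<epsilon> / 3" by (simp only: dist_norm norm_minus_commute)
  qed
  have "\<forall>e>0. \<exists>k. finite k \<and> K \<subseteq> (\<Union>x\<in>k. ball x e)"
    using K(1) by (simp add: compact_eq_totally_bounded)
  then obtain k where k: "finite k" "K \<subseteq> (\<Union>x\<in>k. ball x (\<epsilon>/3))"
    using \<epsilon> by (elim allE[of _ "\<epsilon>/3"]) auto
  \<comment> \<open>One third for the cut-off and one for the finite net. Closed balls of radius 2/3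
    epsilon survive the closure, and the last third makes them open.\<close>
  have "P ` cball 0 1 \<subseteq> (\<Union>x\<in>k. cball x (2*\<epsilon>/3))"
  proof safe
    fix u :: L2 assume "u \<in> cball 0 1"
    then obtain y where y: "y \<in> K" "dist y (P u) \<le> \<epsilon>/3" using near[of u] by auto
    then obtain x where "x \<in> k" "dist x y < \<epsilon>/3" using k(2) by auto
    moreover have "dist x (P u) \<le> dist x y + dist y (P u)" by (rule dist_triangle)
    ultimately show "P u \<in> (\<Union>x\<in>k. cball x (2*\<epsilon>/3))" using y by (intro UN_I[of x]) auto
  qed
  then have "closure (P ` cball 0 1) \<subseteq> (\<Union>x\<in>k. cball x (2*\<epsilon>/3))"
    using k(1) by (intro closure_minimal) auto
  also have "\<dots> \<subseteq> (\<Union>x\<in>k. ball x \<epsilon>)" using \<epsilon> by (intro UN_mono) auto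
  finally show "\<exists>k. finite k \<and> closure (P ` cball 0 1) \<subseteq> (\<Union>x\<in>k. ball x \<epsilon>)" using k(1) by blast
qed

text \<open>Variational principle: \<open>l\<close> is the supremum of the form on the unit sphere
  of the invariant subspace \<open>M\<close>. A maximising sequence is asymptotically an
  eigenvector, and compactness of the image of the ball extracts a limit.\<close>

lemma exists_eigenvector:
  assumes P: "positive_op P" and c: "compact (closure (P ` cball 0 1))"
    and M: "closed M" "subspace M" "\<And>u. u \<in> M \<Longrightarrow> P u \<in> M" and u0: "u0 \<in> M" "u0 \<noteq> 0"
  obtains v l where "v \<in> M" "norm v = 1" "P v = l *\<^sub>R v"
proof -
  define q where "q u = Re (cinner u (P u))" for u
  have q0: "0 \<le> q u" for u unfolding q_def by (rule positive_op_Re[OF P])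
  have qs: "q (t *\<^sub>R u) = t\<^sup>2 * q u" for t u
    by (simp add: q_def blinfun.scaleR_right cinner_scaleR_left cinner_scaleR_right power2_eq_square)
  define X where "X = q ` {u \<in> M. norm u = 1}"
  define l where "l = Sup X"
  have u1: "u0 /\<^sub>R norm u0 \<in> M" "norm (u0 /\<^sub>R norm u0) = 1"
    using u0 M(2) by (auto simp: subspace_scale)
  have qP: "q u \<le> norm P" if "norm u = 1" for u
    using Re_cinner_blinfun_le[of u P] that by (simp add: q_def)
  have X: "X \<noteq> {}" "bdd_above X"
    unfolding X_def using u1 qP by (blast, intro bdd_aboveI2[where M="norm P"]) simp
  have l: "q u \<le> l * (norm u)\<^sup>2" if "u \<in> M" for u
  proof (cases "u = 0")
    case False
    have "q (u /\<^sub>R norm u) \<le> l"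
      unfolding l_def using that False M(2) X(2) by (intro cSup_upper) (auto simp: X_def subspace_scale)
    then show ?thesis using False by (simp add: qs field_simps)
  qed (simp add: q_def)
  have nP: "(norm (P u))\<^sup>2 \<le> l * q u" if "u \<in> M" for u
    unfolding q_def using l[OF M(3)[OF that]] by (intro positive_op_norm_bound[OF P]) (simp add: q_def)
  have l0: "0 \<le> l" using l[OF u1(1)] q0[of "u0 /\<^sub>R norm u0"] unfolding u1(2) by simp
  show ?thesis
  proof (cases "l = 0")
    case True
    \<comment> \<open>A vanishing supremum means \<open>P = 0\<close> on \<open>M\<close>, so every
      unit vector of \<open>M\<close> will do; the limit argument below divides by
      \<open>l\<close>.\<close>
    then have "P (u0 /\<^sub>R norm u0) = 0 *\<^sub>R (u0 /\<^sub>R norm u0)" using nP[OF u1(1)] by simp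
    then show ?thesis using that u1 by blast
  next
    case False
    have "\<exists>u. u \<in> M \<and> norm u = 1 \<and> l - 1 / real (Suc n) < q u" for n :: nat
    proof -
      have "l - 1 / real (Suc n) < Sup X" by (simp add: l_def)
      then show ?thesis using less_cSup_iff[OF X] by (auto simp: X_def)
    qed
    then obtain u where u: "\<And>n::nat. u n \<in> M" "\<And>n. norm (u n) = 1" "\<And>n. l - 1 / real (Suc n) < q (u n)"
      by metis
    have lim0: "(\<lambda>n. P (u n) - l *\<^sub>R u n) \<longlonglongrightarrow> 0"
    proof -
      have "(\<lambda>n. (norm (P (u n) - l *\<^sub>R u n))\<^sup>2) \<longlonglongrightarrow> 0"
      proof (rule tendsto_sandwich[OF _ _ tendsto_const])
        have "(norm (P (u n) - l *\<^sub>R u n))\<^sup>2 \<le> l * (1 / real (Suc n))" for n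
        proof -
          have "inner (P (u n)) (u n) = q (u n)" "inner (u n) (P (u n)) = q (u n)"
            by (simp_all add: q_def inner_L2_def positive_op_symmetric[OF P])
          moreover have "inner (u n) (u n) = 1" using u(2)[of n] by (simp add: norm_eq_1)
          \<comment> \<open>Expanding the square and inserting \<open>nP\<close> leaves l (l - q),
            which the choice of \<open>u n\<close> makes small.\<close>
          ultimately have "(norm (P (u n) - l *\<^sub>R u n))\<^sup>2 = (norm (P (u n)))\<^sup>2 - 2 * l * q (u n) + l * l"
            by (simp add: power2_norm_eq_inner inner_diff_left inner_diff_right algebra_simps)
          also have "\<dots> \<le> l * (l - q (u n))" using nP[OF u(1), of n] by (simp add: algebra_simps)
          also have "\<dots> \<le> l * (1 / real (Suc n))" using u(3)[of n] l0 by (intro mult_left_mono) auto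
          finally show ?thesis .
        qed
        then show "\<forall>\<^sub>F n in sequentially. (norm (P (u n) - l *\<^sub>R u n))\<^sup>2 \<le> l * (1 / real (Suc n))"
          by (intro always_eventually) blast
        show "(\<lambda>n. l * (1 / real (Suc n))) \<longlonglongrightarrow> 0"
          using tendsto_mult_left[OF LIMSEQ_inverse_real_of_nat, of l] by (simp add: inverse_eq_divide)
      qed auto
      from tendsto_real_sqrt[OF this] show ?thesis by (simp add: tendsto_norm_zero_iff)
    qed
    have "\<forall>n. P (u n) \<in> closure (P ` cball 0 1)" using u(2) by (auto intro!: closure_subset[THEN subsetD])
    then obtain w r where w: "strict_mono r" "((\<lambda>n. P (u n)) \<circ> r) \<longlonglongrightarrow> w"
      using c unfolding compact_eq_seq_compact_metric by (auto elim!: seq_compactE)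
    \<comment> \<open>Only the images converge by compactness; \<open>u\<close> itself is recovered
      as P u minus the vanishing defect, divided by \<open>l\<close>.\<close>
    have lim: "(\<lambda>n. u (r n)) \<longlonglongrightarrow> w /\<^sub>R l"
    proof -
      have "(\<lambda>n. (P (u (r n)) - (P (u (r n)) - l *\<^sub>R u (r n))) /\<^sub>R l) \<longlonglongrightarrow> (w - 0) /\<^sub>R l"
        using w(2) LIMSEQ_subseq_LIMSEQ[OF lim0 w(1)] by (intro tendsto_intros) (auto simp: o_def)
      then show ?thesis using False by simp
    qed
    define v where "v = w /\<^sub>R l"
    have "v \<in> M" unfolding v_def by (rule closed_sequentially[OF M(1) _ lim]) (rule u(1))
    moreover have "norm v = 1"
      using tendsto_norm[OF lim] u(2) by (simp add: v_def LIMSEQ_const_iff)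
    moreover have "P v = l *\<^sub>R v"
    proof -
      have "(\<lambda>n. P (u (r n))) \<longlonglongrightarrow> P v" unfolding v_def by (intro tendsto_intros lim)
      then have "P v = w" using w(2) LIMSEQ_unique by (auto simp: o_def)
      then show ?thesis using False by (simp add: v_def)
    qed
    ultimately show ?thesis using that by blast
  qed
qed

text \<open>Zorn on orthonormal sets of eigenvectors. The complement \<open>M\<close> of a maximal
  one is closed and, by symmetry, invariant, so a nonzero \<open>M\<close> would contain an
  eigenvector to add. Writing the eigenvalue as an expectation value gives its sign and summability
  at once.\<close>

lemma spectral_theorem:
  assumes P: "positive_op P" and B: "onb B" and sum: "(\<lambda>e. Re (cinner e (P e))) summable_on B"
  obtains E where "onb E" "\<And>e. e \<in> E \<Longrightarrow> P e = Re (cinner e (P e)) *\<^sub>R e"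
proof -
  define A where "A = {E. orthonormal E \<and> (\<forall>e\<in>E. \<exists>l::real. P e = l *\<^sub>R e)}"
  have "\<exists>E\<in>A. \<forall>X\<in>A. E \<subseteq> X \<longrightarrow> X = E"
  proof (rule subset_Zorn)
    fix C assume C: "subset.chain A C"
    have "\<Union>C \<in> A"
      unfolding A_def
    proof (safe)
      show "orthonormal (\<Union>C)"
        unfolding orthonormal_def
      proof (intro ballI)
        fix e f assume "e \<in> \<Union>C" "f \<in> \<Union>C"
        then obtain X Y where "X \<in> C" "Y \<in> C" "e \<in> X" "f \<in> Y" by blast
        moreover have "X \<subseteq> Y \<or> Y \<subseteq> X" using C calculation by (auto simp: subset.chain_def)
        ultimately obtain Z where "Z \<in> C" "e \<in> Z" "f \<in> Z" by blast
        then show "cinner e f = (if e = f then 1 else 0)"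
          using C by (auto simp: subset.chain_def A_def orthonormal_def)
      qed
    next
      fix e X assume "X \<in> C" "e \<in> X"
      then show "\<exists>l::real. P e = l *\<^sub>R e" using C by (auto simp: subset.chain_def A_def)
    qed
    then show "\<exists>U\<in>A. \<forall>X\<in>C. X \<subseteq> U" by blast
  qed
  then obtain E where E: "orthonormal E" "\<And>e. e \<in> E \<Longrightarrow> \<exists>l::real. P e = l *\<^sub>R e"
    and max: "\<And>X. X \<in> A \<Longrightarrow> E \<subseteq> X \<Longrightarrow> X = E" by (auto simp: A_def)
  define M where "M = {u. \<forall>e\<in>E. cinner e u = 0}"
  have "u = 0" if "u \<in> M" for u
  proof (rule ccontr)
    assume "u \<noteq> 0"
    have "M = (\<Inter>e\<in>E. {u. cinner e u = 0})" by (auto simp: M_def)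
    moreover have "closed {u. cinner e u = 0}" for e
      by (intro closed_Collect_eq linear_continuous_on bounded_linear_cinner_right continuous_on_const)
    ultimately have "closed M" by auto
    moreover have "subspace M"
      by (auto simp: M_def subspace_def cinner_add_right cinner_scaleR_right)
    moreover have "P v \<in> M" if "v \<in> M" for v
      unfolding M_def
    proof safe
      fix e assume e: "e \<in> E"
      then obtain l :: real where "P e = l *\<^sub>R e" using E(2) by blast
      then have "cinner e (P v) = of_real l * cinner e v"
        by (simp add: positive_op_symmetric[OF P, symmetric] cinner_scaleR_left)
      then show "cinner e (P v) = 0" using that e by (simp add: M_def)
    qed
    ultimately obtain v l where v: "v \<in> M" "norm v = 1" "P v = l *\<^sub>R v"
      using exists_eigenvector[OF P compact_image_ball[OF P B sum] _ _ _ \<open>u \<in> M\<close> \<open>u \<noteq> 0\<close>] by blast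
    have vE: "cinner e v = 0" "cinner v e = 0" if "e \<in> E" for e
      using v(1) that cinner_commute[of e v] by (auto simp: M_def)
    have "insert v E \<in> A"
    proof -
      have "cinner v v = 1" by (simp add: cinner_self v(2))
      moreover have "v \<notin> E" using vE(1)[of v] calculation by auto
      ultimately show ?thesis using E v(3) vE unfolding A_def orthonormal_def by auto
    qed
    then have "v \<in> E" using max[of "insert v E"] by blast
    then show False using vE[of v] v(2) by (simp add: cinner_self)
  qed
  then have "onb E" using E(1) by (auto simp: onb_def orthonormal_def M_def)
  moreover have "P e = Re (cinner e (P e)) *\<^sub>R e" if e: "e \<in> E" for e
  proof -
    obtain l :: real where l: "P e = l *\<^sub>R e" using E(2) e by blast
    then have "cinner e (P e) = of_real l"
      using orthonormal_norm[OF E(1) e] by (simp add: cinner_scaleR_right cinner_self)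
    then show ?thesis using l by simp
  qed
  ultimately show ?thesis using that by blast
qed

text \<open>\<open>trace_class\<close> demands summability in every basis, hence also in the
  eigenbasis, where it reads as summability of the eigenvalues; \<open>B\<close> only starts the
  spectral theorem.\<close>

lemma trace_class_eigenbasis:
  assumes P: "positive_op P" and tc: "trace_class P" and B: "onb B"
  obtains E \<mu> where "onb E" "\<And>e. e \<in> E \<Longrightarrow> P e = \<mu> e *\<^sub>R e" "\<And>e. 0 \<le> \<mu> e" "\<mu> summable_on E"
proof -
  have s: "(\<lambda>e. Re (cinner e (P e))) summable_on X" if "onb X" for X
    using tc that by (intro summable_on_Re) (auto simp: trace_class_def op_abs_positive[OF P])
  obtain E where "onb E" "\<And>e. e \<in> E \<Longrightarrow> P e = Re (cinner e (P e)) *\<^sub>R e"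
    using spectral_theorem[OF P B s[OF B]] by blast
  then show ?thesis using that[of E "\<lambda>e. Re (cinner e (P e))"] s positive_op_Re[OF P] by blast
qed

section \<open>Traces and functional calculus\<close>

text \<open>Basis independence of the trace: the double series over E and B is absolutely summable
  by xy <= x^2 + y^2 and Parseval in both factors, so the order of summation may be exchanged.
  \<open>Y\<close> is the identity for functions of an operator and a bounded operator for
  products.\<close>

lemma has_sum_trace_diag:
  assumes E: "onb E" and B: "onb B" and a: "(\<lambda>e. cmod (a e)) summable_on E"
    and Y: "\<And>e. e \<in> E \<Longrightarrow> norm (Y e) \<le> C"
    and Q: "\<And>x u. ((\<lambda>e. a e * cinner e u * cinner x (Y e)) has_sum cinner x (Q u)) E"
  shows "((\<lambda>b. cinner b (Q b)) has_sum (\<Sum>\<^sub>\<infinity>e\<in>E. a e * cinner e (Y e))) B"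
proof -
  define f where "f = (\<lambda>(e,b). a e * cinner e b * cinner b (Y e))"
  have inner: "((\<lambda>b. f (e, b)) has_sum a e * cinner e (Y e)) B" for e
    using has_sum_cmult_right[OF parseval[OF B, of e "Y e"], of "a e"] by (simp add: f_def mult.assoc)
  have g: "((\<lambda>b. cmod (a e) * ((cmod (cinner b e))\<^sup>2 + (cmod (cinner b (Y e)))\<^sup>2))
      has_sum cmod (a e) * ((norm e)\<^sup>2 + (norm (Y e))\<^sup>2)) B" for e
    by (intro has_sum_cmult_right has_sum_add parseval_norm[OF B])
  have fg: "norm (f (e, b)) \<le> cmod (a e) * ((cmod (cinner b e))\<^sup>2 + (cmod (cinner b (Y e)))\<^sup>2)" for e b
  proof -
    have "cmod (cinner e b) = cmod (cinner b e)" by (metis cinner_commute complex_mod_cnj)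
    moreover have "x * y \<le> x\<^sup>2 + y\<^sup>2" if "0 \<le> x" "0 \<le> y" for x y :: real
      using sum_squares_bound[of x y] mult_nonneg_nonneg[OF that] by linarith
    ultimately show ?thesis by (auto simp: f_def norm_mult mult.assoc intro!: mult_left_mono)
  qed
  have n: "(\<lambda>b. norm (f (e, b))) summable_on B" for e
    by (rule summable_on_comparison_test[OF has_sum_imp_summable[OF g]]) (auto intro: fg)
  have "(\<lambda>x. norm (f x)) summable_on E \<times> B"
    unfolding Infinite_Sum.abs_summable_on_Sigma_iff
  proof (intro conjI ballI)
    show "(\<lambda>e. norm (\<Sum>\<^sub>\<infinity>b\<in>B. norm (f (e, b)))) summable_on E"
    proof (rule Infinite_Sum.abs_summable_on_comparison_test')
      show "(\<lambda>e. cmod (a e) * (1 + C\<^sup>2)) summable_on E" by (intro summable_on_cmult_left a)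
      fix e assume e: "e \<in> E"
      have "(\<Sum>\<^sub>\<infinity>b\<in>B. norm (f (e, b))) \<le> cmod (a e) * ((norm e)\<^sup>2 + (norm (Y e))\<^sup>2)"
        using infsum_mono[OF n has_sum_imp_summable[OF g] fg] infsumI[OF g] by metis
      also have "\<dots> \<le> cmod (a e) * (1 + C\<^sup>2)"
        using onb_norm[OF E e] Y[OF e]
        by (intro mult_left_mono add_mono power_mono) auto
      finally show "norm (\<Sum>\<^sub>\<infinity>b\<in>B. norm (f (e, b))) \<le> cmod (a e) * (1 + C\<^sup>2)"
        by (simp add: infsum_nonneg)
    qed
  qed (rule n)
  then have "f summable_on E \<times> B" by (rule abs_summable_summable)
  then have S: "(f has_sum infsum f (E \<times> B)) (E \<times> B)" by simp
  have "((\<lambda>e. a e * cinner e (Y e)) has_sum infsum f (E \<times> B)) E"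
    by (rule has_sum_SigmaD[OF S]) (rule inner)
  then have eq: "infsum f (E \<times> B) = (\<Sum>\<^sub>\<infinity>e\<in>E. a e * cinner e (Y e))" by (simp add: infsumI)
  have "((\<lambda>(b, e). f (e, b)) has_sum infsum f (E \<times> B)) (B \<times> E)"
    using S by (subst (asm) has_sum_swap)
  then have "((\<lambda>b. cinner b (Q b)) has_sum infsum f (E \<times> B)) B"
    by (rule has_sum_SigmaD) (use Q in \<open>simp add: f_def\<close>)
  then show ?thesis by (simp add: eq)
qed

text \<open>The basis \<open>E\<close> witnesses that bases exist; otherwise the condition inside
  the \<open>THE\<close> of \<open>op_trace\<close> would be vacuous and not determine a
  value.\<close>

lemma op_traceI:
  assumes "onb E" "\<And>B. onb B \<Longrightarrow> ((\<lambda>b. cinner b (Q b)) has_sum z) B"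
  shows "op_trace Q = z"
  unfolding op_trace_def
proof (rule the_equality)
  show "z' = z" if "\<forall>B. onb B \<longrightarrow> ((\<lambda>e. cinner e (Q e)) has_sum z') B" for z'
    using that assms has_sum_unique by metis
qed (use assms in blast)

lemma eigenbasis_coeff:
  assumes P: "positive_op P" and e: "P e = \<mu> *\<^sub>R e"
  shows "cinner e (P u) = of_real \<mu> * cinner e u"
  using e by (simp add: positive_op_symmetric[OF P, symmetric] cinner_scaleR_left)

lemma op_trace_comp:
  assumes P: "positive_op P" and E: "onb E" and eig: "\<And>e. e \<in> E \<Longrightarrow> P e = \<mu> e *\<^sub>R e"
    and \<mu>: "\<And>e. 0 \<le> \<mu> e" "\<mu> summable_on E"
    and M: "bounded_linear M" "\<And>c u. M (scaleC_L2 c u) = scaleC_L2 c (M u)"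
  shows "op_trace (\<lambda>u. M (P u)) = (\<Sum>\<^sub>\<infinity>e\<in>E. of_real (\<mu> e) * cinner e (M e))"
proof (rule op_traceI[OF E])
  fix B assume B: "onb B"
  obtain C where C: "\<And>u. norm (M u) \<le> norm u * C" using bounded_linear.bounded[OF M(1)] by blast
  show "((\<lambda>b. cinner b (M (P b))) has_sum (\<Sum>\<^sub>\<infinity>e\<in>E. of_real (\<mu> e) * cinner e (M e))) B"
  proof (rule has_sum_trace_diag[OF E B])
    show "(\<lambda>e. cmod (of_real (\<mu> e))) summable_on E" using \<mu> by simp
    show "norm (M e) \<le> C" if "e \<in> E" for e
      using C[of e] onb_norm[OF E that] by simp
    show "((\<lambda>e. of_real (\<mu> e) * cinner e u * cinner x (M e)) has_sum cinner x (M (P u))) E" for x u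
    proof -
      have "((\<lambda>e. cinner x (M (scaleC_L2 (cinner e (P u)) e))) has_sum cinner x (M (P u))) E"
        by (rule has_sum_bounded_linear[OF bounded_linear_compose[OF bounded_linear_cinner_right M(1)] onb_expansion[OF E]])
      then show ?thesis
        by (rule has_sum_cong[THEN iffD1, rotated]) (simp add: M(2) cinner_scaleC_right eigenbasis_coeff[OF P eig])
    qed
  qed
qed

lemma has_sum_trace_eigenbasis:
  assumes P: "positive_op P" and E: "onb E" and eig: "\<And>e. e \<in> E \<Longrightarrow> P e = \<mu> e *\<^sub>R e"
    and \<mu>: "\<And>e. 0 \<le> \<mu> e" "\<mu> summable_on E" and B: "onb B"
  shows "((\<lambda>b. cinner b (P b)) has_sum of_real (infsum \<mu> E)) B"
proof -
  have "((\<lambda>b. cinner b (P b)) has_sum (\<Sum>\<^sub>\<infinity>e\<in>E. of_real (\<mu> e) * cinner e e)) B"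
  proof (rule has_sum_trace_diag[OF E B, where C=1])
    show "((\<lambda>e. of_real (\<mu> e) * cinner e u * cinner x e) has_sum cinner x (P u)) E" for x u
      by (rule has_sum_cong[THEN iffD1, OF _ parseval[OF E]]) (simp add: eigenbasis_coeff[OF P eig])
  qed (use \<mu> onb_norm[OF E] in auto)
  moreover have "(\<Sum>\<^sub>\<infinity>e\<in>E. of_real (\<mu> e) * cinner e e) = (\<Sum>\<^sub>\<infinity>e\<in>E. complex_of_real (\<mu> e))"
    by (rule infsum_cong) (use E in \<open>simp add: onb_def\<close>)
  moreover have "\<dots> = of_real (infsum \<mu> E)"
    by (rule infsumI[OF has_sum_of_real[OF has_sum_infsum[OF \<mu>(2)]]])
  ultimately show ?thesis by simp
qed

lemma op_trace_eigenbasis: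
  assumes "positive_op P" and E: "onb E" and "\<And>e. e \<in> E \<Longrightarrow> P e = \<mu> e *\<^sub>R e"
    and "\<And>e. 0 \<le> \<mu> e" "\<mu> summable_on E"
  shows "op_trace P = of_real (infsum \<mu> E)"
  by (rule op_traceI[OF E has_sum_trace_eigenbasis[OF assms]])

lemma op_trace_onb:
  assumes "positive_op P" "onb E" "\<And>e. e \<in> E \<Longrightarrow> P e = \<mu> e *\<^sub>R e"
    and "\<And>e. 0 \<le> \<mu> e" "\<mu> summable_on E" "onb B"
  shows "((\<lambda>b. Re (cinner b (P b))) has_sum infsum \<mu> E) B"
  using has_sum_Re[OF has_sum_trace_eigenbasis[OF assms]] by simp

text \<open>Single-valuedness: eigenvectors to different eigenvalues are orthogonal, so two eigenbases give the
  same coefficients.\<close>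

lemma fun_calc_iff:
  assumes E: "onb E" and eig: "\<And>e. e \<in> E \<Longrightarrow> (e, l e *\<^sub>R e) \<in> R"
    and orth: "\<And>a b s t. (a, s *\<^sub>R a) \<in> R \<Longrightarrow> (b, t *\<^sub>R b) \<in> R \<Longrightarrow> s \<noteq> t \<Longrightarrow> cinner a b = 0"
  shows "(u, v) \<in> fun_calc f R \<longleftrightarrow> (\<forall>e\<in>E. cinner e v = of_real (f (l e)) * cinner e u)"
proof
  assume "(u, v) \<in> fun_calc f R"
  then obtain B l' where B: "onb B"
    and B': "\<And>b. b \<in> B \<Longrightarrow> (b, l' b *\<^sub>R b) \<in> R" "\<And>b. b \<in> B \<Longrightarrow> cinner b v = of_real (f (l' b)) * cinner b u"
    unfolding fun_calc_def by blast
  show "\<forall>e\<in>E. cinner e v = of_real (f (l e)) * cinner e u"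
  proof
    fix e assume e: "e \<in> E"
    have "((\<lambda>b. of_real (f (l e)) * (cinner e b * cinner b u)) has_sum of_real (f (l e)) * cinner e u) B"
      by (intro has_sum_cmult_right parseval[OF B])
    moreover have "of_real (f (l e)) * (cinner e b * cinner b u) = cinner e b * cinner b v" if "b \<in> B" for b
    proof (cases "cinner e b = 0")
      case False
      then have "l e = l' b" using orth[OF eig[OF e] B'(1)[OF that]] by blast
      then show ?thesis using B'(2)[OF that] by simp
    qed simp
    ultimately have "((\<lambda>b. cinner e b * cinner b v) has_sum of_real (f (l e)) * cinner e u) B"
      by (simp cong: has_sum_cong)
    then show "cinner e v = of_real (f (l e)) * cinner e u"
      using parseval[OF B] has_sum_unique by blast
  qed
qed (use E eig in \<open>auto simp: fun_calc_def\<close>)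

lemma op_graph_iff: "(u, v) \<in> op_graph P \<longleftrightarrow> v = P u"
  by (auto simp: op_graph_def)

lemma orthogonal_if_symmetric:
  assumes "cinner (s *\<^sub>R a) b = cinner a (t *\<^sub>R b)" "s \<noteq> t"
  shows "cinner a b = 0"
proof -
  have "complex_of_real (s - t) * cinner a b = 0"
    using assms(1) by (simp add: cinner_scaleR_left cinner_scaleR_right left_diff_distrib)
  then show ?thesis using assms(2) by simp
qed

lemma has_sum_abs_le_infsum:
  fixes f :: "'a \<Rightarrow> real"
  assumes "(\<lambda>x. \<bar>f x\<bar>) summable_on A" "x \<in> A"
  shows "\<bar>f x\<bar> \<le> (\<Sum>\<^sub>\<infinity>x\<in>A. \<bar>f x\<bar>)"
  using finite_sum_le_infsum[OF assms(1), of "{x}"] assms(2) by simp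

text \<open>Absolute summability makes the values \<open>f (\<mu> e)\<close> bounded, so the
  functional calculus is defined at every \<open>u\<close> and \<open>graph_apply\<close> is
  determined; the same summability gives the trace.\<close>

lemma op_trace_fun_calc:
  assumes P: "positive_op P" and E: "onb E" and eig: "\<And>e. e \<in> E \<Longrightarrow> P e = \<mu> e *\<^sub>R e"
    and f: "(\<lambda>e. \<bar>f (\<mu> e)\<bar>) summable_on E"
  shows "op_trace (graph_apply (fun_calc f (op_graph P))) = of_real (\<Sum>\<^sub>\<infinity>e\<in>E. f (\<mu> e))"
proof -
  have iff: "(u, v) \<in> fun_calc f (op_graph P) \<longleftrightarrow> (\<forall>e\<in>E. cinner e v = of_real (f (\<mu> e)) * cinner e u)" for u v
  proof (rule fun_calc_iff[OF E])
    show "(e, \<mu> e *\<^sub>R e) \<in> op_graph P" if "e \<in> E" for e using eig[OF that] by (simp add: op_graph_iff)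
    show "cinner a b = 0" if "(a, s *\<^sub>R a) \<in> op_graph P" "(b, t *\<^sub>R b) \<in> op_graph P" "s \<noteq> t" for a b s t
      by (rule orthogonal_if_symmetric[OF _ that(3)])
         (use that positive_op_symmetric[OF P, of a b] in \<open>simp add: op_graph_iff\<close>)
  qed
  define G where "G = graph_apply (fun_calc f (op_graph P))"
  define C where "C = (\<Sum>\<^sub>\<infinity>e\<in>E. \<bar>f (\<mu> e)\<bar>)"
  have G: "cinner e (G u) = of_real (f (\<mu> e)) * cinner e u" if "e \<in> E" for e u
  proof -
    have "(\<lambda>e. (cmod (of_real (f (\<mu> e)) * cinner e u))\<^sup>2) summable_on E"
    proof (rule summable_on_comparison_test)
      show "(\<lambda>e. C\<^sup>2 * (cmod (cinner e u))\<^sup>2) summable_on E"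
        by (intro summable_on_cmult_right bessel_summable onb_orthonormal E)
      fix e assume "e \<in> E"
      then have "\<bar>f (\<mu> e)\<bar> \<le> C" unfolding C_def by (rule has_sum_abs_le_infsum[OF f])
      from power_mono[OF this, of 2] show "(cmod (of_real (f (\<mu> e)) * cinner e u))\<^sup>2 \<le> C\<^sup>2 * (cmod (cinner e u))\<^sup>2"
        by (simp add: norm_mult power_mult_distrib mult_right_mono)
    qed auto
    then obtain v where v: "\<And>e. e \<in> E \<Longrightarrow> cinner e v = of_real (f (\<mu> e)) * cinner e u"
      by (rule onb_exists_coeff[OF E]) blast
    have "G u = v"
      unfolding G_def graph_apply_def iff
    proof (rule the_equality)
      fix w assume "\<forall>e\<in>E. cinner e w = of_real (f (\<mu> e)) * cinner e u"
      then show "w = v" by (intro onb_eqI[OF E]) (simp add: v)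
    qed (use v in blast)
    then show ?thesis using v that by simp
  qed
  have "op_trace G = (\<Sum>\<^sub>\<infinity>e\<in>E. of_real (f (\<mu> e)) * cinner e e)"
  proof (rule op_traceI[OF E], rule has_sum_trace_diag[OF E, where C=1])
    show "((\<lambda>e. of_real (f (\<mu> e)) * cinner e u * cinner x e) has_sum cinner x (G u)) E" for x u
      by (rule has_sum_cong[THEN iffD1, OF _ parseval[OF E]]) (simp add: G)
  qed (use f onb_norm[OF E] in auto)
  also have "\<dots> = (\<Sum>\<^sub>\<infinity>e\<in>E. of_real (f (\<mu> e)))"
    by (rule infsum_cong) (use E in \<open>simp add: onb_def\<close>)
  also have "\<dots> = of_real (\<Sum>\<^sub>\<infinity>e\<in>E. f (\<mu> e))"
  proof -
    have "(\<lambda>e. f (\<mu> e)) summable_on E" by (rule abs_summable_summable) (use f in simp)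
    then show ?thesis by (intro infsumI has_sum_of_real has_sum_infsum)
  qed
  finally show ?thesis by (simp add: G_def)
qed

section \<open>Multiplication operators\<close>

lemma L2_fun_mult_Linf:
  fixes f :: "real \<Rightarrow> complex"
  assumes \<phi>: "\<phi> \<in> Linf_fun" and f: "f \<in> L2_fun"
  shows "(\<lambda>x. of_real (\<phi> x) * f x) \<in> L2_fun"
proof -
  obtain C where C: "AE x in Omega. \<bar>\<phi> x\<bar> \<le> C" using \<phi> by (auto simp: Linf_fun_def)
  have [measurable]: "\<phi> \<in> borel_measurable Omega" "f \<in> borel_measurable Omega"
    using assms by (auto simp: Linf_fun_def L2_fun_def)
  have "integrable Omega (\<lambda>x. (norm (of_real (\<phi> x) * f x))\<^sup>2)"
  proof (rule Bochner_Integration.integrable_bound)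
    show "integrable Omega (\<lambda>x. C\<^sup>2 * (norm (f x))\<^sup>2)" using f by (auto simp: L2_fun_def)
    show "AE x in Omega. norm ((norm (of_real (\<phi> x) * f x))\<^sup>2) \<le> norm (C\<^sup>2 * (norm (f x))\<^sup>2)"
      using C
    proof eventually_elim
      fix x assume "\<bar>\<phi> x\<bar> \<le> C"
      from power_mono[OF this, of 2] show "norm ((norm (of_real (\<phi> x) * f x))\<^sup>2) \<le> norm (C\<^sup>2 * (norm (f x))\<^sup>2)"
        by (simp add: norm_mult power_mult_distrib mult_right_mono)
    qed
  qed measurable
  then show ?thesis by (simp add: L2_fun_def)
qed

lemma L2_cases:
  obtains f where "u = abs_L2 f" "f \<in> L2_fun"
  using that[of "rep_L2 u"] by simp

lemma mult_op_abs:
  assumes \<phi>: "\<phi> \<in> Linf_fun" and f: "f \<in> L2_fun"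
  shows "mult_op \<phi> (abs_L2 f) = abs_L2 (\<lambda>x. of_real (\<phi> x) * f x)"
  unfolding mult_op_def
  by (subst abs_L2_eq_iff) (use rep_abs_L2[OF f] f \<phi> in \<open>auto intro!: L2_fun_mult_Linf\<close>)

lemma mult_op_scaleC: "\<phi> \<in> Linf_fun \<Longrightarrow> mult_op \<phi> (scaleC_L2 c u) = scaleC_L2 c (mult_op \<phi> u)"
  by (cases u rule: L2_cases)
     (simp add: scaleC_abs mult_op_abs L2_fun_scaleC L2_fun_mult_Linf mult.left_commute)

lemma mult_op_add: "\<phi> \<in> Linf_fun \<Longrightarrow> mult_op \<phi> (u + v) = mult_op \<phi> u + mult_op \<phi> v"
  by (cases u rule: L2_cases; cases v rule: L2_cases)
     (simp add: plus_abs mult_op_abs L2_fun_add L2_fun_mult_Linf distrib_left)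

lemma norm_mult_op_le:
  assumes \<phi>: "\<phi> \<in> Linf_fun" and C: "AE x in Omega. \<bar>\<phi> x\<bar> \<le> C" and C0: "0 \<le> C"
  shows "norm (mult_op \<phi> u) \<le> C * norm u"
proof -
  let ?f = "rep_L2 u"
  have "(norm (mult_op \<phi> u))\<^sup>2 = (LINT x|Omega. (norm (of_real (\<phi> x) * ?f x))\<^sup>2)"
    unfolding mult_op_def by (rule norm_abs_L2[OF L2_fun_mult_Linf[OF \<phi> rep_L2_mem]])
  also have "\<dots> \<le> (LINT x|Omega. C\<^sup>2 * (norm (?f x))\<^sup>2)"
  proof (rule integral_mono_AE)
    show "integrable Omega (\<lambda>x. (norm (of_real (\<phi> x) * ?f x))\<^sup>2)"
      using L2_fun_mult_Linf[OF \<phi> rep_L2_mem] by (simp add: L2_fun_def)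
    show "integrable Omega (\<lambda>x. C\<^sup>2 * (norm (?f x))\<^sup>2)"
      using rep_L2_mem[of u] unfolding L2_fun_def by auto
    show "AE x in Omega. (norm (of_real (\<phi> x) * ?f x))\<^sup>2 \<le> C\<^sup>2 * (norm (?f x))\<^sup>2"
      using C
    proof eventually_elim
      fix x assume "\<bar>\<phi> x\<bar> \<le> C"
      from power_mono[OF this, of 2] show "(norm (of_real (\<phi> x) * ?f x))\<^sup>2 \<le> C\<^sup>2 * (norm (?f x))\<^sup>2"
        by (simp add: norm_mult power_mult_distrib mult_right_mono)
    qed
  qed
  also have "\<dots> = (C * norm u)\<^sup>2"
    using norm_abs_L2[OF rep_L2_mem, of u] by (simp add: power_mult_distrib)
  finally show ?thesis by (rule power2_le_imp_le) (use C0 in simp)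
qed

lemma bounded_linear_mult_op:
  assumes \<phi>: "\<phi> \<in> Linf_fun" shows "bounded_linear (mult_op \<phi>)"
proof -
  obtain C where C: "AE x in Omega. \<bar>\<phi> x\<bar> \<le> C" using \<phi> by (auto simp: Linf_fun_def)
  then have C': "AE x in Omega. \<bar>\<phi> x\<bar> \<le> max C 0" by eventually_elim auto
  show ?thesis
  proof (rule bounded_linear_intro)
    show "mult_op \<phi> (r *\<^sub>R u) = r *\<^sub>R mult_op \<phi> u" for r u
      using mult_op_scaleC[OF \<phi>, of "of_real r" u] by (simp add: scaleC_of_real)
    show "norm (mult_op \<phi> u) \<le> norm u * max C 0" for u
      using norm_mult_op_le[OF \<phi> C', of u] by (simp add: mult.commute)
  qed (rule mult_op_add[OF \<phi>])
qed

lemma cinner_mult_op_self: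
  assumes \<phi>: "\<phi> \<in> Linf_fun"
  shows "cinner u (mult_op \<phi> u) = of_real (LINT x|Omega. \<phi> x * (cmod (rep_L2 u x))\<^sup>2)"
proof -
  have "cinner u (mult_op \<phi> u) = (LINT x|Omega. cnj (rep_L2 u x) * (of_real (\<phi> x) * rep_L2 u x))"
    using cinner_abs[OF rep_L2_mem[of u] L2_fun_mult_Linf[OF \<phi> rep_L2_mem[of u]]]
    by (simp add: mult_op_def)
  also have "\<dots> = (LINT x|Omega. complex_of_real (\<phi> x * (cmod (rep_L2 u x))\<^sup>2))"
    by (intro Bochner_Integration.integral_cong refl)
       (simp add: complex_norm_square mult_ac del: of_real_power)
  finally show ?thesis by (simp only: integral_complex_of_real)
qed

lemma mult_op_symmetric:
  assumes \<phi>: "\<phi> \<in> Linf_fun"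
  shows "cinner (mult_op \<phi> u) v = cinner u (mult_op \<phi> v)"
proof -
  have "cinner u (mult_op \<phi> v) = (LINT x|Omega. cnj (rep_L2 u x) * (of_real (\<phi> x) * rep_L2 v x))"
    using cinner_abs[OF rep_L2_mem[of u] L2_fun_mult_Linf[OF \<phi> rep_L2_mem[of v]]] by (simp add: mult_op_def)
  moreover have "cinner (mult_op \<phi> u) v = (LINT x|Omega. cnj (of_real (\<phi> x) * rep_L2 u x) * rep_L2 v x)"
    using cinner_abs[OF L2_fun_mult_Linf[OF \<phi> rep_L2_mem[of u]] rep_L2_mem[of v]] by (simp add: mult_op_def)
  ultimately show ?thesis by (simp add: mult_ac)
qed

section \<open>Weak derivatives on the unit interval\<close>

interpretation Omega: finite_measure Omega
  by (rule finite_measure_lebesgue_on) simp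

lemma AE_OmegaI: "AE x in lebesgue. P x \<Longrightarrow> AE x in Omega. P x"
  by (subst AE_restrict_space_iff) (auto elim: eventually_mono)

lemma AE_Omega_neq: "AE x in Omega. x \<noteq> (c::real)"
  by (intro AE_OmegaI AE_completion AE_lborel_singleton)

lemma AE_Omega_interior: "AE x in Omega. 0 < x \<and> x < 1"
proof -
  have "AE x in Omega. x \<in> {0..1}" by (intro AE_I2) simp
  with AE_Omega_neq[of 0] AE_Omega_neq[of 1] show ?thesis by eventually_elim auto
qed

lemma continuous_Omega_measurable:
  fixes f :: "real \<Rightarrow> 'a::euclidean_space"
  shows "continuous_on {0..1} f \<Longrightarrow> f \<in> borel_measurable Omega"
  by (rule continuous_imp_measurable_on_sets_lebesgue) auto

lemma continuous_Omega_integrable: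
  fixes f :: "real \<Rightarrow> 'a::euclidean_space"
  shows "continuous_on {0..1} f \<Longrightarrow> integrable Omega f"
  by (rule continuous_imp_integrable_real)

lemma id_Omega_measurable [measurable]: "(\<lambda>x. x) \<in> borel_measurable Omega"
  by (rule continuous_Omega_measurable) simp

text \<open>\<open>weak_deriv\<close> integrates over the open interval, the norms over the closed
  one; the end points are null.\<close>

lemma integral_open_Omega:
  fixes f :: "real \<Rightarrow> 'a::{banach,second_countable_topology}"
  assumes [measurable]: "f \<in> borel_measurable Omega"
  shows "(LINT x|lebesgue_on {0<..<1}. f x) = (LINT x|Omega. f x)"
proof -
  have m: "(\<lambda>x. indicator {0..1} x *\<^sub>R f x) \<in> borel_measurable lebesgue"
    using assms by (simp add: borel_measurable_restrict_space_iff)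
  have "(\<lambda>x. indicator {0<..<1} x *\<^sub>R (indicator {0..1} x *\<^sub>R f x)) \<in> borel_measurable lebesgue"
    by (rule borel_measurable_scaleR[OF borel_measurable_indicator m]) simp
  moreover have "(\<lambda>x. indicator {0<..<1} x *\<^sub>R (indicator {0..1} x *\<^sub>R f x)) = (\<lambda>x::real. indicator {0<..<1} x *\<^sub>R f x)"
    by (auto simp: indicator_def)
  ultimately have m': "(\<lambda>x. indicator {0<..<1} x *\<^sub>R f x) \<in> borel_measurable lebesgue" by simp
  have "AE x in lebesgue. x \<noteq> (0::real)" "AE x in lebesgue. x \<noteq> (1::real)"
    by (intro AE_completion AE_lborel_singleton)+
  then have "AE x in lebesgue. indicator {0<..<1} x *\<^sub>R f x = indicator {0..1} x *\<^sub>R f x"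
    by eventually_elim (auto simp: indicator_def)
  then have "(LINT x|lebesgue. indicator {0<..<1} x *\<^sub>R f x) = (LINT x|lebesgue. indicator {0..1} x *\<^sub>R f x)"
    by (rule integral_cong_AE[OF m' m])
  moreover have "(LINT x|lebesgue_on {0<..<1}. f x) = (LINT x|lebesgue. indicator {0<..<1} x *\<^sub>R f x)"
    by (rule integral_restrict_space) simp
  moreover have "(LINT x|Omega. f x) = (LINT x|lebesgue. indicator {0..1} x *\<^sub>R f x)"
    by (rule integral_restrict_space) simp
  ultimately show ?thesis by (simp only:)
qed

text \<open>Approximate sgn k by continuous functions, clip them to [-1,1] and cut them off near the
  end points; dominated convergence turns the vanishing integrals into that of |k|.\<close>

lemma AE_zero_if_orthogonal_continuous:
  fixes k :: "real \<Rightarrow> real"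
  assumes k: "integrable Omega k"
    and z: "\<And>\<psi> c d. continuous_on UNIV \<psi> \<Longrightarrow> 0 < c \<Longrightarrow> d < 1 \<Longrightarrow> (\<And>x. x \<notin> {c..d} \<Longrightarrow> \<psi> x = 0) \<Longrightarrow>
      (LINT x|Omega. \<psi> x * k x) = 0"
  shows "AE x in Omega. k x = 0"
proof -
  have [measurable]: "k \<in> borel_measurable Omega" using k by simp
  have "(\<lambda>x. sgn (k x)) \<in> borel_measurable Omega" by measurable
  then have "(\<lambda>x. indicator {0..1} x *\<^sub>R sgn (k x)) \<in> borel_measurable lebesgue"
    by (simp add: borel_measurable_restrict_space_iff)
  then have "(\<lambda>x. indicator {0..1} x *\<^sub>R sgn (k x)) measurable_on UNIV"
    by (simp add: lebesgue_measurable_imp_measurable_on)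
  then obtain N g where N: "negligible N" and g: "\<And>n. continuous_on UNIV (g n)"
    "\<And>x. x \<notin> N \<Longrightarrow> (\<lambda>n. g n x) \<longlonglongrightarrow> indicator {0..1} x *\<^sub>R sgn (k x)"
    unfolding measurable_on_def by auto
  \<comment> \<open>The cut-off vanishes within 1/(n+1) of an end point and equals 1 at distance
    2/(n+1) or more from both.\<close>
  define \<eta> where "\<eta> n x = max 0 (min 1 (real (Suc n) * x - 1)) * max 0 (min 1 (real (Suc n) * (1 - x) - 1))" for n x
  define \<psi> where "\<psi> n x = max (-1) (min 1 (g n x)) * \<eta> n x" for n x
  have c\<psi>: "continuous_on UNIV (\<psi> n)" for n
    unfolding \<psi>_def \<eta>_def by (intro continuous_intros g(1))
  then have [measurable]: "\<psi> n \<in> borel_measurable Omega" for n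
    by (intro continuous_Omega_measurable) (auto intro: continuous_on_subset)
  have zero: "(LINT x|Omega. \<psi> n x * k x) = 0" for n
  proof (rule z[OF c\<psi>, of "1 / real (Suc n)" "1 - 1 / real (Suc n)"])
    fix x assume "x \<notin> {1 / real (Suc n)..1 - 1 / real (Suc n)}"
    then have "real (Suc n) * x < 1 \<or> real (Suc n) * (1 - x) < 1"
      by (auto simp: not_le field_simps simp del: of_nat_Suc)
    then show "\<psi> n x = 0" by (auto simp: \<psi>_def \<eta>_def)
  qed auto
  have \<eta>: "\<bar>\<eta> n x\<bar> \<le> 1" for n x
    unfolding \<eta>_def abs_mult by (intro mult_le_one) auto
  have bnd: "\<bar>\<psi> n x\<bar> \<le> 1" for n x
    unfolding \<psi>_def abs_mult by (intro mult_le_one \<eta>) auto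
  have "AE x in Omega. x \<notin> N"
    using N by (intro AE_OmegaI AE_not_in) (simp add: negligible_iff_null_sets)
  with AE_Omega_interior have lim: "AE x in Omega. (\<lambda>n. \<psi> n x * k x) \<longlonglongrightarrow> \<bar>k x\<bar>"
  proof eventually_elim
    fix x :: real assume x: "0 < x \<and> x < 1" "x \<notin> N"
    have ev: "\<forall>\<^sub>F n in sequentially. 2 \<le> real (Suc n) * y" if "0 < y" for y
    proof -
      obtain m :: nat where m: "2 / y \<le> real m" using real_arch_simple by blast
      have "2 \<le> real (Suc n) * y" if "n \<ge> m" for n
      proof -
        have "2 / y \<le> real (Suc n)" using m that by linarith
        then show ?thesis using \<open>0 < y\<close> by (simp add: field_simps)
      qed
      then show ?thesis by (auto simp: eventually_sequentially)
    qed
    have "\<forall>\<^sub>F n in sequentially. 2 \<le> real (Suc n) * x" "\<forall>\<^sub>F n in sequentially. 2 \<le> real (Suc n) * (1 - x)"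
      using x(1) by (intro ev; simp)+
    then have "\<forall>\<^sub>F n in sequentially. \<eta> n x = 1"
      by eventually_elim (simp add: \<eta>_def del: of_nat_Suc)
    then have "(\<lambda>n. \<eta> n x) \<longlonglongrightarrow> 1" by (rule tendsto_eventually)
    moreover have "(\<lambda>n. g n x) \<longlonglongrightarrow> sgn (k x)" using g(2)[OF x(2)] x(1) by simp
    ultimately have "(\<lambda>n. max (-1) (min 1 (g n x)) * \<eta> n x * k x) \<longlonglongrightarrow> max (-1) (min 1 (sgn (k x))) * 1 * k x"
      by (intro tendsto_intros)
    moreover have "max (-1) (min 1 (sgn (k x))) * 1 * k x = \<bar>k x\<bar>"
      by (auto simp: sgn_if)
    ultimately show "(\<lambda>n. \<psi> n x * k x) \<longlonglongrightarrow> \<bar>k x\<bar>" by (simp add: \<psi>_def)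
  qed
  have "(\<lambda>n. LINT x|Omega. \<psi> n x * k x) \<longlonglongrightarrow> (LINT x|Omega. \<bar>k x\<bar>)"
  proof (rule integral_dominated_convergence[where w="\<lambda>x. \<bar>k x\<bar>"])
    show "AE x in Omega. norm (\<psi> n x * k x) \<le> \<bar>k x\<bar>" for n
      using bnd mult_right_mono[OF bnd abs_ge_zero] by (auto simp: abs_mult intro!: AE_I2)
  qed (use k lim in auto)
  then have "(LINT x|Omega. \<bar>k x\<bar>) = 0" unfolding zero by (simp add: LIMSEQ_const_iff)
  then have "AE x in Omega. \<bar>k x\<bar> = 0"
    using integral_nonneg_eq_0_iff_AE[of Omega "\<lambda>x. \<bar>k x\<bar>"] k by auto
  then show ?thesis by simp
qed

definition test_fun :: "(real \<Rightarrow> real) \<Rightarrow> (real \<Rightarrow> real) \<Rightarrow> bool" where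
  "test_fun \<phi> \<phi>' \<longleftrightarrow> (\<forall>x. (\<phi> has_real_derivative \<phi>' x) (at x)) \<and> continuous_on UNIV \<phi>'
     \<and> (\<exists>c d. 0 < c \<and> d < 1 \<and> (\<forall>x. x \<notin> {c..d} \<longrightarrow> \<phi> x = 0))"

lemma test_fun_continuous:
  assumes "test_fun \<phi> \<phi>'"
  shows "continuous_on S \<phi>" "continuous_on S \<phi>'"
  using assms by (auto simp: test_fun_def intro: continuous_on_subset DERIV_continuous_on has_field_derivative_at_within)

lemma weak_deriv_iff:
  fixes u :: "real \<Rightarrow> 'a::{banach,second_countable_topology}"
  assumes [measurable]: "u \<in> borel_measurable Omega" "g \<in> borel_measurable Omega"
  shows "weak_deriv 0 1 u g \<longleftrightarrow>
    (\<forall>\<phi> \<phi>'. test_fun \<phi> \<phi>' \<longrightarrow> (LINT x|Omega. \<phi>' x *\<^sub>R u x) = - (LINT x|Omega. \<phi> x *\<^sub>R g x))"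
proof -
  have eq: "(LINT x|lebesgue_on {0<..<1}. \<phi>' x *\<^sub>R u x) = (LINT x|Omega. \<phi>' x *\<^sub>R u x)"
       "(LINT x|lebesgue_on {0<..<1}. \<phi> x *\<^sub>R g x) = (LINT x|Omega. \<phi> x *\<^sub>R g x)" if "test_fun \<phi> \<phi>'" for \<phi> \<phi>'
  proof -
    have [measurable]: "\<phi> \<in> borel_measurable Omega" "\<phi>' \<in> borel_measurable Omega"
      using test_fun_continuous[OF that] by (auto intro: continuous_Omega_measurable)
    show "(LINT x|lebesgue_on {0<..<1}. \<phi>' x *\<^sub>R u x) = (LINT x|Omega. \<phi>' x *\<^sub>R u x)"
       "(LINT x|lebesgue_on {0<..<1}. \<phi> x *\<^sub>R g x) = (LINT x|Omega. \<phi> x *\<^sub>R g x)"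
      by (intro integral_open_Omega; measurable)+
  qed
  have "weak_deriv 0 1 u g \<longleftrightarrow> (\<forall>\<phi> \<phi>'. test_fun \<phi> \<phi>' \<longrightarrow>
      (LINT x|lebesgue_on {0<..<1}. \<phi>' x *\<^sub>R u x) = - (LINT x|lebesgue_on {0<..<1}. \<phi> x *\<^sub>R g x))"
    unfolding weak_deriv_def test_fun_def by blast
  then show ?thesis by (simp add: eq cong: imp_cong)
qed

subsection \<open>Primitives\<close>

text \<open>The indicator of a half-line in place of a variable interval: the function is total in
  \<open>x\<close>, and Fubini applies on a fixed product space.\<close>

definition primitive :: "(real \<Rightarrow> 'a::{banach,second_countable_topology}) \<Rightarrow> real \<Rightarrow> 'a" where
  "primitive a x = (LINT y|Omega. indicator {..x} y *\<^sub>R a y)"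

lemma integrable_indicator_scaleR:
  fixes a :: "real \<Rightarrow> 'a::{banach,second_countable_topology}"
  assumes "integrable Omega a"
  shows "integrable Omega (\<lambda>y. indicator {..x::real} y *\<^sub>R a y)"
proof -
  have [measurable]: "a \<in> borel_measurable Omega" using assms by simp
  have [measurable]: "(\<lambda>y. indicator {..x} y :: real) \<in> borel_measurable Omega"
    by measurable
  show ?thesis
    by (rule Bochner_Integration.integrable_bound[OF assms]) (auto simp: indicator_def)
qed

lemma primitive_0: "integrable Omega a \<Longrightarrow> primitive a 0 = 0"
proof -
  assume a: "integrable Omega a"
  have "primitive a 0 = (LINT y|Omega. 0)"
    unfolding primitive_def
  proof (rule integral_cong_AE)
    show "AE y in Omega. indicator {..0} y *\<^sub>R a y = 0"
      using AE_Omega_interior by eventually_elim auto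
  qed (use integrable_indicator_scaleR[OF a] in auto)
  then show ?thesis by simp
qed

lemma primitive_1: "primitive a 1 = (LINT y|Omega. a y)"
  unfolding primitive_def by (intro Bochner_Integration.integral_cong) auto

lemma primitive_diff:
  "integrable Omega a \<Longrightarrow> integrable Omega b \<Longrightarrow> primitive (\<lambda>x. a x - b x) x = primitive a x - primitive b x"
  by (simp add: primitive_def scaleR_diff_right integrable_indicator_scaleR)

lemma continuous_primitive:
  fixes a :: "real \<Rightarrow> 'a::{banach,second_countable_topology}"
  assumes a: "integrable Omega a" shows "continuous_on S (primitive a)"
proof (rule continuous_on_sequentiallyI)
  fix X x assume X: "X \<longlonglongrightarrow> (x::real)"
  show "(\<lambda>n. primitive a (X n)) \<longlonglongrightarrow> primitive a x"
    unfolding primitive_def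
  proof (rule integral_dominated_convergence[where w="\<lambda>y. norm (a y)"])
    show "AE y in Omega. (\<lambda>n. indicator {..X n} y *\<^sub>R a y) \<longlonglongrightarrow> indicator {..x} y *\<^sub>R a y"
      using AE_Omega_neq[of x]
    proof eventually_elim
      fix y assume "y \<noteq> x"
      have "\<forall>\<^sub>F n in sequentially. (indicator {..X n} y :: real) = indicator {..x} y"
      proof (cases "y < x")
        case True
        from order_tendstoD(1)[OF X this] show ?thesis by eventually_elim (use True in auto)
      next
        case False
        with \<open>y \<noteq> x\<close> have "x < y" by simp
        from order_tendstoD(2)[OF X this] show ?thesis by eventually_elim (use \<open>x < y\<close> in auto)
      qed
      then have "(\<lambda>n. indicator {..X n} y :: real) \<longlonglongrightarrow> indicator {..x} y" by (rule tendsto_eventually)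
      then show "(\<lambda>n. indicator {..X n} y *\<^sub>R a y) \<longlonglongrightarrow> indicator {..x} y *\<^sub>R a y"
        by (intro tendsto_intros)
    qed
  qed (use a integrable_indicator_scaleR[OF a] in \<open>auto simp: indicator_def\<close>)
qed

lemma primitive_deriv:
  fixes f :: "real \<Rightarrow> 'a::euclidean_space"
  assumes f: "\<And>x. (f has_vector_derivative f' x) (at x)" "continuous_on UNIV f'" and x: "x \<in> {0..1}"
  shows "primitive f' x = f x - f 0"
proof -
  have "primitive f' x = (LINT y|Omega. indicator {0..x} y *\<^sub>R f' y)"
    unfolding primitive_def by (intro Bochner_Integration.integral_cong) (auto simp: indicator_def)
  also have "\<dots> = (LINT y|lebesgue. indicator {0..1} y *\<^sub>R indicator {0..x} y *\<^sub>R f' y)"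
    by (rule integral_restrict_space) simp
  also have "\<dots> = (LINT y|lebesgue. indicator {0..x} y *\<^sub>R f' y)"
    using x by (intro Bochner_Integration.integral_cong) (auto simp: indicator_def)
  also have "\<dots> = (LINT y|lebesgue_on {0..x}. f' y)"
    by (rule integral_restrict_space[symmetric]) simp
  also have "\<dots> = integral {0..x} f'"
    by (rule lebesgue_integral_eq_integral)
       (auto intro!: continuous_imp_integrable_real continuous_on_subset[OF f(2)])
  also have "\<dots> = f x - f 0"
  proof (rule integral_unique, rule fundamental_theorem_of_calculus)
    show "(f has_vector_derivative f' y) (at y within {0..x})" for y
      by (rule has_vector_derivative_at_within[OF f(1)])
  qed (use x in simp)
  finally show ?thesis .
qed

lemma integral_Omega_deriv:
  fixes f :: "real \<Rightarrow> 'a::euclidean_space"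
  assumes "\<And>x. (f has_vector_derivative f' x) (at x)" "continuous_on UNIV f'"
  shows "(LINT x|Omega. f' x) = f 1 - f 0"
  using primitive_deriv[OF assms, of 1] by (simp add: primitive_1)

lemma primitive_Omega_measurable:
  fixes a :: "real \<Rightarrow> 'a::{banach,second_countable_topology}"
  assumes "integrable Omega a"
  shows "primitive a \<in> borel_measurable Omega"
proof -
  have "primitive a \<in> borel_measurable borel"
    by (rule borel_measurable_continuous_onI[OF continuous_primitive[OF assms]])
  then show ?thesis using measurable_compose[OF id_Omega_measurable] by blast
qed

lemma norm_primitive_le:
  fixes a :: "real \<Rightarrow> 'a::{banach,second_countable_topology}"
  assumes "integrable Omega a"
  shows "norm (primitive a x) \<le> (LINT x|Omega. norm (a x))"
  unfolding primitive_def
proof (rule order_trans[OF integral_norm_bound integral_mono])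
  show "integrable Omega (\<lambda>y. norm (indicator {..x} y *\<^sub>R a y))"
    by (rule integrable_norm[OF integrable_indicator_scaleR[OF assms]])
qed (use assms in \<open>auto simp: indicator_def\<close>)

text \<open>Integration by parts for merely integrable functions: Fubini on the triangle y <= x. The
  product of the two integrals is the boundary term at 1; the one at 0 is zero.\<close>

lemma integral_primitive_mult:
  fixes a b :: "real \<Rightarrow> 'a::{real_normed_field,banach,second_countable_topology}"
  assumes a: "integrable Omega a" and b: "integrable Omega b"
  shows "(LINT x|Omega. primitive a x * b x) = (LINT x|Omega. a x) * (LINT x|Omega. b x) - (LINT x|Omega. a x * primitive b x)"
proof -
  have [measurable]: "a \<in> borel_measurable Omega" "b \<in> borel_measurable Omega" using a b by auto
  interpret pair_sigma_finite Omega Omega ..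
  define f where "f x y = (indicator {..x} y *\<^sub>R a y) * b x" for x y :: real
  have m: "case_prod f \<in> borel_measurable (Omega \<Otimes>\<^sub>M Omega)"
  proof -
    have "case_prod f = (\<lambda>p. (if snd p \<le> fst p then 1 else 0) *\<^sub>R a (snd p) * b (fst p))"
      by (auto simp: f_def indicator_def)
    also have "\<dots> \<in> borel_measurable (Omega \<Otimes>\<^sub>M Omega)" by measurable
    finally show ?thesis .
  qed
  have fx: "integrable Omega (f x)" for x
    unfolding f_def by (intro integrable_mult_left integrable_indicator_scaleR a)
  have "integrable (Omega \<Otimes>\<^sub>M Omega) (case_prod f)"
  proof (rule Fubini_integrable[OF m])
    show "integrable Omega (\<lambda>x. LINT y|Omega. norm (case (x, y) of (x, y) \<Rightarrow> f x y))"
    proof (rule Bochner_Integration.integrable_bound)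
      show "integrable Omega (\<lambda>x. (LINT y|Omega. norm (a y)) * norm (b x))" using b by simp
      show "(\<lambda>x. LINT y|Omega. norm (case (x, y) of (x, y) \<Rightarrow> f x y)) \<in> borel_measurable Omega"
        using m by measurable
      have "norm (LINT y|Omega. norm (f x y)) \<le> norm ((LINT y|Omega. norm (a y)) * norm (b x))" for x
      proof -
        have "(LINT y|Omega. norm (f x y)) \<le> (LINT y|Omega. norm (a y) * norm (b x))"
        proof (rule integral_mono[OF integrable_norm[OF fx]])
          show "integrable Omega (\<lambda>y. norm (a y) * norm (b x))" using a by simp
        qed (auto simp: f_def norm_mult indicator_def)
        then show ?thesis by (simp add: integral_nonneg_AE)
      qed
      then show "AE x in Omega. norm (LINT y|Omega. norm (case (x, y) of (x, y) \<Rightarrow> f x y))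
          \<le> norm ((LINT y|Omega. norm (a y)) * norm (b x))" by simp
    qed
  qed (use fx in auto)
  from Fubini_integral[OF this]
  have "(LINT x|Omega. LINT y|Omega. f x y) = (LINT y|Omega. LINT x|Omega. f x y)" by simp
  moreover have "(LINT y|Omega. f x y) = primitive a x * b x" for x
    unfolding f_def primitive_def by (rule Bochner_Integration.integral_mult_left) (rule integrable_indicator_scaleR[OF a])
  moreover have "(LINT x|Omega. f x y) = a y * ((LINT x|Omega. b x) - primitive b y)" for y
  proof -
    have "(LINT x|Omega. f x y) = (LINT x|Omega. a y * (b x - indicator {..y} x *\<^sub>R b x))"
    proof (rule integral_cong_AE)
      show "AE x in Omega. f x y = a y * (b x - indicator {..y} x *\<^sub>R b x)"
        \<comment> \<open>The two sides may differ only at x = y, which lies in both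
          half-lines.\<close>
        using AE_Omega_neq[of y] by eventually_elim (auto simp: f_def indicator_def)
      show "(\<lambda>x. a y * (b x - indicator {..y} x *\<^sub>R b x)) \<in> borel_measurable Omega"
        using integrable_indicator_scaleR[OF b] by measurable
      show "(\<lambda>x. f x y) \<in> borel_measurable Omega"
      proof -
        have "(\<lambda>x. f x y) = (\<lambda>x. (if y \<le> x then 1 else 0) *\<^sub>R a y * b x)" by (auto simp: f_def indicator_def)
        also have "\<dots> \<in> borel_measurable Omega" by measurable
        finally show ?thesis .
      qed
    qed
    also have "\<dots> = a y * ((LINT x|Omega. b x) - primitive b y)"
      using b integrable_indicator_scaleR[OF b] by (simp add: primitive_def)
    finally show ?thesis .
  qed
  ultimately have "(LINT x|Omega. primitive a x * b x) = (LINT y|Omega. a y * (LINT x|Omega. b x) - a y * primitive b y)"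
    by (simp add: right_diff_distrib)
  also have "\<dots> = (LINT x|Omega. a x) * (LINT x|Omega. b x) - (LINT x|Omega. a x * primitive b x)"
  proof -
    have "integrable Omega (\<lambda>y. a y * primitive b y)"
    proof (rule Bochner_Integration.integrable_bound)
      show "integrable Omega (\<lambda>y. (LINT x|Omega. norm (b x)) * norm (a y))" using a by simp
      show "(\<lambda>y. a y * primitive b y) \<in> borel_measurable Omega"
        using primitive_Omega_measurable[OF b] by measurable
      have "norm (primitive b y) \<le> (LINT x|Omega. norm (b x))" for y
        by (rule norm_primitive_le[OF b])
      then have "norm (a y * primitive b y) \<le> (LINT x|Omega. norm (b x)) * norm (a y)" for y
        by (simp add: norm_mult mult.commute mult_left_mono)
      then show "AE y in Omega. norm (a y * primitive b y) \<le> norm ((LINT x|Omega. norm (b x)) * norm (a y))"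
        by (auto intro!: AE_I2 order_trans[OF _ abs_ge_self])
    qed
    then show ?thesis using a by simp
  qed
  finally show ?thesis .
qed

text \<open>The coincidence set is closed and of full measure in the open interval, so it contains
  the open interval and its closure. This is how boundary values are read off almost everywhere
  identities.\<close>

lemma continuous_AE_eq:
  fixes u v :: "real \<Rightarrow> 'a::euclidean_space"
  assumes u: "continuous_on {0..1} u" and v: "continuous_on {0..1} v"
    and eq: "AE x in Omega. u x = v x" and x: "x \<in> {0..1}"
  shows "u x = v x"
proof -
  define C where "C = {x \<in> {0..1}. u x = v x}"
  have C: "closed C"
    using continuous_closed_preimage[OF continuous_on_diff[OF u v], of "{0}"]
    by (simp add: C_def vimage_def Int_def conj_commute)
  have "AE x in lebesgue. x \<in> {0..1} \<longrightarrow> u x = v x"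
    using eq by (subst (asm) AE_restrict_space_iff) auto
  then have "AE x \<in> {0<..<1} in lebesgue. x \<in> C"
    by eventually_elim (auto simp: C_def)
  then have "{0<..<1} \<subseteq> C"
    using mem_closed_if_AE_lebesgue_open[OF open_greaterThanLessThan C] by blast
  then have "closure {0<..<1::real} \<subseteq> C" using C by (rule closure_minimal)
  then show ?thesis using x by (auto simp: C_def)
qed

lemma integrable_continuous_scaleR:
  fixes f :: "real \<Rightarrow> 'a::{banach,second_countable_topology}"
  assumes \<phi>: "continuous_on {0..1} \<phi>" and f: "integrable Omega f"
  shows "integrable Omega (\<lambda>x. (\<phi> x :: real) *\<^sub>R f x)"
proof -
  have "compact (\<phi> ` {0..1})" by (rule compact_continuous_image[OF \<phi>]) simp
  then obtain C where C: "\<And>x. x \<in> {0..1} \<Longrightarrow> \<bar>\<phi> x\<bar> \<le> C"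
    using bounded_iff compact_imp_bounded by (metis imageI real_norm_def)
  have [measurable]: "\<phi> \<in> borel_measurable Omega" "f \<in> borel_measurable Omega"
    using continuous_Omega_measurable[OF \<phi>] f by auto
  show ?thesis
  proof (rule Bochner_Integration.integrable_bound)
    show "integrable Omega (\<lambda>x. C *\<^sub>R f x)" using f by simp
    show "AE x in Omega. norm (\<phi> x *\<^sub>R f x) \<le> norm (C *\<^sub>R f x)"
    proof (rule AE_I2)
      fix x assume "x \<in> space Omega"
      then have "\<bar>\<phi> x\<bar> \<le> \<bar>C\<bar>" using C[of x] by simp
      then show "norm (\<phi> x *\<^sub>R f x) \<le> norm (C *\<^sub>R f x)" by (simp add: mult_right_mono)
    qed
  qed measurable
qed

section \<open>Weakly differentiable functions are primitives (du Bois-Reymond)\<close>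

lemma test_fun_values:
  assumes "test_fun \<phi> \<phi>'" shows "\<phi> 0 = 0" "\<phi> 1 = 0"
  using assms unfolding test_fun_def by (metis atLeastAtMost_iff not_le)+

lemma test_fun_vector_derivative: "test_fun \<phi> \<phi>' \<Longrightarrow> (\<phi> has_vector_derivative \<phi>' x) (at x)"
  by (simp add: test_fun_def has_real_derivative_iff_has_vector_derivative)

text \<open>A continuous compactly supported function is the derivative of a test function exactly
  if its integral vanishes; subtracting a multiple of a fixed bump achieves this.\<close>

lemma du_bois_reymond_real:
  fixes h :: "real \<Rightarrow> real"
  assumes h: "integrable Omega h"
    and z: "\<And>\<phi> \<phi>'. test_fun \<phi> \<phi>' \<Longrightarrow> (LINT x|Omega. \<phi>' x * h x) = 0"
  shows "\<exists>C. AE x in Omega. h x = C"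
proof -
  \<comment> \<open>A tent supported in [1/4, 3/4]; only its nonzero integral \<open>I\<close>
    matters.\<close>
  define \<psi>0 where "\<psi>0 x = max 0 (1/4 - \<bar>x - 1/2\<bar>)" for x :: real
  define I where "I = (LINT x|Omega. \<psi>0 x)"
  have c0: "continuous_on S \<psi>0" for S unfolding \<psi>0_def by (intro continuous_intros)
  have "I \<noteq> 0"
  proof
    assume "I = 0"
    then have "AE x in Omega. \<psi>0 x = 0"
      using integral_nonneg_eq_0_iff_AE[OF continuous_Omega_integrable[OF c0]]
      unfolding I_def by (simp add: \<psi>0_def[abs_def])
    from continuous_AE_eq[OF c0 continuous_on_const this, of "1/2"] show False by (simp add: \<psi>0_def)
  qed
  \<comment> \<open>The only possible constant: it makes h - C orthogonal to the bump.\<close>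
  define C where "C = (LINT x|Omega. \<psi>0 x * h x) / I"
  have "AE x in Omega. h x - C = 0"
  proof (rule AE_zero_if_orthogonal_continuous)
    show hC: "integrable Omega (\<lambda>x. h x - C)" using h by simp
    fix \<psi> :: "real \<Rightarrow> real" and c d :: real
    assume \<psi>: "continuous_on UNIV \<psi>" and cd: "0 < c" "d < 1" and \<psi>z: "\<And>x. x \<notin> {c..d} \<Longrightarrow> \<psi> x = (0::real)"
    have \<psi>': "continuous_on {0..1} \<psi>" using \<psi> by (rule continuous_on_subset) simp
    define J where "J = (LINT x|Omega. \<psi> x)"
    define \<zeta> where "\<zeta> x = \<psi> x - J / I * \<psi>0 x" for x
    have c\<zeta>: "continuous_on UNIV \<zeta>" unfolding \<zeta>_def by (intro continuous_intros \<psi> c0)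
    have "\<exists>F. \<forall>x::real. -\<infinity> < ereal x \<longrightarrow> ereal x < \<infinity> \<longrightarrow> (F has_vector_derivative \<zeta> x) (at x)"
      by (rule einterval_antiderivative) (use c\<zeta> in \<open>auto simp: continuous_on_eq_continuous_at\<close>)
    then obtain F where F: "\<And>x. (F has_real_derivative \<zeta> x) (at x)"
      by (auto simp: has_real_derivative_iff_has_vector_derivative)
    define c' where "c' = min c (1/4)"
    define d' where "d' = max d (3/4)"
    have \<zeta>0: "\<zeta> x = 0" if "x < c' \<or> x > d'" for x
      using that \<psi>z[of x] by (auto simp: \<zeta>_def \<psi>0_def c'_def d'_def)
    have const: "\<exists>k. \<forall>x\<in>S. F x = k" if "convex S" "\<And>x. x \<in> S \<Longrightarrow> \<zeta> x = 0" for S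
    proof (rule has_field_derivative_zero_constant[OF that(1)])
      fix x assume "x \<in> S"
      then show "(F has_field_derivative 0) (at x within S)"
        using has_field_derivative_at_within[OF F[of x]] that(2) by simp
    qed
    have low: "F x = F 0" if "x < c'" for x
      using const[of "{..<c'}"] \<zeta>0 that cd by (fastforce simp: c'_def)
    have high: "F x = F 1" if "x > d'" for x
      using const[of "{d'<..}"] \<zeta>0 that cd by (fastforce simp: d'_def)
    have "(LINT x|Omega. \<zeta> x) = F 1 - F 0"
      by (rule integral_Omega_deriv[OF _ c\<zeta>]) (use F in \<open>simp add: has_real_derivative_iff_has_vector_derivative\<close>)
    moreover have "(LINT x|Omega. \<zeta> x) = 0"
      using continuous_Omega_integrable[OF \<psi>'] continuous_Omega_integrable[OF c0] \<open>I \<noteq> 0\<close>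
      by (simp add: \<zeta>_def J_def I_def)
    ultimately have F1: "F 1 = F 0" by simp
    have "test_fun (\<lambda>x. F x - F 0) \<zeta>"
      unfolding test_fun_def
    proof (intro conjI allI exI impI)
      show "((\<lambda>x. F x - F 0) has_real_derivative \<zeta> x) (at x)" for x
        using F[of x] by (auto intro!: derivative_eq_intros)
      \<comment> \<open>Left of the support \<open>F\<close> equals \<open>F 0\<close>, right of it
        \<open>F 1\<close>; these agree because \<open>\<zeta>\<close> has integral 0.\<close>
      show "F x - F 0 = 0" if "x \<notin> {c'..d'}" for x using that low[of x] high[of x] F1 by auto
    qed (use cd c\<zeta> in \<open>auto simp: c'_def d'_def\<close>)
    from z[OF this] have "0 = (LINT x|Omega. \<psi> x * h x - J / I * (\<psi>0 x * h x))"
      by (simp add: \<zeta>_def left_diff_distrib mult.assoc)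
    also have "\<dots> = (LINT x|Omega. \<psi> x * h x) - J * C"
      using integrable_continuous_scaleR[OF \<psi>' h] integrable_continuous_scaleR[OF c0 h] by (simp add: C_def)
    also have "\<dots> = (LINT x|Omega. \<psi> x * (h x - C))"
      using integrable_continuous_scaleR[OF \<psi>' h] continuous_Omega_integrable[OF \<psi>']
      by (simp add: J_def right_diff_distrib)
    finally show "(LINT x|Omega. \<psi> x * (h x - C)) = 0" by simp
  qed
  then show ?thesis by auto
qed

lemma primitive_inner:
  fixes a :: "real \<Rightarrow> 'a::euclidean_space"
  assumes "integrable Omega a"
  shows "primitive a x \<bullet> b = primitive (\<lambda>x. a x \<bullet> b) x"
proof -
  have "primitive a x \<bullet> b = (LINT y|Omega. (indicator {..x} y *\<^sub>R a y) \<bullet> b)"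
    unfolding primitive_def by (rule integral_inner_left[symmetric]) (rule integrable_indicator_scaleR[OF assms])
  then show ?thesis by (simp add: primitive_def)
qed

text \<open>Taken componentwise, since the integration by parts above multiplies two functions with
  values in one field.\<close>

lemma integral_test_fun_primitive:
  fixes g :: "real \<Rightarrow> 'a::euclidean_space"
  assumes g: "integrable Omega g" and t: "test_fun \<phi> \<phi>'"
  shows "(LINT x|Omega. \<phi>' x *\<^sub>R (C + primitive g x)) = - (LINT x|Omega. \<phi> x *\<^sub>R g x)"
proof (rule euclidean_eqI)
  fix b :: 'a assume "b \<in> Basis"
  have c: "continuous_on {0..1} \<phi>" "continuous_on {0..1} \<phi>'" using test_fun_continuous[OF t] by auto
  have gb: "integrable Omega (\<lambda>x. g x \<bullet> b)" using g by simp
  have "\<phi> x = primitive \<phi>' x" if "x \<in> {0..1}" for x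
    using primitive_deriv[OF test_fun_vector_derivative[OF t] test_fun_continuous(2)[OF t] that] test_fun_values[OF t] by simp
  then have p: "(LINT x|Omega. (g x \<bullet> b) * primitive \<phi>' x) = (LINT x|Omega. \<phi> x * (g x \<bullet> b))"
    by (intro Bochner_Integration.integral_cong) auto
  have i0: "(LINT x|Omega. \<phi>' x) = 0"
    using integral_Omega_deriv[OF test_fun_vector_derivative[OF t] test_fun_continuous(2)[OF t]] test_fun_values[OF t] by simp
  have "(LINT x|Omega. \<phi>' x *\<^sub>R (C + primitive g x)) \<bullet> b = (LINT x|Omega. (\<phi>' x *\<^sub>R (C + primitive g x)) \<bullet> b)"
    by (rule integral_inner_left[symmetric])
       (intro integrable_continuous_scaleR c continuous_Omega_integrable continuous_intros continuous_primitive[OF g])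
  also have "\<dots> = (LINT x|Omega. (C \<bullet> b) * \<phi>' x + primitive (\<lambda>x. g x \<bullet> b) x * \<phi>' x)"
    by (intro Bochner_Integration.integral_cong) (auto simp: inner_add_left primitive_inner[OF g] algebra_simps)
  also have "\<dots> = (C \<bullet> b) * (LINT x|Omega. \<phi>' x) + (LINT x|Omega. primitive (\<lambda>x. g x \<bullet> b) x * \<phi>' x)"
  proof (subst Bochner_Integration.integral_add)
    show "integrable Omega (\<lambda>x. primitive (\<lambda>x. g x \<bullet> b) x * \<phi>' x)"
      by (intro continuous_Omega_integrable continuous_intros continuous_primitive[OF gb] c)
  qed (use continuous_Omega_integrable[OF c(2)] in auto)
  also have "\<dots> = - (LINT x|Omega. \<phi> x * (g x \<bullet> b))"
    using integral_primitive_mult[OF gb continuous_Omega_integrable[OF c(2)]] by (simp add: i0 p)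
  also have "\<dots> = (- (LINT x|Omega. \<phi> x *\<^sub>R g x)) \<bullet> b"
    using integrable_continuous_scaleR[OF c(1) g] by (simp flip: integral_inner_left)
  finally show "(LINT x|Omega. \<phi>' x *\<^sub>R (C + primitive g x)) \<bullet> b = (- (LINT x|Omega. \<phi> x *\<^sub>R g x)) \<bullet> b" .
qed

lemma weak_derivI:
  fixes g :: "real \<Rightarrow> 'a::euclidean_space"
  assumes g: "integrable Omega g" and u: "u \<in> borel_measurable Omega" and eq: "AE x in Omega. u x = C + primitive g x"
  shows "weak_deriv 0 1 u g"
proof -
  have gm: "g \<in> borel_measurable Omega" using g by simp
  show ?thesis
    unfolding weak_deriv_iff[OF u gm]
  proof (intro allI impI)
    fix \<phi> \<phi>' assume t: "test_fun \<phi> \<phi>'"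
    have [measurable]: "\<phi>' \<in> borel_measurable Omega"
      by (rule continuous_Omega_measurable) (rule test_fun_continuous[OF t])
    note [measurable] = u primitive_Omega_measurable[OF g]
    have "(LINT x|Omega. \<phi>' x *\<^sub>R u x) = (LINT x|Omega. \<phi>' x *\<^sub>R (C + primitive g x))"
      by (rule integral_cong_AE) (use eq in \<open>auto elim: eventually_mono\<close>)
    then show "(LINT x|Omega. \<phi>' x *\<^sub>R u x) = - (LINT x|Omega. \<phi> x *\<^sub>R g x)"
      by (simp add: integral_test_fun_primitive[OF g t])
  qed
qed

text \<open>The difference of \<open>u\<close> and the primitive of \<open>g\<close> has weak
  derivative 0, so each of its components is constant.\<close>

lemma weak_deriv_rep:
  fixes u g :: "real \<Rightarrow> 'a::euclidean_space"
  assumes u: "integrable Omega u" and g: "integrable Omega g" and w: "weak_deriv 0 1 u g"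
  shows "\<exists>C. AE x in Omega. u x = C + primitive g x"
proof -
  have um: "u \<in> borel_measurable Omega" "g \<in> borel_measurable Omega" using u g by auto
  have pi: "integrable Omega (primitive g)" by (rule continuous_Omega_integrable[OF continuous_primitive[OF g]])
  have "\<exists>C. AE x in Omega. (u x - primitive g x) \<bullet> b = C" for b
  proof (rule du_bois_reymond_real)
    show "integrable Omega (\<lambda>x. (u x - primitive g x) \<bullet> b)" using u pi by simp
    fix \<phi> \<phi>' assume t: "test_fun \<phi> \<phi>'"
    have c: "continuous_on {0..1} \<phi>'" by (rule test_fun_continuous[OF t])
    have "(LINT x|Omega. \<phi>' x *\<^sub>R u x) - (LINT x|Omega. \<phi>' x *\<^sub>R primitive g x) = 0"
      using w integral_test_fun_primitive[OF g t, of 0] t unfolding weak_deriv_iff[OF um] by simp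
    then have "(LINT x|Omega. \<phi>' x *\<^sub>R u x - \<phi>' x *\<^sub>R primitive g x) = 0"
      using integrable_continuous_scaleR[OF c u] integrable_continuous_scaleR[OF c pi] by simp
    then have "(LINT x|Omega. (\<phi>' x *\<^sub>R u x - \<phi>' x *\<^sub>R primitive g x) \<bullet> b) = 0"
      using integrable_continuous_scaleR[OF c u] integrable_continuous_scaleR[OF c pi]
      by (subst integral_inner_left) auto
    then show "(LINT x|Omega. \<phi>' x * ((u x - primitive g x) \<bullet> b)) = 0"
      by (simp add: inner_diff_left right_diff_distrib)
  qed
  then obtain C where C: "\<And>b. AE x in Omega. (u x - primitive g x) \<bullet> b = C b" by metis
  have "AE x in Omega. \<forall>b\<in>Basis. (u x - primitive g x) \<bullet> b = C b"
    by (rule AE_finite_allI) (auto intro: C)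
  then have "AE x in Omega. u x = (\<Sum>b\<in>Basis. C b *\<^sub>R b) + primitive g x"
  proof eventually_elim
    fix x assume "\<forall>b\<in>Basis. (u x - primitive g x) \<bullet> b = C b"
    then have "u x - primitive g x = (\<Sum>b\<in>Basis. C b *\<^sub>R b)" by (metis (no_types, lifting) euclidean_representation sum.cong)
    then show "u x = (\<Sum>b\<in>Basis. C b *\<^sub>R b) + primitive g x" by (simp add: algebra_simps)
  qed
  then show ?thesis by blast
qed

lemma nonpos_if_le_multiples:
  fixes x K :: real
  assumes le: "\<And>e. 0 < e \<Longrightarrow> x \<le> e * K" and K: "0 \<le> K"
  shows "x \<le> 0"
proof (rule field_le_epsilon)
  fix e :: real assume e: "0 < e"
  \<comment> \<open>The denominator K + 1 keeps the quotient meaningful for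
    \<open>K = 0\<close>.\<close>
  have "x \<le> e / (K + 1) * K" using e K by (intro le) simp
  also have "\<dots> \<le> e" using e K by (simp add: field_simps)
  finally show "x \<le> 0 + e" by simp
qed

text \<open>For a polynomial, integration by parts moves the derivative off \<open>k\<close> and
  onto its zero primitive; Weierstrass approximation passes to continuous test functions.\<close>

lemma primitive_zero_imp_real:
  fixes k :: "real \<Rightarrow> real"
  assumes k: "integrable Omega k" and z: "\<And>x. x \<in> {0..1} \<Longrightarrow> primitive k x = 0"
  shows "AE x in Omega. k x = 0"
proof (rule AE_zero_if_orthogonal_continuous[OF k])
  fix \<psi> :: "real \<Rightarrow> real" and c d :: real assume \<psi>: "continuous_on UNIV \<psi>"
  have \<psi>': "continuous_on {0..1} \<psi>" using \<psi> by (rule continuous_on_subset) simp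
  have k0: "(LINT x|Omega. k x) = 0" using z[of 1] by (simp add: primitive_1)
  have poly: "(LINT x|Omega. p x * k x) = 0" if p: "real_polynomial_function p" for p
  proof -
    obtain p' where p': "real_polynomial_function p'" "\<And>x. (p has_real_derivative p' x) (at x)"
      using has_real_derivative_polynomial_function[OF p] by blast
    have cp: "continuous_on S p'" for S
      using p'(1) by (simp add: continuous_on_polymonial_function real_polynomial_function_eq)
    have "(LINT x|Omega. p x * k x) = (LINT x|Omega. p 0 * k x + primitive p' x * k x)"
    proof (rule Bochner_Integration.integral_cong[OF refl])
      fix x assume "x \<in> space Omega"
      then have "p x = p 0 + primitive p' x"
        using primitive_deriv[of p p' x] p'(2) cp by (simp add: has_real_derivative_iff_has_vector_derivative)
      then show "p x * k x = p 0 * k x + primitive p' x * k x" by (simp add: algebra_simps)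
    qed
    also have "\<dots> = p 0 * (LINT x|Omega. k x) + (LINT x|Omega. primitive p' x * k x)"
    proof (subst Bochner_Integration.integral_add)
      show "integrable Omega (\<lambda>x. primitive p' x * k x)"
        using integrable_continuous_scaleR[OF continuous_primitive[OF continuous_Omega_integrable[OF cp]] k] by simp
    qed (use k in auto)
    also have "\<dots> = - (LINT x|Omega. p' x * primitive k x)"
      using integral_primitive_mult[OF continuous_Omega_integrable[OF cp] k] by (simp add: k0)
    also have "(LINT x|Omega. p' x * primitive k x) = (LINT x|Omega. 0)"
      by (intro Bochner_Integration.integral_cong) (auto simp: z)
    finally show ?thesis by simp
  qed
  have "\<bar>LINT x|Omega. \<psi> x * k x\<bar> \<le> e * (LINT x|Omega. \<bar>k x\<bar>)" if "0 < e" for e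
  proof -
    obtain p where p: "real_polynomial_function p" "\<And>x. x \<in> {0..1} \<Longrightarrow> \<bar>\<psi> x - p x\<bar> < e"
      using Stone_Weierstrass_real_polynomial_function[OF compact_Icc \<psi>' \<open>0 < e\<close>] by blast
    have cp: "continuous_on {0..1} p"
      using p(1) by (simp add: continuous_on_polymonial_function real_polynomial_function_eq)
    have i: "integrable Omega (\<lambda>x. \<psi> x * k x)" "integrable Omega (\<lambda>x. p x * k x)"
      using integrable_continuous_scaleR[OF \<psi>' k] integrable_continuous_scaleR[OF cp k] by auto
    have "(LINT x|Omega. \<psi> x * k x) = (LINT x|Omega. \<psi> x * k x - p x * k x)"
      using i poly[OF p(1)] by simp
    also have "\<bar>\<dots>\<bar> \<le> (LINT x|Omega. \<bar>\<psi> x * k x - p x * k x\<bar>)"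
      using integral_norm_bound[of Omega "\<lambda>x. \<psi> x * k x - p x * k x"] by simp
    also have "\<dots> \<le> (LINT x|Omega. e * \<bar>k x\<bar>)"
    proof (rule integral_mono)
      fix x assume "x \<in> space Omega"
      then have "\<bar>\<psi> x - p x\<bar> * \<bar>k x\<bar> \<le> e * \<bar>k x\<bar>" using p(2)[of x] by (intro mult_right_mono) auto
      then show "\<bar>\<psi> x * k x - p x * k x\<bar> \<le> e * \<bar>k x\<bar>" by (simp add: abs_mult flip: left_diff_distrib)
    qed (use i k in auto)
    finally show ?thesis by simp
  qed
  from nonpos_if_le_multiples[OF this] have "\<bar>LINT x|Omega. \<psi> x * k x\<bar> \<le> 0" by simp
  then show "(LINT x|Omega. \<psi> x * k x) = 0" by simp
qed

lemma primitive_inj: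
  fixes g g' :: "real \<Rightarrow> 'a::euclidean_space"
  assumes g: "integrable Omega g" "integrable Omega g'" and eq: "AE x in Omega. C + primitive g x = C' + primitive g' x"
  shows "C = C' \<and> (AE x in Omega. g x = g' x)"
proof -
  have all: "C + primitive g x = C' + primitive g' x" if "x \<in> {0..1}" for x
    by (rule continuous_AE_eq[OF _ _ eq that]) (intro continuous_intros continuous_primitive g)+
  have C: "C = C'" using all[of 0] g by (simp add: primitive_0)
  have "AE x in Omega. (g x - g' x) \<bullet> b = 0" for b
  proof (rule primitive_zero_imp_real)
    show "integrable Omega (\<lambda>x. (g x - g' x) \<bullet> b)" using g by simp
    show "primitive (\<lambda>x. (g x - g' x) \<bullet> b) x = 0" if "x \<in> {0..1}" for x
      using all[OF that] C g by (simp add: primitive_inner[symmetric] primitive_diff)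
  qed
  then have "AE x in Omega. \<forall>b\<in>Basis. (g x - g' x) \<bullet> b = 0"
    by (intro AE_finite_allI) auto
  then have "AE x in Omega. g x = g' x"
    by eventually_elim (auto simp: euclidean_all_zero_iff)
  then show ?thesis using C by blast
qed

section \<open>Sobolev spaces on the unit interval\<close>

lemma L2_fun_integrable:
  fixes f :: "real \<Rightarrow> 'a::euclidean_space"
  shows "f \<in> L2_fun \<Longrightarrow> integrable Omega f"
  using L2_fun_integrable_norm(1)[of f] by (auto simp: L2_fun_def integrable_norm_iff)

lemma continuous_L2_fun:
  fixes f :: "real \<Rightarrow> 'a::euclidean_space"
  assumes "continuous_on {0..1} f" shows "f \<in> L2_fun"
  unfolding L2_fun_def
  by (auto intro!: continuous_Omega_measurable continuous_Omega_integrable continuous_intros assms)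

lemma L2_fun_cong_AE:
  fixes f g :: "real \<Rightarrow> 'a::euclidean_space"
  assumes "f \<in> L2_fun" "g \<in> borel_measurable Omega" "AE x in Omega. f x = g x"
  shows "g \<in> L2_fun"
proof -
  have [measurable]: "f \<in> borel_measurable Omega" "g \<in> borel_measurable Omega"
    using assms by (auto simp: L2_fun_def)
  have "integrable Omega (\<lambda>x. (norm (f x))\<^sup>2) \<longleftrightarrow> integrable Omega (\<lambda>x. (norm (g x))\<^sup>2)"
    by (rule integrable_cong_AE) (use assms(3) in \<open>auto elim: eventually_mono\<close>)
  then show ?thesis using assms by (simp add: L2_fun_def)
qed

lemma H1_grad:
  assumes "f \<in> H1" shows "grad f \<in> L2_fun" "weak_deriv 0 1 f (grad f)"
  using someI_ex[of "\<lambda>g. g \<in> L2_fun \<and> weak_deriv 0 1 f g"] assms by (auto simp: H1_def grad_def)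

lemma H1_rep:
  fixes f :: "real \<Rightarrow> 'a::euclidean_space"
  assumes "f \<in> H1" shows "\<exists>C. AE x in Omega. f x = C + primitive (grad f) x"
  by (rule weak_deriv_rep) (use assms H1_grad[OF assms] in \<open>auto simp: H1_def intro: L2_fun_integrable\<close>)

text \<open>The given continuous representative and constant plus primitive agree everywhere on
  [0,1], so boundary conditions become statements about the constant and the mean of the
  gradient.\<close>

lemma H1_boundary_rep:
  fixes f :: "real \<Rightarrow> 'a::euclidean_space"
  assumes f: "f \<in> H1" and v: "continuous_on {0..1} v" "AE x in Omega. f x = v x"
  shows "AE x in Omega. f x = v 0 + primitive (grad f) x" "(LINT x|Omega. grad f x) = v 1 - v 0"
proof -
  have i: "integrable Omega (grad f)" by (rule L2_fun_integrable[OF H1_grad(1)[OF f]])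
  obtain C where C: "AE x in Omega. f x = C + primitive (grad f) x" using H1_rep[OF f] by blast
  have ae: "AE x in Omega. v x = C + primitive (grad f) x" using C v(2) by eventually_elim simp
  have "v x = C + primitive (grad f) x" if "x \<in> {0..1}" for x
    by (rule continuous_AE_eq[OF v(1) _ ae that]) (intro continuous_intros continuous_primitive i)
  from this[of 0] this[of 1] have "v 0 = C" "v 1 = C + (LINT x|Omega. grad f x)"
    using i by (auto simp: primitive_0 primitive_1)
  then show "AE x in Omega. f x = v 0 + primitive (grad f) x" "(LINT x|Omega. grad f x) = v 1 - v 0"
    using C by auto
qed

lemma H1_per_rep:
  fixes f :: "real \<Rightarrow> 'a::euclidean_space"
  assumes "f \<in> H1_per"
  obtains C where "AE x in Omega. f x = C + primitive (grad f) x" "(LINT x|Omega. grad f x) = 0"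
  using assms H1_boundary_rep[of f] unfolding H1_per_def by fastforce

lemma H1_0_rep:
  fixes f :: "real \<Rightarrow> 'a::euclidean_space"
  assumes "f \<in> H1_0"
  shows "AE x in Omega. f x = primitive (grad f) x" "(LINT x|Omega. grad f x) = 0"
proof -
  obtain v where "f \<in> H1" "continuous_on {0..1} v" "AE x in Omega. f x = v x" "v 0 = 0" "v 1 = 0"
    using assms by (auto simp: H1_0_def)
  from H1_boundary_rep[OF this(1-3)] this(4,5)
  show "AE x in Omega. f x = primitive (grad f) x" "(LINT x|Omega. grad f x) = 0" by auto
qed

text \<open>\<open>grad\<close> is a \<open>SOME\<close>; injectivity of constant plus primitive
  identifies it almost everywhere.\<close>

lemma grad_eqI:
  fixes f :: "real \<Rightarrow> 'a::euclidean_space"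
  assumes f: "f \<in> borel_measurable Omega" and g: "g \<in> L2_fun" and rep: "AE x in Omega. f x = C + primitive g x"
  shows "f \<in> H1" "AE x in Omega. grad f x = g x"
proof -
  have i: "integrable Omega g" by (rule L2_fun_integrable[OF g])
  have "continuous_on {0..1} (\<lambda>x. C + primitive g x)" by (intro continuous_intros continuous_primitive i)
  then have "(\<lambda>x. C + primitive g x) \<in> L2_fun" by (rule continuous_L2_fun)
  then have "f \<in> L2_fun" by (rule L2_fun_cong_AE) (use f rep in \<open>auto elim: eventually_mono\<close>)
  then show f1: "f \<in> H1" using g weak_derivI[OF i f rep] by (auto simp: H1_def)
  obtain C' where C': "AE x in Omega. f x = C' + primitive (grad f) x" using H1_rep[OF f1] by blast
  with rep have "AE x in Omega. C' + primitive (grad f) x = C + primitive g x" by eventually_elim simp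
  from primitive_inj[OF L2_fun_integrable[OF H1_grad(1)[OF f1]] i this]
  show "AE x in Omega. grad f x = g x" by blast
qed

lemma H1_perI:
  fixes f :: "real \<Rightarrow> 'a::euclidean_space"
  assumes f: "f \<in> borel_measurable Omega" and g: "g \<in> L2_fun" "(LINT x|Omega. g x) = 0"
    and rep: "AE x in Omega. f x = C + primitive g x"
  shows "f \<in> H1_per"
proof -
  have i: "integrable Omega g" by (rule L2_fun_integrable[OF g(1)])
  have "continuous_on {0..1} (\<lambda>x. C + primitive g x)" by (intro continuous_intros continuous_primitive i)
  then show ?thesis
    using grad_eqI(1)[OF f g(1) rep] rep g(2) i by (auto simp: H1_per_def primitive_0 primitive_1)
qed

lemma H1_0I:
  fixes g :: "real \<Rightarrow> 'a::euclidean_space"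
  assumes g: "g \<in> L2_fun" "(LINT x|Omega. g x) = 0"
  shows "primitive g \<in> H1_0"
proof -
  have i: "integrable Omega g" by (rule L2_fun_integrable[OF g(1)])
  have "primitive g \<in> H1"
    by (rule grad_eqI(1)[OF primitive_Omega_measurable[OF i] g(1), of 0]) simp
  then show ?thesis
    using g(2) i continuous_primitive[OF i] by (auto simp: H1_0_def primitive_0 primitive_1 intro!: exI[of _ "primitive g"])
qed

lemma H1_bounded:
  fixes f :: "real \<Rightarrow> real"
  assumes f: "f \<in> H1" shows "f \<in> Linf_fun"
proof -
  obtain C where C: "AE x in Omega. f x = C + primitive (grad f) x" using H1_rep[OF f] by blast
  have i: "integrable Omega (grad f)" by (rule L2_fun_integrable[OF H1_grad(1)[OF f]])
  have "\<bar>C + primitive (grad f) x\<bar> \<le> \<bar>C\<bar> + (LINT x|Omega. norm (grad f x))" for x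
    using norm_primitive_le[OF i, of x] by simp
  then have "AE x in Omega. \<bar>f x\<bar> \<le> \<bar>C\<bar> + (LINT x|Omega. norm (grad f x))"
    using C by (auto elim!: eventually_mono)
  then show ?thesis using f by (auto simp: Linf_fun_def H1_def L2_fun_def)
qed

lemma H1_diff:
  fixes f g :: "real \<Rightarrow> real"
  assumes f: "AE x in Omega. f x = C + primitive (grad f) x" "f \<in> H1"
    and g: "AE x in Omega. g x = C' + primitive (grad g) x" "g \<in> H1"
  shows "AE x in Omega. grad (f - g) x = grad f x - grad g x" "f - g \<in> H1"
    "AE x in Omega. (f - g) x = C - C' + primitive (\<lambda>x. grad f x - grad g x) x"
proof -
  have fg: "grad f \<in> L2_fun" "grad g \<in> L2_fun" using f g H1_grad by auto
  note i = fg[THEN L2_fun_integrable]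
  have m: "f - g \<in> borel_measurable Omega"
    using f(2) g(2) unfolding fun_diff_def by (auto simp: H1_def L2_fun_def)
  show rep: "AE x in Omega. (f - g) x = C - C' + primitive (\<lambda>x. grad f x - grad g x) x"
    using f(1) g(1) by eventually_elim (simp add: primitive_diff[OF i])
  show "AE x in Omega. grad (f - g) x = grad f x - grad g x" "f - g \<in> H1"
    using grad_eqI[OF m L2_fun_diff[OF fg] rep] by (auto simp: fun_diff_def)
qed

subsection \<open>The Poisson equation\<close>

lemma poisson_rep:
  assumes n: "integrable Omega n" and V: "poisson_solution n V"
  obtains C where "AE x in Omega. grad V x = C - primitive n x"
proof -
  have V1: "V \<in> H1" using V by (simp add: poisson_solution_def H1_0_def)
  have "\<exists>C. AE x in Omega. grad V x = C + primitive (\<lambda>x. - n x) x"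
    by (rule weak_deriv_rep)
       (use V n H1_grad[OF V1] in \<open>auto simp: poisson_solution_def intro: L2_fun_integrable\<close>)
  moreover have "primitive (\<lambda>x. - n x) x = - primitive n x" for x by (simp add: primitive_def)
  ultimately show ?thesis using that by auto
qed

lemma poisson_exists:
  assumes n: "integrable Omega n"
  shows "\<exists>V. poisson_solution n V"
proof -
  \<comment> \<open>This constant gives the gradient mean 0 on the unit interval, which is the
    boundary condition at 1; the one at 0 is built into \<open>primitive\<close>.\<close>
  define C where "C = (LINT x|Omega. primitive n x)"
  define g where "g x = C - primitive n x" for x
  have c: "continuous_on {0..1} g" unfolding g_def by (intro continuous_intros continuous_primitive n)
  have g: "g \<in> L2_fun" by (rule continuous_L2_fun[OF c])
  have pi: "integrable Omega (primitive n)" by (rule continuous_Omega_integrable[OF continuous_primitive[OF n]])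
  have g0: "(LINT x|Omega. g x) = 0"
    using pi by (simp add: g_def C_def measure_restrict_space)
  have V: "primitive g \<in> H1_0" by (rule H1_0I[OF g g0])
  have gV: "AE x in Omega. grad (primitive g) x = g x"
    by (rule grad_eqI(2)[OF primitive_Omega_measurable[OF L2_fun_integrable[OF g]] g, of 0]) simp
  have V1: "primitive g \<in> H1" using V by (simp add: H1_0_def)
  have "weak_deriv 0 1 (grad (primitive g)) (\<lambda>x. - n x)"
  proof (rule weak_derivI)
    show "grad (primitive g) \<in> borel_measurable Omega" using H1_grad(1)[OF V1] by (simp add: L2_fun_def)
    show "AE x in Omega. grad (primitive g) x = C + primitive (\<lambda>x. - n x) x"
      using gV by eventually_elim (simp add: g_def primitive_def)
  qed (use n in simp)
  then show ?thesis using V by (auto simp: poisson_solution_def)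
qed

text \<open>The Poisson equation tested with the primitive of \<open>g\<close>, which vanishes at
  both ends since \<open>g\<close> has mean 0; for the same reason the integration constant of
  \<open>grad V\<close> disappears.\<close>

lemma poisson_ibp:
  assumes n: "integrable Omega n" and V: "poisson_solution n V"
    and g: "integrable Omega g" "(LINT x|Omega. g x) = 0"
  shows "(LINT x|Omega. n x * primitive g x) = (LINT x|Omega. grad V x * g x)"
proof -
  obtain C where C: "AE x in Omega. grad V x = C - primitive n x" using poisson_rep[OF n V] by blast
  have V1: "V \<in> H1" using V by (simp add: poisson_solution_def H1_0_def)
  have [measurable]: "grad V \<in> borel_measurable Omega" "g \<in> borel_measurable Omega" "primitive n \<in> borel_measurable Omega"
    using H1_grad(1)[OF V1] g primitive_Omega_measurable[OF n] by (auto simp: L2_fun_def)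
  have "(LINT x|Omega. grad V x * g x) = (LINT x|Omega. C * g x - primitive n x * g x)"
    by (rule integral_cong_AE) (use C in \<open>auto elim!: eventually_mono simp: left_diff_distrib\<close>)
  also have "\<dots> = - (LINT x|Omega. primitive n x * g x)"
    using integrable_continuous_scaleR[OF continuous_primitive[OF n] g(1)] g by simp
  also have "\<dots> = (LINT x|Omega. n x * primitive g x)"
    using integral_primitive_mult[OF n g(1)] g(2) by simp
  finally show ?thesis by simp
qed

text \<open>The gradients differ by a constant, and both have mean 0 by the boundary conditions.
  Densities equal almost everywhere are allowed because a density is only determined up to null
  sets.\<close>

lemma poisson_grad_unique:
  assumes n: "integrable Omega n" "integrable Omega n'" "AE x in Omega. n x = n' x"
    and V: "poisson_solution n V" "poisson_solution n' V'"
  shows "AE x in Omega. grad V x = grad V' x"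
proof -
  obtain C where C: "AE x in Omega. grad V x = C - primitive n x" using poisson_rep[OF n(1) V(1)] by blast
  obtain C' where C': "AE x in Omega. grad V' x = C' - primitive n' x" using poisson_rep[OF n(2) V(2)] by blast
  have eq: "primitive n x = primitive n' x" for x
    unfolding primitive_def
  proof (rule integral_cong_AE)
    show "AE y in Omega. indicator {..x} y *\<^sub>R n y = indicator {..x} y *\<^sub>R n' y"
      using n(3) by eventually_elim simp
  qed (use integrable_indicator_scaleR[OF n(1)] integrable_indicator_scaleR[OF n(2)] in auto)
  have diff: "AE x in Omega. grad V x = (C - C') + grad V' x" using C C' by eventually_elim (simp add: eq)
  have H: "V \<in> H1_0" "V' \<in> H1_0" using V by (auto simp: poisson_solution_def)
  have i: "integrable Omega (grad V)" "integrable Omega (grad V')"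
    using H H1_grad(1) by (auto simp: H1_0_def intro: L2_fun_integrable)
  have "(LINT x|Omega. grad V x) = (LINT x|Omega. (C - C') + grad V' x)"
    by (rule integral_cong_AE) (use i diff in auto)
  then have "C - C' = 0" using H1_0_rep(2)[OF H(1)] H1_0_rep(2)[OF H(2)] i by (simp add: measure_restrict_space)
  then show ?thesis using diff by auto
qed

lemma poisson_energy_unique:
  assumes n: "integrable Omega n" "integrable Omega n'" "AE x in Omega. n x = n' x"
    and V: "poisson_solution n V"
  shows "L2_norm (grad (poisson_potential n')) = L2_norm (grad V)"
proof -
  have V': "poisson_solution n' (poisson_potential n')"
    unfolding poisson_potential_def using poisson_exists[OF n(2)] by (rule someI_ex)
  have H: "V \<in> H1" "poisson_potential n' \<in> H1" using V V' by (auto simp: poisson_solution_def H1_0_def)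
  have [measurable]: "grad V \<in> borel_measurable Omega" "grad (poisson_potential n') \<in> borel_measurable Omega"
    using H H1_grad(1) by (auto simp: L2_fun_def)
  have "(LINT x|Omega. (norm (grad (poisson_potential n') x))\<^sup>2) = (LINT x|Omega. (norm (grad V x))\<^sup>2)"
    by (rule integral_cong_AE) (use poisson_grad_unique[OF n V V'] in \<open>auto elim: eventually_mono\<close>)
  then show ?thesis by (simp add: L2_norm_def)
qed

lemma Linf_mult_integrable:
  fixes f \<phi> :: "real \<Rightarrow> real"
  assumes \<phi>: "\<phi> \<in> Linf_fun" and f: "integrable Omega f"
  shows "integrable Omega (\<lambda>x. \<phi> x * f x)"
proof -
  obtain C where C: "AE x in Omega. \<bar>\<phi> x\<bar> \<le> C" using \<phi> by (auto simp: Linf_fun_def)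
  have [measurable]: "\<phi> \<in> borel_measurable Omega" "f \<in> borel_measurable Omega"
    using \<phi> f by (auto simp: Linf_fun_def)
  show ?thesis
  proof (rule Bochner_Integration.integrable_bound)
    show "integrable Omega (\<lambda>x. C * f x)" using f by simp
    show "AE x in Omega. norm (\<phi> x * f x) \<le> norm (C * f x)"
      using C by eventually_elim (auto simp: abs_mult intro!: mult_right_mono)
  qed measurable
qed

lemma density_unique_AE:
  assumes n: "is_density P n" and n': "is_density P n'"
  shows "AE x in Omega. n x = n' x"
proof -
  have i: "integrable Omega n" "integrable Omega n'" using n n' by (auto simp: is_density_def)
  then have [measurable]: "n \<in> borel_measurable Omega" "n' \<in> borel_measurable Omega" by auto
  \<comment> \<open>This bounded test function turns equality of the traces into vanishing of the L1
    distance.\<close>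
  define \<phi> where "\<phi> x = sgn (n x - n' x)" for x
  have \<phi>: "\<phi> \<in> Linf_fun"
    unfolding Linf_fun_def
  proof (intro CollectI conjI exI)
    show "\<phi> \<in> borel_measurable Omega" unfolding \<phi>_def by measurable
    show "AE x in Omega. \<bar>\<phi> x\<bar> \<le> 1" by (auto simp: \<phi>_def sgn_if)
  qed
  have "complex_of_real (LINT x|Omega. \<phi> x * n x) = complex_of_real (LINT x|Omega. \<phi> x * n' x)"
    using n n' \<phi> unfolding is_density_def by metis
  then have "(LINT x|Omega. \<phi> x * n x - \<phi> x * n' x) = 0"
    using Linf_mult_integrable[OF \<phi>] i by simp
  moreover have "\<phi> x * n x - \<phi> x * n' x = \<bar>n x - n' x\<bar>" for x
    by (auto simp: \<phi>_def sgn_if)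
  ultimately have "(LINT x|Omega. \<bar>n x - n' x\<bar>) = 0" by simp
  then have "AE x in Omega. \<bar>n x - n' x\<bar> = 0"
    using integral_nonneg_eq_0_iff_AE[of Omega "\<lambda>x. \<bar>n x - n' x\<bar>"] i by auto
  then show ?thesis by simp
qed

section \<open>The Fourier basis\<close>

definition freq :: "int \<Rightarrow> complex" where
  "freq m = of_real (2 * pi * of_int m) * \<i>"

definition fourier :: "int \<Rightarrow> real \<Rightarrow> complex" where
  "fourier m x = exp (freq m * of_real x)"

definition fourier_vec :: "int \<Rightarrow> L2" where
  "fourier_vec m = abs_L2 (fourier m)"

lemma fourier_deriv: "((\<lambda>x. c * fourier m x) has_vector_derivative c * (freq m * fourier m x)) (at x)"
proof -
  have "((\<lambda>z. c * exp (freq m * z)) has_field_derivative c * (freq m * exp (freq m * of_real x))) (at (of_real x))"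
    by (auto intro!: derivative_eq_intros)
  from has_vector_derivative_real_field[OF this] show ?thesis by (simp add: fourier_def[abs_def])
qed

lemma fourier_continuous [continuous_intros]: "continuous_on S (fourier m)"
  unfolding fourier_def by (intro continuous_intros)

lemma fourier_0 [simp]: "fourier m 0 = 1" "fourier 0 x = 1"
  by (simp_all add: fourier_def freq_def)

lemma fourier_1 [simp]: "fourier m 1 = 1"
  using exp_integer_2pi[of "of_int m"] by (simp add: fourier_def freq_def mult_ac)

lemma fourier_add: "fourier (m + k) x = fourier m x * fourier k x"
  by (simp add: fourier_def freq_def exp_add[symmetric] algebra_simps)

lemma fourier_cnj: "cnj (fourier m x) = fourier (- m) x"
  by (simp add: fourier_def freq_def exp_cnj)

lemma freq_minus [simp]: "freq (- m) = - freq m" by (simp add: freq_def)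

lemma freq_eq_0 [simp]: "freq m = 0 \<longleftrightarrow> m = 0" by (simp add: freq_def)

lemma freq_square: "- (freq m * freq m) = of_real ((2 * pi * of_int m)\<^sup>2)"
  by (simp add: freq_def power2_eq_square algebra_simps)

lemma integral_fourier_deriv: "(LINT x|Omega. c * (freq m * fourier m x)) = 0"
  using integral_Omega_deriv[OF fourier_deriv, of c m] by (simp add: continuous_intros)

lemma integral_fourier: "(LINT x|Omega. fourier m x) = (if m = 0 then 1 else 0)"
proof (cases "m = 0")
  case False
  then show ?thesis using integral_fourier_deriv[of "1 / freq m" m] by simp
qed (simp add: measure_restrict_space)

lemma fourier_L2 [simp]: "fourier m \<in> L2_fun"
  by (intro continuous_L2_fun continuous_intros)

lemma cinner_fourier_vec: "f \<in> L2_fun \<Longrightarrow> cinner (fourier_vec m) (abs_L2 f) = (LINT x|Omega. fourier (-m) x * f x)"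
  by (simp add: fourier_vec_def cinner_abs fourier_cnj)

lemma cinner_fourier_vecs: "cinner (fourier_vec m) (fourier_vec k) = (if m = k then 1 else 0)"
proof -
  have "cinner (fourier_vec m) (fourier_vec k) = (LINT x|Omega. fourier (k - m) x)"
    unfolding fourier_vec_def[of k] cinner_fourier_vec[OF fourier_L2]
    using fourier_add[of "-m" k] by simp
  then show ?thesis by (auto simp: integral_fourier)
qed

lemma inj_fourier_vec: "inj fourier_vec"
proof (rule injI)
  fix m k assume "fourier_vec m = fourier_vec k"
  then have "cinner (fourier_vec m) (fourier_vec k) = 1" using cinner_fourier_vecs[of m m] by simp
  then show "m = k" unfolding cinner_fourier_vecs by (auto split: if_splits)
qed

text \<open>A continuous map from a compact space is a quotient map onto its image. Used to pass
  from the interval to the circle with its ends glued.\<close>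

lemma continuous_on_compact_image:
  fixes p :: "'a::metric_space \<Rightarrow> 'b::metric_space" and f :: "'b \<Rightarrow> 'c::metric_space"
  assumes K: "compact K" and p: "continuous_on K p" and fp: "continuous_on K (\<lambda>x. f (p x))"
  shows "continuous_on (p ` K) f"
proof -
  have c: "closed (p ` K)" using compact_continuous_image[OF p K] by (rule compact_imp_closed)
  show ?thesis
    unfolding continuous_on_closed_vimage[OF c]
  proof (intro allI impI)
    fix B :: "'c set" assume "closed B"
    have "closed (K \<inter> (\<lambda>x. f (p x)) -` B)"
      by (rule continuous_closed_preimage[OF fp compact_imp_closed[OF K] \<open>closed B\<close>])
    then have "compact (K \<inter> (\<lambda>x. f (p x)) -` B)" using K compact_Int_closed[of K "K \<inter> (\<lambda>x. f (p x)) -` B"] by simp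
    then have "compact (p ` (K \<inter> (\<lambda>x. f (p x)) -` B))"
      by (intro compact_continuous_image continuous_on_subset[OF p]) auto
    moreover have "f -` B \<inter> p ` K = p ` (K \<inter> (\<lambda>x. f (p x)) -` B)" by auto
    ultimately show "closed (f -` B \<inter> p ` K)" by (simp add: compact_imp_closed)
  qed
qed

lemma L2_fun_mult_continuous:
  fixes f :: "real \<Rightarrow> complex"
  assumes c: "continuous_on {0..1} c" and f: "f \<in> L2_fun"
  shows "(\<lambda>x. of_real (c x) * f x) \<in> L2_fun"
proof (rule L2_fun_mult_Linf[OF _ f])
  have "compact (c ` {0..1})" by (rule compact_continuous_image[OF c]) simp
  then obtain C where "\<And>x. x \<in> {0..1} \<Longrightarrow> \<bar>c x\<bar> \<le> C"
    using bounded_iff compact_imp_bounded by (metis imageI real_norm_def)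
  then show "c \<in> Linf_fun"
    using continuous_Omega_measurable[OF c] by (auto simp: Linf_fun_def intro!: exI[of _ C] AE_I2)
qed

lemma integrable_fourier_mult:
  assumes "f \<in> L2_fun" shows "integrable Omega (\<lambda>x. fourier m x * f x)"
  using L2_fun_integrable_mult[OF fourier_L2[of "-m"] assms] by (simp add: fourier_cnj)

lemma continuous_polynomial_fourier:
  assumes "real_polynomial_function p" shows "continuous_on S (\<lambda>x. p (fourier m x))"
proof (rule continuous_on_compose2[of UNIV p S "fourier m"])
  show "continuous_on UNIV p"
    using assms by (simp add: continuous_on_polymonial_function real_polynomial_function_eq)
qed (auto intro: fourier_continuous)

text \<open>Induction over polynomials in the two real coordinates of the circle. \<open>f\<close>
  and \<open>m\<close> are arbitrary because, in the product case, q f takes the place of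
  \<open>f\<close> and must again be orthogonal to all modes.\<close>

lemma fourier_orthogonal_polynomial:
  assumes "real_polynomial_function p" and f: "f \<in> L2_fun" "\<And>m. (LINT x|Omega. fourier m x * f x) = 0"
  shows "(LINT x|Omega. fourier m x * (of_real (p (fourier 1 x)) * f x)) = 0"
  using assms
proof (induction arbitrary: f m)
  case (linear L)
  \<comment> \<open>A real linear form on the complex plane is a z + b cnj z, and on the circle cnj
    z is the mode -1.\<close>
  define a where "a = (of_real (L 1) - \<i> * of_real (L \<i>)) / 2"
  define b where "b = (of_real (L 1) + \<i> * of_real (L \<i>)) / 2"
  interpret L: bounded_linear L by fact
  have L: "of_real (L (fourier 1 x)) = a * fourier 1 x + b * fourier (-1) x" for x
  proof -
    define z where "z = fourier 1 x"
    have "L z = L (Re z *\<^sub>R 1 + Im z *\<^sub>R \<i>)"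
      by (rule arg_cong[where f=L]) (simp add: complex_eq_iff)
    also have "\<dots> = Re z * L 1 + Im z * L \<i>" by (simp only: L.add L.scaleR real_scaleR_def)
    finally have "of_real (L z) = a * z + b * cnj z"
      by (simp add: a_def b_def complex_eq_iff field_simps)
    then show ?thesis by (simp add: z_def fourier_cnj)
  qed
  have "(LINT x|Omega. fourier m x * (of_real (L (fourier 1 x)) * f x))
     = (LINT x|Omega. a * (fourier (m + 1) x * f x) + b * (fourier (m - 1) x * f x))"
    using fourier_add[of m 1] fourier_add[of m "-1"]
    by (intro Bochner_Integration.integral_cong) (auto simp: L algebra_simps)
  then show ?case using linear by (simp add: integrable_fourier_mult)
next
  case (const c)
  have "(LINT x|Omega. fourier m x * (of_real c * f x)) = of_real c * (LINT x|Omega. fourier m x * f x)"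
    by (simp flip: integral_mult_right_zero add: mult.left_commute)
  then show ?case using const by simp
next
  case (add p q)
  have c: "continuous_on {0..1} (\<lambda>x. p (fourier 1 x))" "continuous_on {0..1} (\<lambda>x. q (fourier 1 x))"
    by (intro continuous_polynomial_fourier add)+
  show ?case
    using add integrable_fourier_mult[OF L2_fun_mult_continuous[OF c(1) add.prems(1)]]
      integrable_fourier_mult[OF L2_fun_mult_continuous[OF c(2) add.prems(1)]]
    by (simp add: distrib_left distrib_right)
next
  case (mult p q)
  have c: "continuous_on {0..1} (\<lambda>x. q (fourier 1 x))"
    by (intro continuous_polynomial_fourier mult)
  have "(LINT x|Omega. fourier m x * (of_real (p (fourier 1 x)) * (of_real (q (fourier 1 x)) * f x))) = 0"
    by (rule mult.IH(1)[OF L2_fun_mult_continuous[OF c mult.prems(1)] mult.IH(2)[OF mult.prems]])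
  then show ?case by (simp add: mult.assoc)
qed

text \<open>A continuous function supported inside (0,1) descends to the circle, where
  Stone-Weierstrass approximates it by polynomials; \<open>f\<close> is orthogonal to all of these,
  hence to the function.\<close>

lemma fourier_total:
  assumes f: "f \<in> L2_fun" "\<And>m. (LINT x|Omega. fourier m x * f x) = 0"
  shows "AE x in Omega. f x = 0"
proof -
  have fi: "integrable Omega f" by (rule L2_fun_integrable[OF f(1)])
  have zero: "(LINT x|Omega. of_real (\<psi> x) * f x) = 0"
    if \<psi>: "continuous_on UNIV \<psi>" and cd: "0 < c" "d < 1" and \<psi>z: "\<And>x. x \<notin> {c..d} \<Longrightarrow> \<psi> x = 0"
    for \<psi> :: "real \<Rightarrow> real" and c d
  proof -
    have \<psi>': "continuous_on {0..1} \<psi>" using \<psi> by (rule continuous_on_subset) simp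
    define F where "F w = \<psi> (Arg2pi w / (2 * pi))" for w
    have F: "F (fourier 1 x) = \<psi> x" if "x \<in> {0..1}" for x
    proof (cases "x = 1")
      case True
      \<comment> \<open>Both ends are mapped to 1, where \<open>Arg2pi\<close> returns 0;
        \<open>\<psi>\<close> vanishes at both ends.\<close>
      then show ?thesis using \<psi>z[of 0] \<psi>z[of 1] cd by (simp add: F_def Arg2pi_of_real[of 1, simplified])
    next
      case False
      have "Arg2pi (fourier 1 x) = Im (freq 1 * of_real x)"
        unfolding fourier_def by (rule Arg2pi_exp) (use that False in \<open>auto simp: freq_def\<close>)
      then show ?thesis by (simp add: F_def freq_def)
    qed
    have cF: "continuous_on (fourier 1 ` {0..1}) F"
      by (rule continuous_on_compact_image[OF compact_Icc fourier_continuous])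
         (rule continuous_on_eq[OF \<psi>'], simp add: F)
    have "cmod (LINT x|Omega. of_real (\<psi> x) * f x) \<le> e * (LINT x|Omega. cmod (f x))" if "0 < e" for e
    proof -
      have "compact (fourier 1 ` {0..1})" by (intro compact_continuous_image continuous_intros) simp
      then obtain p where p: "real_polynomial_function p" "\<And>w. w \<in> fourier 1 ` {0..1} \<Longrightarrow> \<bar>F w - p w\<bar> < e"
        using Stone_Weierstrass_real_polynomial_function[OF _ cF \<open>0 < e\<close>] by blast
      have cp: "continuous_on {0..1} (\<lambda>x. p (fourier 1 x))"
        by (rule continuous_polynomial_fourier[OF p(1)])
      have i: "integrable Omega (\<lambda>x. of_real (\<psi> x) * f x)" "integrable Omega (\<lambda>x. of_real (p (fourier 1 x)) * f x)"
        using integrable_continuous_scaleR[OF \<psi>' fi] integrable_continuous_scaleR[OF cp fi]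
        by (auto simp: scaleR_conv_of_real)
      have "(LINT x|Omega. of_real (\<psi> x) * f x) = (LINT x|Omega. of_real (\<psi> x) * f x - of_real (p (fourier 1 x)) * f x)"
        using i fourier_orthogonal_polynomial[OF p(1) f, of 0] by simp
      also have "cmod \<dots> \<le> (LINT x|Omega. cmod (of_real (\<psi> x) * f x - of_real (p (fourier 1 x)) * f x))"
        by (rule integral_norm_bound)
      also have "\<dots> \<le> (LINT x|Omega. e * cmod (f x))"
      proof (rule integral_mono)
        fix x assume x: "x \<in> space Omega"
        have "cmod (of_real (\<psi> x) * f x - of_real (p (fourier 1 x)) * f x) = \<bar>\<psi> x - p (fourier 1 x)\<bar> * cmod (f x)"
          by (simp flip: left_diff_distrib of_real_diff add: norm_mult)
        also have "\<dots> \<le> e * cmod (f x)"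
          using p(2)[of "fourier 1 x"] F[of x] x by (intro mult_right_mono) auto
        finally show "cmod (of_real (\<psi> x) * f x - of_real (p (fourier 1 x)) * f x) \<le> e * cmod (f x)" .
      qed (use i fi in auto)
      finally show ?thesis by simp
    qed
    from nonpos_if_le_multiples[OF this] have "cmod (LINT x|Omega. of_real (\<psi> x) * f x) \<le> 0" by simp
    then show ?thesis by simp
  qed
  have ae: "AE x in Omega. f x \<bullet> b = 0" for b
  proof (rule AE_zero_if_orthogonal_continuous)
    fix \<psi> :: "real \<Rightarrow> real" and c d :: real
    assume a: "continuous_on UNIV \<psi>" "0 < c" "d < 1" "\<And>x. x \<notin> {c..d} \<Longrightarrow> \<psi> x = 0"
    have "continuous_on {0..1} \<psi>" using a(1) by (rule continuous_on_subset) simp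
    from integral_inner_left[OF integrable_continuous_scaleR[OF this fi], of b]
    show "(LINT x|Omega. \<psi> x * (f x \<bullet> b)) = 0" using zero[OF a] by (simp add: scaleR_conv_of_real[symmetric])
  qed (use fi in simp)
  from ae[of 1] ae[of \<i>] show ?thesis
    by eventually_elim (simp add: inner_complex_def complex_eq_iff)
qed

lemma onb_fourier: "onb (range fourier_vec)"
  unfolding onb_def
proof (intro conjI allI impI)
  show "\<forall>e\<in>range fourier_vec. \<forall>f\<in>range fourier_vec. cinner e f = (if e = f then 1 else 0)"
    using inj_fourier_vec by (auto simp: cinner_fourier_vecs inj_eq)
  fix u assume u: "\<forall>e\<in>range fourier_vec. cinner e u = 0"
  obtain f where f: "u = abs_L2 f" "f \<in> L2_fun" by (rule L2_cases)
  have "(LINT x|Omega. fourier m x * f x) = 0" for m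
    using u cinner_fourier_vec[OF f(2), of "-m"] f(1) by simp
  from fourier_total[OF f(2) this] have "abs_L2 f = abs_L2 (\<lambda>x. 0)"
    by (subst abs_L2_eq_iff) (use f L2_fun_zero in auto)
  then show "u = 0" by (simp add: f(1) zero_L2_def)
qed

lemma has_sum_fourier_iff: "(f has_sum s) (range fourier_vec) \<longleftrightarrow> ((\<lambda>m. f (fourier_vec m)) has_sum s) UNIV"
  using has_sum_reindex[OF inj_fourier_vec, of f s] by (simp add: o_def)

lemma fourier_parseval: "((\<lambda>m. cinner u (fourier_vec m) * cinner (fourier_vec m) v) has_sum cinner u v) UNIV"
  using parseval[OF onb_fourier] unfolding has_sum_fourier_iff .

lemma fourier_eqI: "(\<And>m. cinner (fourier_vec m) u = cinner (fourier_vec m) v) \<Longrightarrow> u = v"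
  by (rule onb_eqI[OF onb_fourier]) auto

text \<open>Integration by parts; periodicity enters as the vanishing means of \<open>grad f\<close>
  and of the derivative of the mode, which remove all boundary terms.\<close>

lemma fourier_coeff_grad:
  assumes f: "f \<in> H1_per"
  shows "cinner (fourier_vec m) (abs_L2 (grad f)) = freq m * cinner (fourier_vec m) (abs_L2 f)"
proof -
  have f1: "f \<in> H1" "f \<in> L2_fun" using f by (auto simp: H1_per_def H1_def)
  have g: "grad f \<in> L2_fun" by (rule H1_grad(1)[OF f1(1)])
  have gi: "integrable Omega (grad f)" by (rule L2_fun_integrable[OF g])
  obtain C where C: "AE x in Omega. f x = C + primitive (grad f) x" and g0: "(LINT x|Omega. grad f x) = 0"
    using H1_per_rep[OF f] by blast
  define e where "e = fourier (-m)"
  define e' where "e' x = freq (-m) * e x" for x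
  have c': "continuous_on S e'" for S unfolding e'_def e_def by (intro continuous_intros)
  have e'i: "integrable Omega e'" by (rule continuous_Omega_integrable[OF c'])
  have e: "e x = 1 + primitive e' x" if "x \<in> {0..1}" for x
    using primitive_deriv[OF _ c' that, of e] fourier_deriv[of 1 "-m"] by (simp add: e_def e'_def[abs_def])
  have e'0: "(LINT x|Omega. e' x) = 0" using integral_fourier_deriv[of 1 "-m"] by (simp add: e_def e'_def)
  have pe: "integrable Omega (\<lambda>x. primitive e' x * grad f x)"
  proof -
    have "integrable Omega (\<lambda>x. e x * grad f x - grad f x)"
      using integrable_fourier_mult[OF g] gi by (simp add: e_def)
    then show ?thesis
      by (rule Bochner_Integration.integrable_cong[THEN iffD1, OF refl, rotated]) (simp add: e algebra_simps)
  qed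
  have [measurable]: "f \<in> borel_measurable Omega" "e' \<in> borel_measurable Omega" "primitive (grad f) \<in> borel_measurable Omega"
    using f1 e'i primitive_Omega_measurable[OF gi] by (auto simp: L2_fun_def)
  have "cinner (fourier_vec m) (abs_L2 (grad f)) = (LINT x|Omega. e x * grad f x)"
    by (simp add: cinner_fourier_vec[OF g] e_def)
  also have "\<dots> = (LINT x|Omega. grad f x + primitive e' x * grad f x)"
    by (intro Bochner_Integration.integral_cong) (auto simp: e algebra_simps)
  also have "\<dots> = - (LINT x|Omega. e' x * primitive (grad f) x)"
    using pe gi g0 integral_primitive_mult[OF e'i gi] by simp
  also have "(LINT x|Omega. e' x * primitive (grad f) x) = (LINT x|Omega. C * e' x + e' x * primitive (grad f) x)"
  proof -
    have "integrable Omega (\<lambda>x. e' x * primitive (grad f) x)"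
      by (intro continuous_Omega_integrable continuous_intros c' continuous_primitive[OF gi])
    then show ?thesis using e'i e'0 by simp
  qed
  also have "\<dots> = (LINT x|Omega. e' x * f x)"
    by (rule integral_cong_AE) (use C in \<open>auto elim!: eventually_mono simp: algebra_simps\<close>)
  also have "- \<dots> = freq m * (LINT x|Omega. e x * f x)"
    by (simp add: e'_def mult.assoc)
  also have "\<dots> = freq m * cinner (fourier_vec m) (abs_L2 f)"
    by (simp add: cinner_fourier_vec[OF f1(2)] e_def)
  finally show ?thesis .
qed

section \<open>Schroedinger operators in Fourier coordinates\<close>

text \<open>Replaces the representative \<open>f\<close> and its chosen gradients in the graph by
  conditions on classes: \<open>h\<close> is the class of minus the second derivative, described by
  its Fourier coefficients.\<close>

lemma schroedinger_fourier:
  assumes W: "W \<in> Linf_fun" and uw: "(u, w) \<in> schroedinger W"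
  obtains h where "w = h + mult_op W u"
    "\<And>m. cinner (fourier_vec m) h = of_real ((2 * pi * of_int m)\<^sup>2) * cinner (fourier_vec m) u"
proof -
  obtain f where f: "f \<in> H1_per" "grad f \<in> H1_per" "u = abs_L2 f"
     "w = abs_L2 (\<lambda>x. - grad (grad f) x + of_real (W x) * f x)"
    using uw by (auto simp: schroedinger_def)
  have L: "f \<in> L2_fun" "grad f \<in> L2_fun" "grad f \<in> H1" using f by (auto simp: H1_per_def H1_def)
  have gg: "grad (grad f) \<in> L2_fun" by (rule H1_grad(1)[OF L(3)])
  define h where "h = abs_L2 (\<lambda>x. - grad (grad f) x)"
  have "w = h + mult_op W u"
    by (simp add: h_def f(3,4) mult_op_abs[OF W L(1)] plus_abs L2_fun_uminus[OF gg] L2_fun_mult_Linf[OF W L(1)])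
  moreover have "cinner (fourier_vec m) h = of_real ((2 * pi * of_int m)\<^sup>2) * cinner (fourier_vec m) u" for m
  proof -
    have "h = - abs_L2 (grad (grad f))" by (simp add: h_def uminus_L2.abs_eq gg)
    then have "cinner (fourier_vec m) h = - (freq m * freq m) * cinner (fourier_vec m) u"
      using fourier_coeff_grad[OF f(1)] fourier_coeff_grad[OF f(2)] by (simp add: cinner_minus_right f(3))
    then show ?thesis by (simp add: freq_square)
  qed
  ultimately show ?thesis using that by blast
qed

text \<open>Equality is assumed almost everywhere only, so that the lemma applies a second time, to
  the chosen gradient of a mode.\<close>

lemma fourier_H1_per:
  assumes f: "f \<in> borel_measurable Omega" "AE x in Omega. f x = c * fourier m x"
  shows "f \<in> H1_per" "AE x in Omega. grad f x = c * freq m * fourier m x"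
proof -
  define g where "g x = c * freq m * fourier m x" for x
  have c: "continuous_on S g" for S unfolding g_def by (intro continuous_intros)
  have g: "g \<in> L2_fun" by (rule continuous_L2_fun[OF c])
  have g0: "(LINT x|Omega. g x) = 0" using integral_fourier_deriv[of c m] by (simp add: g_def mult.assoc)
  have "c * fourier m x = c + primitive g x" if "x \<in> {0..1}" for x
    using primitive_deriv[OF _ c that, of "\<lambda>x. c * fourier m x"] fourier_deriv[of c m]
    by (simp add: g_def[abs_def] mult.assoc)
  moreover have "AE x in Omega. x \<in> {0..1}" by (intro AE_I2) simp
  ultimately have "AE x in Omega. f x = c + primitive g x"
    using f(2) by (auto elim!: eventually_elim2)
  from H1_perI[OF f(1) g g0 this] grad_eqI(2)[OF f(1) g this]
  show "f \<in> H1_per" "AE x in Omega. grad f x = c * freq m * fourier m x" by (simp_all add: g_def)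
qed

lemma fourier_vec_schroedinger:
  "(fourier_vec m, ((2 * pi * of_int m)\<^sup>2) *\<^sub>R fourier_vec m) \<in> schroedinger (\<lambda>x. 0)"
proof -
  have "fourier m \<in> borel_measurable Omega" by (intro continuous_Omega_measurable continuous_intros)
  note 1 = fourier_H1_per[OF this, of 1 m, simplified]
  have "grad (fourier m) \<in> L2_fun" using 1(1) H1_grad(1) by (auto simp: H1_per_def)
  then have "grad (fourier m) \<in> borel_measurable Omega" by (simp add: L2_fun_def)
  note 2 = fourier_H1_per[OF this 1(2)]
  have L: "grad (grad (fourier m)) \<in> L2_fun" using 2(1) H1_grad(1) by (auto simp: H1_per_def)
  have "((2 * pi * of_int m)\<^sup>2) *\<^sub>R fourier_vec m = abs_L2 (\<lambda>x. ((2 * pi * of_int m)\<^sup>2) *\<^sub>R fourier m x)"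
    by (simp add: fourier_vec_def scaleR_abs)
  also have "\<dots> = abs_L2 (\<lambda>x. - grad (grad (fourier m)) x + of_real 0 * fourier m x)"
  proof (subst abs_L2_eq_iff)
    have "(2 * pi * of_int m)\<^sup>2 *\<^sub>R z = - (freq m * freq m * z)" for z
      using arg_cong[OF freq_square[of m], of "\<lambda>w. w * z"] by (simp only: scaleR_conv_of_real mult_minus_left)
    with 2(2) show "AE x in Omega. (2 * pi * of_int m)\<^sup>2 *\<^sub>R fourier m x = - grad (grad (fourier m)) x + of_real 0 * fourier m x"
      by (auto elim!: eventually_mono)
    show "(\<lambda>x. (2 * pi * of_int m)\<^sup>2 *\<^sub>R fourier m x) \<in> L2_fun" by (rule L2_fun_scaleR) simp
    show "(\<lambda>x. - grad (grad (fourier m)) x + of_real 0 * fourier m x) \<in> L2_fun" using L2_fun_uminus[OF L] by simp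
  qed
  finally show ?thesis using 1(1) 2(1) unfolding schroedinger_def fourier_vec_def by auto
qed

lemma fourier_expansion: "((\<lambda>m. scaleC_L2 (cinner (fourier_vec m) u) (fourier_vec m)) has_sum u) UNIV"
  using onb_expansion[OF onb_fourier, of u] unfolding has_sum_fourier_iff .

lemma fourier_parseval_norm: "((\<lambda>m. (cmod (cinner (fourier_vec m) u))\<^sup>2) has_sum (norm u)\<^sup>2) UNIV"
  using parseval_norm[OF onb_fourier, of u] unfolding has_sum_fourier_iff .

section \<open>The square root of the periodic Laplacian as a Fourier multiplier\<close>

lemma sqrt_freq: "sqrt ((2 * pi * of_int m)\<^sup>2) = 2 * pi * \<bar>of_int m\<bar>"
  by (simp add: abs_mult)

lemma abs_freq_square:
  "complex_of_real (2 * pi * \<bar>of_int m\<bar>) * (of_real (2 * pi * \<bar>of_int m\<bar>) * z) = of_real ((2 * pi * of_int m)\<^sup>2) * z"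
proof -
  have "(2 * pi * \<bar>of_int m\<bar>) * (2 * pi * \<bar>of_int m\<bar>) = (2 * pi * real_of_int m)\<^sup>2"
    by (simp add: power2_eq_square abs_mult_self_eq)
  then show ?thesis by (simp only: mult.assoc[symmetric] of_real_mult[symmetric])
qed

lemma cinner_real_multiple_left:
  "cinner g u' = of_real r * cinner g u \<Longrightarrow> cinner u' g = of_real r * cinner u g"
  by (metis cinner_commute complex_cnj_complex_of_real complex_cnj_mult)

text \<open>The Fourier basis diagonalises the Laplacian. Independence from the basis hidden in
  \<open>fun_calc\<close> needs eigenvectors to different eigenvalues to be orthogonal: Parseval
  with real multipliers gives the symmetry.\<close>

lemma sqrt_H0_iff:
  "(u, v) \<in> sqrt_H0 \<longleftrightarrow>
    (\<forall>m. cinner (fourier_vec m) v = of_real (2 * pi * \<bar>of_int m\<bar>) * cinner (fourier_vec m) u)"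
proof -
  define l where "l e = (2 * pi * of_int (inv fourier_vec e))\<^sup>2" for e
  have l: "l (fourier_vec m) = (2 * pi * of_int m)\<^sup>2" for m
    by (simp add: l_def inv_f_f[OF inj_fourier_vec])
  have "(u, v) \<in> sqrt_H0 \<longleftrightarrow> (\<forall>e\<in>range fourier_vec. cinner e v = of_real (sqrt (l e)) * cinner e u)"
    unfolding sqrt_H0_def
  proof (rule fun_calc_iff[OF onb_fourier])
    show "(e, l e *\<^sub>R e) \<in> schroedinger (\<lambda>x. 0)" if "e \<in> range fourier_vec" for e
      using that fourier_vec_schroedinger by (auto simp: l)
  next
    fix a b :: L2 and s t :: real
    assume a: "(a, s *\<^sub>R a) \<in> schroedinger (\<lambda>x. 0)" and b: "(b, t *\<^sub>R b) \<in> schroedinger (\<lambda>x. 0)" and st: "s \<noteq> t"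
    have W: "(\<lambda>x. 0) \<in> Linf_fun" by (auto simp: Linf_fun_def)
    have W0: "mult_op (\<lambda>x. 0) w = 0" for w using norm_mult_op_le[OF W, of 0 w] by simp
    have co: "cinner (fourier_vec m) (r *\<^sub>R w) = of_real ((2 * pi * of_int m)\<^sup>2) * cinner (fourier_vec m) w"
      if rw: "(w, r *\<^sub>R w) \<in> schroedinger (\<lambda>x. 0)" for w r m
      using schroedinger_fourier[OF W rw] W0 by (metis add.right_neutral)
    have "cinner (s *\<^sub>R a) (fourier_vec m) * cinner (fourier_vec m) b
        = cinner a (fourier_vec m) * cinner (fourier_vec m) (t *\<^sub>R b)" for m
      unfolding co[OF b] cinner_real_multiple_left[OF co[OF a]] by (simp only: mult_ac)
    then have "cinner (s *\<^sub>R a) b = cinner a (t *\<^sub>R b)"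
      using fourier_parseval[of "s *\<^sub>R a" b] fourier_parseval[of a "t *\<^sub>R b"] by (simp add: has_sum_unique)
    then show "cinner a b = 0" using st by (rule orthogonal_if_symmetric)
  qed
  also have "\<dots> \<longleftrightarrow> (\<forall>m. cinner (fourier_vec m) v = of_real (2 * pi * \<bar>of_int m\<bar>) * cinner (fourier_vec m) u)"
    by (simp only: ball_simps l sqrt_freq)
  finally show ?thesis .
qed

lemma sqrt_H0_cinner:
  assumes u: "(u, u') \<in> sqrt_H0" and v: "(v, v') \<in> sqrt_H0"
  shows "cinner u v' = cinner u' v"
proof -
  have "cinner u (fourier_vec m) * cinner (fourier_vec m) v' = cinner u' (fourier_vec m) * cinner (fourier_vec m) v" for m
    using v[unfolded sqrt_H0_iff] cinner_real_multiple_left[OF u[unfolded sqrt_H0_iff, rule_format]]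
    by (simp only: mult_ac)
  then show ?thesis using fourier_parseval[of u v'] fourier_parseval[of u' v] by (simp add: has_sum_unique)
qed

lemma sqrt_H0_scaleC: "(u, v) \<in> sqrt_H0 \<Longrightarrow> (scaleC_L2 c u, scaleC_L2 c v) \<in> sqrt_H0"
  by (simp add: sqrt_H0_iff cinner_scaleC_right)

lemma sqrt_H0_diff: "(u, v) \<in> sqrt_H0 \<Longrightarrow> (u', v') \<in> sqrt_H0 \<Longrightarrow> (u - u', v - v') \<in> sqrt_H0"
  by (simp add: sqrt_H0_iff cinner_diff_right right_diff_distrib)

lemma sqrt_H0_sum: "(\<And>i. i \<in> A \<Longrightarrow> (u i, v i) \<in> sqrt_H0) \<Longrightarrow> (\<Sum>i\<in>A. u i, \<Sum>i\<in>A. v i) \<in> sqrt_H0"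
  by (simp add: sqrt_H0_iff cinner_sum_right sum_distrib_left)

lemma sqrt_H0_fourier_vec: "(fourier_vec m, (2 * pi * \<bar>of_int m\<bar>) *\<^sub>R fourier_vec m) \<in> sqrt_H0"
  by (auto simp: sqrt_H0_iff cinner_scaleR_right cinner_fourier_vecs)

text \<open>The contribution of mode \<open>m\<close> to the quadratic form of the free operator at
  \<open>u\<close>. Summability over \<open>m\<close> means membership in the form domain, without a
  gradient of \<open>u\<close> being mentioned.\<close>

abbreviation kinetic :: "int \<Rightarrow> L2 \<Rightarrow> real" where
  "kinetic m u \<equiv> (2 * pi * of_int m)\<^sup>2 * (cmod (cinner (fourier_vec m) u))\<^sup>2"

lemma sqrt_H0_norm:
  assumes "(u, v) \<in> sqrt_H0"
  shows "((\<lambda>m. kinetic m u) has_sum (norm v)\<^sup>2) UNIV"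
proof -
  have "(cmod (cinner (fourier_vec m) v))\<^sup>2 = kinetic m u" for m
    using assms by (simp add: sqrt_H0_iff norm_mult power_mult_distrib)
  then show ?thesis using fourier_parseval_norm[of v] by simp
qed

text \<open>Finite kinetic energy says that the multiplied coefficients are square summable, so some
  vector has them.\<close>

lemma sqrt_H0_exists:
  assumes "(\<lambda>m. kinetic m u) summable_on UNIV"
  obtains v where "(u, v) \<in> sqrt_H0"
proof -
  define c where "c e = of_real (2 * pi * \<bar>of_int (inv fourier_vec e)\<bar>) * cinner e u" for e
  have c: "c (fourier_vec m) = of_real (2 * pi * \<bar>of_int m\<bar>) * cinner (fourier_vec m) u" for m
    by (simp add: c_def inv_f_f[OF inj_fourier_vec])
  have "(\<lambda>e. (cmod (c e))\<^sup>2) summable_on range fourier_vec"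
    unfolding summable_on_def has_sum_fourier_iff c
    using assms by (simp add: norm_mult power_mult_distrib summable_on_def)
  then obtain v where "\<And>e. e \<in> range fourier_vec \<Longrightarrow> cinner e v = c e"
    by (rule onb_exists_coeff[OF onb_fourier]) blast
  then have "(u, v) \<in> sqrt_H0" by (simp add: sqrt_H0_iff c)
  then show ?thesis by (rule that)
qed

text \<open>\<open>sandwich_ext\<close> prescribes \<open>S\<close> on the domain of
  \<open>sqrt_H0\<close> only; this contains all modes, whose combinations are dense, and
  \<open>S\<close> is bounded.\<close>

lemma sandwich_unique:
  assumes S: "sandwich_ext P S" "sandwich_ext P S'" shows "S = S'"
proof (rule blinfun_eqI)
  fix u
  have eq: "S v = S' v" if "(v, w) \<in> sqrt_H0" for v w
    by (rule fourier_eqI) (use S that in \<open>simp add: sandwich_ext_def sqrt_H0_iff\<close>)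
  have "S (scaleC_L2 c (fourier_vec m)) = S' (scaleC_L2 c (fourier_vec m))" for c m
    by (rule eq[OF sqrt_H0_scaleC[OF sqrt_H0_fourier_vec]])
  then show "S u = S' u"
    using has_sum_bounded_linear[OF blinfun.bounded_linear_right fourier_expansion, of S u]
      has_sum_bounded_linear[OF blinfun.bounded_linear_right fourier_expansion, of S' u]
    by (simp add: has_sum_unique)
qed

text \<open>For (u, v) in \<open>sqrt_H0\<close>, symmetry of the root moves it over, so the
  expectation of \<open>S\<close> at \<open>u\<close> is that of \<open>P\<close> at
  \<open>v\<close>. Finite Fourier sums carry the sign to all vectors.\<close>

lemma sandwich_positive:
  assumes P: "positive_op P" and S: "sandwich_ext P S" "clinear_op S"
  shows "positive_op S"
proof -
  have dom: "cinner u (S u) = cinner v (P v)" if uv: "(u, v) \<in> sqrt_H0" for u v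
    using sqrt_H0_cinner[OF uv, of "P v" "S u"] S(1) uv by (simp add: sandwich_ext_def)
  have "Im (cinner u (S u)) = 0 \<and> 0 \<le> Re (cinner u (S u))" for u
  proof -
    define s where "s F = (\<Sum>m\<in>F. scaleC_L2 (cinner (fourier_vec m) u) (fourier_vec m))" for F
    have s: "(s \<longlongrightarrow> u) (finite_subsets_at_top UNIV)"
      using fourier_expansion[of u] by (simp add: has_sum_def s_def[abs_def])
    have lim: "((\<lambda>F. cinner (s F) (S (s F))) \<longlongrightarrow> cinner u (S u)) (finite_subsets_at_top UNIV)"
      by (intro tendsto_intros s)
    have F: "Im (cinner (s F) (S (s F))) = 0 \<and> 0 \<le> Re (cinner (s F) (S (s F)))" for F
    proof -
      have "(s F, \<Sum>m\<in>F. scaleC_L2 (cinner (fourier_vec m) u) ((2 * pi * \<bar>of_int m\<bar>) *\<^sub>R fourier_vec m)) \<in> sqrt_H0"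
        unfolding s_def by (intro sqrt_H0_sum sqrt_H0_scaleC sqrt_H0_fourier_vec)
      from dom[OF this] show ?thesis using P by (simp add: positive_op_def)
    qed
    have "((\<lambda>F. 0) \<longlongrightarrow> Im (cinner u (S u))) (finite_subsets_at_top (UNIV :: int set))"
      using tendsto_Im[OF lim] F by simp
    moreover have "0 \<le> Re (cinner u (S u))"
      by (rule tendsto_lowerbound[OF tendsto_Re[OF lim]]) (use F in auto)
    ultimately show ?thesis by (simp add: tendsto_const_iff)
  qed
  then show ?thesis using S(2) by (simp add: positive_op_def)
qed

text \<open>The trace of the sandwich in the Fourier basis, with \<open>P\<close> expanded in its
  eigenbasis; all terms are nonnegative, so the sums may be exchanged. \<open>\<tau> e\<close> is
  the kinetic energy of \<open>e\<close>, asserted only for nonzero eigenvalues, since a vector of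
  the kernel may lie outside the form domain.\<close>

lemma energy_trace:
  assumes P: "P \<in> energy_space_pos"
    and E: "onb E" and eig: "\<And>e. e \<in> E \<Longrightarrow> P e = \<mu> e *\<^sub>R e" and \<mu>: "\<And>e. 0 \<le> \<mu> e"
  obtains s \<tau> where "op_trace (sandwich P) = of_real s"
    "\<And>e. e \<in> E \<Longrightarrow> \<mu> e \<noteq> 0 \<Longrightarrow>
      ((\<lambda>m. kinetic m e) has_sum \<tau> e) UNIV"
    "((\<lambda>e. \<mu> e * \<tau> e) has_sum s) E"
proof -
  have P': "positive_op P" using P by (simp add: energy_space_pos_def)
  obtain S where S: "sandwich_ext P S" "trace_class S"
    using P unfolding energy_space_pos_def energy_space_def by (auto simp: op_abs_positive)
  have "sandwich P = S" unfolding sandwich_def using S(1) sandwich_unique by blast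
  have S': "positive_op S" using sandwich_positive[OF P' S(1)] S(2) by (simp add: trace_class_def)
  obtain B \<nu> where B: "onb B" "\<And>e. e \<in> B \<Longrightarrow> S e = \<nu> e *\<^sub>R e" "\<And>e. 0 \<le> \<nu> e" "\<nu> summable_on B"
    using trace_class_eigenbasis[OF S' S(2) onb_fourier] by blast
  define s where "s = infsum \<nu> B"
  have tr: "op_trace S = of_real s" unfolding s_def by (rule op_trace_eigenbasis[OF S' B])
  have "((\<lambda>m. Re (cinner (fourier_vec m) (S (fourier_vec m)))) has_sum s) UNIV"
    using op_trace_onb[OF S' B onb_fourier] unfolding has_sum_fourier_iff s_def .
  moreover have "Re (cinner (fourier_vec m) (S (fourier_vec m))) = (2 * pi * of_int m)\<^sup>2 * Re (cinner (fourier_vec m) (P (fourier_vec m)))" for m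
  proof -
    have "(P ((2 * pi * \<bar>of_int m\<bar>) *\<^sub>R fourier_vec m), S (fourier_vec m)) \<in> sqrt_H0"
      using S(1) sqrt_H0_fourier_vec by (simp add: sandwich_ext_def)
    then have "cinner (fourier_vec m) (S (fourier_vec m)) =
        of_real (2 * pi * \<bar>of_int m\<bar>) * (of_real (2 * pi * \<bar>of_int m\<bar>) * cinner (fourier_vec m) (P (fourier_vec m)))"
      by (simp only: sqrt_H0_iff blinfun.scaleR_right cinner_scaleR_right)
    also have "\<dots> = of_real ((2 * pi * of_int m)\<^sup>2) * cinner (fourier_vec m) (P (fourier_vec m))"
      by (rule abs_freq_square)
    finally show ?thesis by simp
  qed
  ultimately have sm: "((\<lambda>m. (2 * pi * of_int m)\<^sup>2 * Re (cinner (fourier_vec m) (P (fourier_vec m)))) has_sum s) UNIV"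
    by simp
  define f where "f = (\<lambda>(m, e). (2 * pi * of_int m)\<^sup>2 * (\<mu> e * (cmod (cinner (fourier_vec m) e))\<^sup>2))"
  have fm: "((\<lambda>e. f (m, e)) has_sum (2 * pi * of_int m)\<^sup>2 * Re (cinner (fourier_vec m) (P (fourier_vec m)))) E" for m
  proof -
    have "((\<lambda>e. Re (cinner (fourier_vec m) e * cinner e (P (fourier_vec m)))) has_sum Re (cinner (fourier_vec m) (P (fourier_vec m)))) E"
      by (rule has_sum_Re[OF parseval[OF E]])
    moreover have "Re (cinner (fourier_vec m) e * cinner e (P (fourier_vec m))) = \<mu> e * (cmod (cinner (fourier_vec m) e))\<^sup>2" if "e \<in> E" for e
    proof -
      have "cinner (fourier_vec m) e * cinner e (P (fourier_vec m))
          = of_real (\<mu> e) * (cinner e (fourier_vec m) * cinner (fourier_vec m) e)"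
        unfolding eigenbasis_coeff[OF P' eig[OF that]] by (simp add: mult_ac)
      then show ?thesis unfolding cinner_mult_commute by simp
    qed
    ultimately have "((\<lambda>e. \<mu> e * (cmod (cinner (fourier_vec m) e))\<^sup>2) has_sum Re (cinner (fourier_vec m) (P (fourier_vec m)))) E"
      by (simp cong: has_sum_cong)
    from has_sum_cmult_right[OF this] show ?thesis by (simp add: f_def)
  qed
  have "f summable_on UNIV \<times> E"
    by (rule summable_on_SigmaI[OF fm has_sum_imp_summable[OF sm]]) (simp add: f_def \<mu>)
  from has_sum_SigmaI[OF fm sm this] have "(f has_sum s) (UNIV \<times> E)" .
  then have fs: "((\<lambda>(e, m). f (m, e)) has_sum s) (E \<times> UNIV)" by (subst (asm) has_sum_swap)
  then have fe: "(\<lambda>m. f (m, e)) summable_on UNIV" if "e \<in> E" for e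
    using summable_on_SigmaD1[of "\<lambda>e m. f (m, e)" E "\<lambda>_. UNIV" e] that has_sum_imp_summable by auto
  define \<tau> where "\<tau> e = (\<Sum>\<^sub>\<infinity>m. kinetic m e)" for e
  have f\<mu>: "f (m, e) = \<mu> e * (kinetic m e)" for m e
    by (simp add: f_def mult_ac)
  have \<tau>: "((\<lambda>m. kinetic m e) has_sum \<tau> e) UNIV"
    if e: "e \<in> E" "\<mu> e \<noteq> 0" for e
  proof -
    have "(\<lambda>m. (1 / \<mu> e) * f (m, e)) summable_on UNIV" by (intro summable_on_cmult_right fe e)
    then have "(\<lambda>m. kinetic m e) summable_on UNIV"
      unfolding f\<mu> using e(2) by simp
    then show ?thesis unfolding \<tau>_def by (rule has_sum_infsum)
  qed
  have "((\<lambda>e. \<mu> e * \<tau> e) has_sum s) E"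
  proof (rule has_sum_SigmaD[OF fs])
    fix e assume e: "e \<in> E"
    show "((\<lambda>m. case (e, m) of (e, m) \<Rightarrow> f (m, e)) has_sum \<mu> e * \<tau> e) UNIV"
      \<comment> \<open>In the kernel every term carries the factor 0, so the value of
        \<open>\<tau> e\<close> is irrelevant.\<close>
      by (cases "\<mu> e = 0") (use has_sum_cmult_right[OF \<tau>[OF e], of "\<mu> e"] in \<open>simp_all add: f\<mu>\<close>)
  qed
  moreover have "op_trace (sandwich P) = of_real s" using tr \<open>sandwich P = S\<close> by simp
  ultimately show ?thesis using \<tau> by (intro that[of s \<tau>]) simp_all
qed

text \<open>The eigenvalue equation paired with \<open>f\<close> itself, the kinetic part being
  evaluated by Parseval.\<close>

lemma eigenvector_energy:
  assumes W: "W \<in> Linf_fun" and f: "(f, l *\<^sub>R f) \<in> schroedinger W" "norm f = 1"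
  shows "((\<lambda>m. kinetic m f) has_sum (l - Re (cinner f (mult_op W f)))) UNIV"
proof -
  obtain h where h: "l *\<^sub>R f = h + mult_op W f"
    "\<And>m. cinner (fourier_vec m) h = of_real ((2 * pi * of_int m)\<^sup>2) * cinner (fourier_vec m) f"
    using schroedinger_fourier[OF W f(1)] by blast
  have "Re (cinner f (fourier_vec m) * cinner (fourier_vec m) h) = kinetic m f" for m
  proof -
    have "cinner f (fourier_vec m) * cinner (fourier_vec m) h
        = of_real ((2 * pi * of_int m)\<^sup>2) * (cinner f (fourier_vec m) * cinner (fourier_vec m) f)"
      unfolding h(2) by (simp only: mult_ac)
    then show ?thesis by (simp only: cinner_mult_commute of_real_mult[symmetric] Re_complex_of_real)
  qed
  moreover have "((\<lambda>m. Re (cinner f (fourier_vec m) * cinner (fourier_vec m) h)) has_sum Re (cinner f h)) UNIV"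
    by (rule has_sum_Re[OF fourier_parseval])
  moreover have "Re (cinner f h) = l - Re (cinner f (mult_op W f))"
  proof -
    have "h = l *\<^sub>R f - mult_op W f" using h(1) by simp
    then show ?thesis by (simp add: cinner_diff_right cinner_scaleR_right cinner_self f(2))
  qed
  ultimately show ?thesis by simp
qed

text \<open>
  Bessel's inequality in the form domain: the eigenvectors of the Schroedinger operator are orthogonal with
  respect to its quadratic form, which becomes nonnegative after adding a bound \<open>C\<close> of the potential.
\<close>

lemma schroedinger_bessel:
  assumes W: "W \<in> Linf_fun" and F: "onb F" "\<And>f. f \<in> F \<Longrightarrow> (f, l f *\<^sub>R f) \<in> schroedinger W"
    and u: "((\<lambda>m. kinetic m u) has_sum \<tau>) UNIV"
  obtains x where "((\<lambda>f. l f * (cmod (cinner f u))\<^sup>2) has_sum x) F" "x \<le> \<tau> + Re (cinner u (mult_op W u))"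
proof -
  have oF: "orthonormal F" by (rule onb_orthonormal[OF F(1)])
  note nF = orthonormal_norm[OF oF]
  obtain C0 where "AE x in Omega. \<bar>W x\<bar> \<le> C0" using W by (auto simp: Linf_fun_def)
  then have C': "AE x in Omega. \<bar>W x\<bar> \<le> \<bar>C0\<bar>" by eventually_elim auto
  define C where "C = \<bar>C0\<bar>"
  have WC: "\<bar>Re (cinner w (mult_op W w))\<bar> \<le> C * (norm w)\<^sup>2" for w
  proof -
    have "\<bar>Re (cinner w (mult_op W w))\<bar> \<le> norm w * norm (mult_op W w)"
      using abs_Re_le_cmod norm_cinner_le order_trans by blast
    also have "\<dots> \<le> norm w * (C * norm w)"
      unfolding C_def by (intro mult_left_mono norm_mult_op_le[OF W C']) auto
    finally show ?thesis by (simp add: power2_eq_square mult_ac)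
  qed
  have "\<exists>v. (f, v) \<in> sqrt_H0" if "f \<in> F" for f
    using sqrt_H0_exists[OF has_sum_imp_summable[OF eigenvector_energy[OF W F(2)[OF that] nF[OF that]]]] by blast
  then obtain D where D: "\<And>f. f \<in> F \<Longrightarrow> (f, D f) \<in> sqrt_H0" by metis
  obtain Du where Du: "(u, Du) \<in> sqrt_H0" using sqrt_H0_exists[OF has_sum_imp_summable[OF u]] by blast
  have nDu: "(norm Du)\<^sup>2 = \<tau>" using sqrt_H0_norm[OF Du] u has_sum_unique by blast
  \<comment> \<open>The eigenvalue equation in weak form: one root of the Laplacian is moved onto
    \<open>y\<close>, which therefore only has to be in the form domain.\<close>
  have key: "cinner (D f) Dy + cinner f (mult_op W y) = of_real (l f) * cinner f y"
    if f: "f \<in> F" and y: "(y, Dy) \<in> sqrt_H0" for f y Dy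
  proof -
    obtain h where h: "l f *\<^sub>R f = h + mult_op W f"
      "\<And>m. cinner (fourier_vec m) h = of_real ((2 * pi * of_int m)\<^sup>2) * cinner (fourier_vec m) f"
      using schroedinger_fourier[OF W F(2)[OF f]] by blast
    have "(D f, h) \<in> sqrt_H0"
      using D[OF f] unfolding sqrt_H0_iff h(2) by (simp only: abs_freq_square simp_thms)
    from sqrt_H0_cinner[OF this y] have "cinner (D f) Dy = cinner h y" .
    moreover have "cinner f (mult_op W y) = cinner (mult_op W f) y" by (simp add: mult_op_symmetric[OF W])
    ultimately have "cinner (D f) Dy + cinner f (mult_op W y) = cinner (l f *\<^sub>R f) y"
      by (simp add: h(1) cinner_add_left)
    then show ?thesis by (simp add: cinner_scaleR_left)
  qed
  define t where "t = \<tau> + Re (cinner u (mult_op W u))"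
  have lC: "0 \<le> l f + C" if "f \<in> F" for f
  proof -
    have "0 \<le> l f - Re (cinner f (mult_op W f))"
      by (rule has_sum_nonneg[OF eigenvector_energy[OF W F(2)[OF that] nF[OF that]]]) simp
    then show ?thesis using WC[of f] nF[OF that] by simp
  qed
  \<comment> \<open>Split \<open>u\<close> into its projection \<open>p\<close> on the span of
    \<open>A\<close> and the remainder \<open>w\<close>. The form value of \<open>w\<close> is that
    of \<open>u\<close> minus the partial sum, and it is at least -C times the squared norm of
    \<open>w\<close>.\<close>
  have fin: "(\<Sum>f\<in>A. (l f + C) * (cmod (cinner f u))\<^sup>2) \<le> t + C * (norm u)\<^sup>2" if A: "finite A" "A \<subseteq> F" for A
  proof -
    define p where "p = (\<Sum>f\<in>A. scaleC_L2 (cinner f u) f)"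
    define w where "w = u - p"
    define Dp where "Dp = (\<Sum>f\<in>A. scaleC_L2 (cinner f u) (D f))"
    define Dw where "Dw = Du - Dp"
    have pD: "(p, Dp) \<in> sqrt_H0" unfolding p_def Dp_def
      by (intro sqrt_H0_sum sqrt_H0_scaleC D) (use A in auto)
    then have wD: "(w, Dw) \<in> sqrt_H0" unfolding w_def Dw_def by (rule sqrt_H0_diff[OF Du])
    have fw: "cinner f w = 0" if "f \<in> A" for f
      using orthonormal_cinner_sum[OF oF A, of f "\<lambda>f. cinner f u"] that A by (auto simp: w_def p_def cinner_diff_right)
    have W_add: "mult_op W (u - p) = mult_op W u - mult_op W p"
      using bounded_linear_mult_op[OF W] by (simp add: linear_diff bounded_linear.linear)
    have 1: "cinner Dp Dy + cinner p (mult_op W y) = (\<Sum>f\<in>A. cnj (cinner f u) * (of_real (l f) * cinner f y))"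
      if "(y, Dy) \<in> sqrt_H0" for y Dy
      unfolding p_def Dp_def cinner_sum_left cinner_scaleC_left sum.distrib[symmetric] distrib_left[symmetric]
      by (intro sum.cong refl arg_cong2[where f="(*)"] key that) (use A in auto)
    \<comment> \<open>The remainder is orthogonal to \<open>p\<close> in the form too, because by
      \<open>key\<close> the form of an eigenvector with \<open>w\<close> is a multiple of their
      inner product.\<close>
    have pw: "cinner Dp Dw + cinner p (mult_op W w) = 0" using fw by (simp add: 1[OF wD])
    have pu: "cinner Dp Du + cinner p (mult_op W u) = of_real (\<Sum>f\<in>A. l f * (cmod (cinner f u))\<^sup>2)"
      unfolding 1[OF Du] of_real_sum
      by (intro sum.cong refl) (simp only: of_real_mult complex_norm_square mult_ac)
    have up: "cinner Du Dp + cinner u (mult_op W p) = of_real (\<Sum>f\<in>A. l f * (cmod (cinner f u))\<^sup>2)"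
    proof -
      have "cinner Du Dp + cinner u (mult_op W p) = cnj (cinner Dp Du + cinner p (mult_op W u))"
        by (simp add: cinner_commute[symmetric] mult_op_symmetric[OF W, symmetric])
      then show ?thesis by (simp only: pu complex_cnj_complex_of_real)
    qed
    have "cinner Dw Dw + cinner w (mult_op W w) = (cinner Du Dw + cinner u (mult_op W w)) - (cinner Dp Dw + cinner p (mult_op W w))"
      unfolding Dw_def w_def by (simp add: cinner_diff_left algebra_simps)
    also have "\<dots> = cinner Du Du + cinner u (mult_op W u) - (cinner Du Dp + cinner u (mult_op W p))"
      unfolding pw unfolding Dw_def w_def W_add by (simp add: cinner_diff_right algebra_simps)
    finally have "Re (cinner Dw Dw + cinner w (mult_op W w)) = t - (\<Sum>f\<in>A. l f * (cmod (cinner f u))\<^sup>2)"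
      unfolding up by (simp add: cinner_self nDu t_def del: of_real_power of_real_sum)
    then have "0 \<le> t - (\<Sum>f\<in>A. l f * (cmod (cinner f u))\<^sup>2) + C * (norm w)\<^sup>2"
    proof -
      have "0 \<le> Re (cinner Dw Dw)" by (simp add: cinner_self del: of_real_power)
      moreover assume "Re (cinner Dw Dw + cinner w (mult_op W w)) = t - (\<Sum>f\<in>A. l f * (cmod (cinner f u))\<^sup>2)"
      ultimately show ?thesis using abs_le_D2[OF WC[of w]] by simp
    qed
    moreover have "(norm w)\<^sup>2 = (norm u)\<^sup>2 - (\<Sum>f\<in>A. (cmod (cinner f u))\<^sup>2)"
      using bessel_finite[OF oF A, of u] by (simp add: w_def p_def)
    ultimately show ?thesis by (simp add: distrib_right sum.distrib sum_distrib_left algebra_simps)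
  qed
  have sm: "(\<lambda>f. (l f + C) * (cmod (cinner f u))\<^sup>2) summable_on F"
    by (rule nonneg_bdd_above_summable_on) (use lC fin in \<open>auto intro!: bdd_aboveI2\<close>)
  define y where "y = (\<Sum>\<^sub>\<infinity>f\<in>F. (l f + C) * (cmod (cinner f u))\<^sup>2)"
  have y: "y \<le> t + C * (norm u)\<^sup>2" unfolding y_def by (rule infsum_le_finite_sums[OF sm fin])
  \<comment> \<open>Undo the shift: by Parseval it contributed exactly C times the squared norm of
    \<open>u\<close>.\<close>
  have "((\<lambda>f. (l f + C) * (cmod (cinner f u))\<^sup>2 + - C * (cmod (cinner f u))\<^sup>2) has_sum (y + - C * (norm u)\<^sup>2)) F"
    unfolding y_def by (intro has_sum_add has_sum_infsum sm has_sum_cmult_right parseval_norm F)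
  then have "((\<lambda>f. l f * (cmod (cinner f u))\<^sup>2) has_sum (y + - C * (norm u)\<^sup>2)) F"
    by (simp add: algebra_simps)
  then show ?thesis using that y by (simp add: t_def)
qed

section \<open>Existence of the local density\<close>

lemma has_sum_enumerate:
  fixes \<mu> F :: "'a \<Rightarrow> real"
  assumes \<mu>: "\<mu> summable_on E"
  obtains c :: "nat \<Rightarrow> real" and v :: "nat \<Rightarrow> 'a" where "\<And>i. c i \<noteq> 0 \<Longrightarrow> v i \<in> E \<and> c i = \<mu> (v i)"
    "\<And>F s. ((\<lambda>e. \<mu> e * F e) has_sum (s::real)) E \<Longrightarrow> ((\<lambda>i. c i * F (v i)) has_sum s) UNIV"
proof -
  define E' where "E' = {e \<in> E. \<mu> e \<noteq> 0}"
  have E': "countable E'" unfolding E'_def by (rule summable_countable_real[OF \<mu>])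
  define I where "I = to_nat_on E' ` E'"
  define v where "v = from_nat_into E'"
  define c where "c i = (if i \<in> I then \<mu> (v i) else 0)" for i
  have vI: "v (to_nat_on E' e) = e" if "e \<in> E'" for e
    unfolding v_def using that E' by simp
  show ?thesis
  proof (rule that[of c v])
    fix i assume "c i \<noteq> 0"
    then have "i \<in> I" "c i = \<mu> (v i)" by (auto simp: c_def split: if_splits)
    moreover from this(1) have "v i \<in> E'" using vI by (auto simp: I_def)
    ultimately show "v i \<in> E \<and> c i = \<mu> (v i)" by (auto simp: E'_def)
  next
    fix F s assume s: "((\<lambda>e. \<mu> e * F e) has_sum (s::real)) E"
    have "((\<lambda>e. \<mu> e * F e) has_sum s) E'"
      using s by (rule has_sum_cong_neutral[THEN iffD1, rotated -1]) (auto simp: E'_def)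
    moreover have "\<mu> e * F e = ((\<lambda>i. c i * F (v i)) \<circ> to_nat_on E') e" if "e \<in> E'" for e
      using that by (simp add: c_def I_def vI)
    ultimately have "(((\<lambda>i. c i * F (v i)) \<circ> to_nat_on E') has_sum s) E'"
      by (simp cong: has_sum_cong)
    then have "((\<lambda>i. c i * F (v i)) has_sum s) I"
      unfolding I_def using has_sum_reindex[OF inj_on_to_nat_on[OF E']] by blast
    then show "((\<lambda>i. c i * F (v i)) has_sum s) UNIV"
      by (rule has_sum_cong_neutral[THEN iffD1, rotated -1]) (auto simp: c_def)
  qed
qed

lemma mult_expectation_bound:
  assumes \<phi>: "\<phi> \<in> Linf_fun"
  obtains C where "0 \<le> C" "\<And>e. norm e = 1 \<Longrightarrow> \<bar>Re (cinner e (mult_op \<phi> e))\<bar> \<le> C"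
proof -
  obtain C where C: "\<And>u. norm (mult_op \<phi> u) \<le> norm u * C"
    using bounded_linear.bounded[OF bounded_linear_mult_op[OF \<phi>]] by blast
  have "\<bar>Re (cinner e (mult_op \<phi> e))\<bar> \<le> max 0 C" if "norm e = 1" for e
  proof -
    have "\<bar>Re (cinner e (mult_op \<phi> e))\<bar> \<le> norm e * norm (mult_op \<phi> e)"
      using abs_Re_le_cmod norm_cinner_le order_trans by blast
    then show ?thesis using C[of e] that by simp
  qed
  then show ?thesis using that[of "max 0 C"] by simp
qed

lemma op_trace_mult_op:
  assumes P: "positive_op P" and E: "onb E" and eig: "\<And>e. e \<in> E \<Longrightarrow> P e = \<mu> e *\<^sub>R e"
    and \<mu>: "\<And>e. 0 \<le> \<mu> e" "\<mu> summable_on E" and \<phi>: "\<phi> \<in> Linf_fun"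
  obtains t where "op_trace (\<lambda>u. mult_op \<phi> (P u)) = of_real t"
    "((\<lambda>e. \<mu> e * Re (cinner e (mult_op \<phi> e))) has_sum t) E"
proof -
  obtain C where C: "0 \<le> C" "\<And>e. norm e = 1 \<Longrightarrow> \<bar>Re (cinner e (mult_op \<phi> e))\<bar> \<le> C"
    using mult_expectation_bound[OF \<phi>] by blast
  have "(\<lambda>e. \<mu> e * Re (cinner e (mult_op \<phi> e))) summable_on E"
  proof (rule abs_summable_summable, rule Infinite_Sum.abs_summable_on_comparison_test')
    show "(\<lambda>e. \<mu> e * C) summable_on E" by (intro summable_on_cmult_left \<mu>)
    fix e assume "e \<in> E"
    then show "norm (\<mu> e * Re (cinner e (mult_op \<phi> e))) \<le> \<mu> e * C"
      using C(2)[OF onb_norm[OF E], of e] \<mu>(1)[of e] by (simp add: abs_mult mult_left_mono)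
  qed
  then obtain t where t: "((\<lambda>e. \<mu> e * Re (cinner e (mult_op \<phi> e))) has_sum t) E"
    using summable_on_def by blast
  have "op_trace (\<lambda>u. mult_op \<phi> (P u)) = (\<Sum>\<^sub>\<infinity>e\<in>E. of_real (\<mu> e) * cinner e (mult_op \<phi> e))"
    by (rule op_trace_comp[OF P E eig \<mu> bounded_linear_mult_op[OF \<phi>] mult_op_scaleC[OF \<phi>]])
  also have "\<dots> = (\<Sum>\<^sub>\<infinity>e\<in>E. of_real (\<mu> e * Re (cinner e (mult_op \<phi> e))))"
    by (rule infsum_cong) (simp add: cinner_mult_op_self[OF \<phi>])
  also have "\<dots> = of_real t" by (rule infsumI[OF has_sum_of_real[OF t]])
  finally show ?thesis using t that by blast
qed

text \<open>The density is the sum of |e|^2 weighted by the eigenvalues. Its terms have integrals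
  summing to the trace, so it converges almost everywhere and to an integrable function; bounded
  test functions may then be integrated term by term.\<close>

lemma density_exists:
  assumes P: "positive_op P" and E: "onb E" and eig: "\<And>e. e \<in> E \<Longrightarrow> P e = \<mu> e *\<^sub>R e"
    and \<mu>: "\<And>e. 0 \<le> \<mu> e" "\<mu> summable_on E"
  shows "\<exists>n. is_density P n"
proof -
  obtain c v where cv: "\<And>i::nat. c i \<noteq> 0 \<Longrightarrow> v i \<in> E \<and> c i = \<mu> (v i)"
    "\<And>F s. ((\<lambda>e. \<mu> e * F e) has_sum (s::real)) E \<Longrightarrow> ((\<lambda>i. c i * F (v i)) has_sum s) UNIV"
    using has_sum_enumerate[OF \<mu>(2)] by metis
  have c0: "0 \<le> c i" for i using cv(1)[of i] \<mu>(1)[of "v i"] by (cases "c i = 0") auto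
  have cs: "summable c"
    using cv(2)[of "\<lambda>_. 1"] has_sum_infsum[OF \<mu>(2)] has_sum_imp_sums sums_summable by fastforce
  define q where "q i x = c i * (cmod (rep_L2 (v i) x))\<^sup>2" for i x
  have q0: "0 \<le> q i x" for i x by (simp add: q_def c0)
  have i2: "integrable Omega (\<lambda>x. (cmod (rep_L2 u x))\<^sup>2)" for u
    using rep_L2_mem[of u] by (simp add: L2_fun_def)
  have qi: "integrable Omega (q i)" for i unfolding q_def using i2 by simp
  then have [measurable]: "q i \<in> borel_measurable Omega" for i by auto
  have qint: "(LINT x|Omega. q i x) = c i" for i
  proof (cases "c i = 0")
    case False
    then have "norm (v i) = 1" using cv(1) onb_norm[OF E] by blast
    then show ?thesis using norm_abs_L2[OF rep_L2_mem, of "v i"] by (simp add: q_def)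
  qed (simp add: q_def)
  have ae: "AE x in Omega. summable (\<lambda>i. q i x)"
  proof -
    have "(\<integral>\<^sup>+x. (\<Sum>i. ennreal (q i x)) \<partial>Omega) = (\<Sum>i. \<integral>\<^sup>+x. ennreal (q i x) \<partial>Omega)"
      by (rule nn_integral_suminf) measurable
    also have "\<dots> = (\<Sum>i. ennreal (c i))"
      using qi q0 by (simp add: nn_integral_eq_integral qint)
    also have "\<dots> < \<infinity>" using suminf_ennreal2[OF c0 cs] by simp
    finally have "(\<integral>\<^sup>+x. (\<Sum>i. ennreal (q i x)) \<partial>Omega) \<noteq> \<infinity>" by simp
    then have "AE x in Omega. (\<Sum>i. ennreal (q i x)) \<noteq> \<infinity>"
      by (rule nn_integral_PInf_AE[rotated]) measurable
    then show ?thesis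
      by eventually_elim (rule summable_suminf_not_top, use q0 in auto)
  qed
  define n where "n x = (\<Sum>i. q i x)" for x
  have ni: "integrable Omega n"
    unfolding n_def by (rule integrable_suminf) (use ae qi q0 cs qint in auto)
  have "op_trace (\<lambda>u. mult_op \<phi> (P u)) = of_real (LINT x|Omega. \<phi> x * n x)" if \<phi>: "\<phi> \<in> Linf_fun" for \<phi>
  proof -
    obtain C where "AE x in Omega. \<bar>\<phi> x\<bar> \<le> C" using \<phi> by (auto simp: Linf_fun_def)
    then have C: "AE x in Omega. \<bar>\<phi> x\<bar> \<le> \<bar>C\<bar>" by eventually_elim auto
    obtain t where t: "op_trace (\<lambda>u. mult_op \<phi> (P u)) = of_real t"
      "((\<lambda>e. \<mu> e * Re (cinner e (mult_op \<phi> e))) has_sum t) E"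
      using op_trace_mult_op[OF P E eig \<mu> \<phi>] by blast
    have "(\<lambda>i. c i * Re (cinner (v i) (mult_op \<phi> (v i)))) sums t"
      by (rule has_sum_imp_sums[OF cv(2)[OF t(2)]])
    moreover have "c i * Re (cinner (v i) (mult_op \<phi> (v i))) = (LINT x|Omega. \<phi> x * q i x)" for i
      unfolding cinner_mult_op_self[OF \<phi>] Re_complex_of_real integral_mult_right_zero[symmetric] q_def
      by (simp only: mult.left_commute)
    ultimately have 1: "(\<lambda>i. LINT x|Omega. \<phi> x * q i x) sums t" by simp
    have [measurable]: "\<phi> \<in> borel_measurable Omega" using \<phi> by (simp add: Linf_fun_def)
    have \<phi>q: "integrable Omega (\<lambda>x. \<phi> x * q i x)" for i by (rule Linf_mult_integrable[OF \<phi> qi])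
    have "(\<lambda>i. LINT x|Omega. \<phi> x * q i x) sums (LINT x|Omega. (\<Sum>i. \<phi> x * q i x))"
    proof (rule sums_integral[OF \<phi>q])
      show "AE x in Omega. summable (\<lambda>i. norm (\<phi> x * q i x))"
        using ae
      proof eventually_elim
        fix x assume "summable (\<lambda>i. q i x)"
        from summable_mult[OF this, of "\<bar>\<phi> x\<bar>"] show "summable (\<lambda>i. norm (\<phi> x * q i x))"
          using q0 by (simp add: abs_mult)
      qed
      show "summable (\<lambda>i. LINT x|Omega. norm (\<phi> x * q i x))"
      proof (rule summable_comparison_test'[OF summable_mult[OF cs, of "\<bar>C\<bar>"]])
        fix i :: nat assume "0 \<le> i"
        have "(LINT x|Omega. norm (\<phi> x * q i x)) \<le> (LINT x|Omega. \<bar>C\<bar> * q i x)"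
        proof (rule integral_mono_AE[OF integrable_norm[OF \<phi>q]])
          show "AE x in Omega. norm (\<phi> x * q i x) \<le> \<bar>C\<bar> * q i x"
            using C by eventually_elim (use q0 in \<open>auto simp: abs_mult intro!: mult_right_mono\<close>)
        qed (use qi in simp)
        then show "norm (LINT x|Omega. norm (\<phi> x * q i x)) \<le> \<bar>C\<bar> * c i"
          by (simp add: qint)
      qed
    qed
    then have "t = (LINT x|Omega. (\<Sum>i. \<phi> x * q i x))" using 1 sums_unique2 by blast
    also have "\<dots> = (LINT x|Omega. \<phi> x * n x)"
    proof (rule integral_cong_AE)
      show "AE x in Omega. (\<Sum>i. \<phi> x * q i x) = \<phi> x * n x"
        using ae by eventually_elim (simp add: n_def suminf_mult)
    qed (use ni in auto)
    finally show ?thesis using t(1) by simp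
  qed
  then show ?thesis using ni by (auto simp: is_density_def)
qed

section \<open>Klein's inequality and the free energy\<close>

text \<open>With y = ln x + l the claim, divided by x, is exp(-y) >= 1 - y.\<close>

lemma entropy_fun_tangent:
  assumes "0 \<le> x" shows "0 \<le> entropy_fun x + x * l + exp (- l)"
proof (cases "x = 0")
  case False
  define y where "y = ln x + l"
  have "exp (- y) = exp (- l - ln x)" by (simp add: y_def)
  also have "\<dots> = exp (- l) / x" using False assms by (simp add: exp_diff)
  finally have e: "exp (- l) = x * exp (- y)" using False by simp
  have "x * (1 - y) \<le> x * exp (- y)" using exp_ge_add_one_self[of "- y"] assms by (intro mult_left_mono) auto
  then show ?thesis using False by (simp add: entropy_fun_def e) (simp add: y_def algebra_simps)
qed (simp add: entropy_fun_def)

text \<open>The upper half of the absolute summability of the competitor's entropy; the tangent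
  inequality only bounds from below.\<close>

lemma entropy_fun_le_square: "0 \<le> x \<Longrightarrow> entropy_fun x \<le> x * x"
proof (cases "x = 0")
  case False
  assume "0 \<le> x"
  with False have "x * ln x \<le> x * (x - 1)" by (intro mult_left_mono ln_le_minus_one) auto
  then show ?thesis using \<open>0 \<le> x\<close> False by (simp add: entropy_fun_def algebra_simps)
qed (simp add: entropy_fun_def)

text \<open>Any density and any Poisson solution may stand for the ones chosen by
  \<open>SOME\<close> in \<open>free_energy\<close>, since only almost everywhere equal gradients
  enter.\<close>

lemma free_energy_density:
  assumes n: "is_density P n" and V: "poisson_solution n V" and Vext: "Vext \<in> Linf_fun"
  shows "free_energy Vext P = Re (op_trace (graph_apply (fun_calc entropy_fun (op_graph P))))
     + Re (op_trace (sandwich P)) + (LINT x|Omega. Vext x * n x) + 1/2 * (L2_norm (grad V))\<^sup>2"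
proof -
  have d: "is_density P (density P)" unfolding density_def using n by (rule someI[of "is_density P"])
  have "L2_norm (grad (poisson_potential (density P))) = L2_norm (grad V)"
    by (rule poisson_energy_unique[OF _ _ density_unique_AE[OF n d] V]) (use n d in \<open>auto simp: is_density_def\<close>)
  moreover have "op_trace (\<lambda>u. mult_op Vext (P u)) = of_real (LINT x|Omega. Vext x * n x)"
    using n Vext by (simp add: is_density_def)
  ultimately show ?thesis by (simp add: free_energy_def)
qed

lemma energy_space_pos_eigenbasis:
  assumes "P \<in> energy_space_pos"
  obtains E \<mu> where "onb E" "\<And>e. e \<in> E \<Longrightarrow> P e = \<mu> e *\<^sub>R e" "\<And>e. 0 \<le> \<mu> e" "\<mu> summable_on E"
proof -
  have "positive_op P" "trace_class P" using assms by (auto simp: energy_space_pos_def energy_space_def)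
  from trace_class_eigenbasis[OF this onb_fourier] show ?thesis using that by blast
qed

text \<open>The state exp(-H) in diagonal form. \<open>W\<close> collects the whole potential, in
  use \<open>Vext\<close> plus \<open>A\<close> at one time, so the logarithm of
  \<open>\<rho>\<close> is minus one Schroedinger operator.\<close>

locale gibbs_state =
  fixes W l F \<rho>
  assumes W: "W \<in> Linf_fun" and \<rho>: "\<rho> \<in> energy_space_pos" and F: "onb F"
    and eig: "\<And>f. f \<in> F \<Longrightarrow> (f, l f *\<^sub>R f) \<in> schroedinger W"
    and \<rho>_eig: "\<And>f. f \<in> F \<Longrightarrow> \<rho> f = exp (- l f) *\<^sub>R f"
begin

lemma \<rho>_pos: "positive_op \<rho>" using \<rho> by (simp add: energy_space_pos_def)

lemma nF: "f \<in> F \<Longrightarrow> norm f = 1" by (rule onb_norm[OF F])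

lemma weights_summable: "(\<lambda>f. exp (- l f)) summable_on F"
proof -
  have "trace_class \<rho>" using \<rho> by (simp add: energy_space_pos_def energy_space_def)
  then have "(\<lambda>e. Re (cinner e (\<rho> e))) summable_on F"
    using F by (intro summable_on_Re) (auto simp: trace_class_def op_abs_positive[OF \<rho>_pos])
  then show ?thesis
    by (rule summable_on_cong[THEN iffD1, rotated]) (simp add: \<rho>_eig cinner_scaleR_right cinner_self nF)
qed

lemma op_trace_\<rho>: "op_trace \<rho> = of_real (\<Sum>\<^sub>\<infinity>f\<in>F. exp (- l f))"
  by (rule op_trace_eigenbasis[OF \<rho>_pos F \<rho>_eig exp_ge_zero weights_summable])

text \<open>The equality case of the tangent inequality: at x = exp(-l) the entropy function is -l x
  - x, and \<open>l\<close> splits into kinetic and potential energy of the eigenvector.\<close>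

lemma entropy_eq:
  assumes n: "is_density \<rho> n"
  shows "Re (op_trace (graph_apply (fun_calc entropy_fun (op_graph \<rho>))))
    = - Re (op_trace (sandwich \<rho>)) - (LINT x|Omega. W x * n x) - Re (op_trace \<rho>)"
proof -
  obtain s \<tau> where s: "op_trace (sandwich \<rho>) = of_real s"
    and \<tau>: "\<And>f. f \<in> F \<Longrightarrow> exp (- l f) \<noteq> 0 \<Longrightarrow>
      ((\<lambda>m. kinetic m f) has_sum \<tau> f) UNIV"
    and hs: "((\<lambda>f. exp (- l f) * \<tau> f) has_sum s) F"
    using energy_trace[OF \<rho> F \<rho>_eig exp_ge_zero] by blast
  obtain t where t: "op_trace (\<lambda>u. mult_op W (\<rho> u)) = of_real t"
    "((\<lambda>f. exp (- l f) * Re (cinner f (mult_op W f))) has_sum t) F"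
    using op_trace_mult_op[OF \<rho>_pos F \<rho>_eig exp_ge_zero weights_summable W] by blast
  have t': "t = (LINT x|Omega. W x * n x)" using n W t(1) by (simp add: is_density_def)
  have sum: "((\<lambda>f. - (exp (- l f) * \<tau> f) + - (exp (- l f) * Re (cinner f (mult_op W f))) + - exp (- l f))
      has_sum (- s + - t + - (\<Sum>\<^sub>\<infinity>f\<in>F. exp (- l f)))) F"
    by (intro has_sum_add has_sum_uminusI hs t(2) has_sum_infsum weights_summable)
  have "- (exp (- l f) * \<tau> f) + - (exp (- l f) * Re (cinner f (mult_op W f))) + - exp (- l f) = entropy_fun (exp (- l f))"
    if f: "f \<in> F" for f
  proof -
    have eq: "\<tau> f = l f - Re (cinner f (mult_op W f))"
      by (rule has_sum_unique[OF \<tau>[OF f] eigenvector_energy[OF W eig[OF f] nF[OF f]]]) simp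
    show ?thesis unfolding eq by (simp add: entropy_fun_def algebra_simps)
  qed
  with sum have ent: "((\<lambda>f. entropy_fun (exp (- l f))) has_sum (- s + - t + - (\<Sum>\<^sub>\<infinity>f\<in>F. exp (- l f)))) F"
    by (simp cong: has_sum_cong)
  have "op_trace (graph_apply (fun_calc entropy_fun (op_graph \<rho>))) = of_real (\<Sum>\<^sub>\<infinity>f\<in>F. entropy_fun (exp (- l f)))"
  proof (rule op_trace_fun_calc[OF \<rho>_pos F \<rho>_eig])
    show "(\<lambda>f. \<bar>entropy_fun (exp (- l f))\<bar>) summable_on F"
      using has_sum_imp_summable[OF ent] summable_on_iff_abs_summable_on_real[of "\<lambda>f. entropy_fun (exp (- l f))" F] by simp
  qed
  then show ?thesis using infsumI[OF ent] s t' op_trace_\<rho> by simp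
qed

lemma klein_inequality:
  assumes P: "P \<in> energy_space_pos" and n: "is_density P n"
  shows "Re (op_trace (graph_apply (fun_calc entropy_fun (op_graph P))))
    \<ge> - Re (op_trace (sandwich P)) - (LINT x|Omega. W x * n x) - Re (op_trace \<rho>)"
proof -
  have P': "positive_op P" using P by (simp add: energy_space_pos_def)
  obtain E \<mu> where E: "onb E" and P_eig: "\<And>e. e \<in> E \<Longrightarrow> P e = \<mu> e *\<^sub>R e" and \<mu>: "\<And>e. 0 \<le> \<mu> e" "\<mu> summable_on E"
    using energy_space_pos_eigenbasis[OF P] by blast
  have nE: "e \<in> E \<Longrightarrow> norm e = 1" for e by (rule onb_norm[OF E])
  obtain s \<tau> where s: "op_trace (sandwich P) = of_real s"
    and \<tau>: "\<And>e. e \<in> E \<Longrightarrow> \<mu> e \<noteq> 0 \<Longrightarrow>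
      ((\<lambda>m. kinetic m e) has_sum \<tau> e) UNIV"
    and hs: "((\<lambda>e. \<mu> e * \<tau> e) has_sum s) E"
    using energy_trace[OF P E P_eig \<mu>(1)] by blast
  obtain t where t: "op_trace (\<lambda>u. mult_op W (P u)) = of_real t"
    "((\<lambda>e. \<mu> e * Re (cinner e (mult_op W e))) has_sum t) E"
    using op_trace_mult_op[OF P' E P_eig \<mu> W] by blast
  have t': "t = (LINT x|Omega. W x * n x)" using n W t(1) by (simp add: is_density_def)
  have trE: "((\<lambda>e. Re (cinner e (\<rho> e))) has_sum (\<Sum>\<^sub>\<infinity>f\<in>F. exp (- l f))) E"
    by (rule op_trace_onb[OF \<rho>_pos F \<rho>_eig _ weights_summable E]) auto
  define a where "a e = \<mu> e * \<tau> e + \<mu> e * Re (cinner e (mult_op W e)) + Re (cinner e (\<rho> e))" for e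
  have a: "(a has_sum (s + t + (\<Sum>\<^sub>\<infinity>f\<in>F. exp (- l f)))) E"
    unfolding a_def by (intro has_sum_add hs t(2) trE)
  \<comment> \<open>Klein's inequality for a single eigenvector. For eigenvalue 0 it is just
    positivity of \<open>\<rho>\<close>, which avoids a possibly infinite kinetic energy.\<close>
  have le: "- a e \<le> entropy_fun (\<mu> e)" if e: "e \<in> E" for e
  proof (cases "\<mu> e = 0")
    case True
    then show ?thesis using positive_op_Re[OF \<rho>_pos, of e] by (simp add: a_def entropy_fun_def)
  next
    case False
    obtain x where x: "((\<lambda>f. l f * (cmod (cinner f e))\<^sup>2) has_sum x) F" "x \<le> \<tau> e + Re (cinner e (mult_op W e))"
      using schroedinger_bessel[OF W F eig \<tau>[OF e False]] by blast
    have r: "((\<lambda>f. exp (- l f) * (cmod (cinner f e))\<^sup>2) has_sum Re (cinner e (\<rho> e))) F"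
    proof -
      have "Re (cinner e f * cinner f (\<rho> e)) = exp (- l f) * (cmod (cinner f e))\<^sup>2" if "f \<in> F" for f
      proof -
        have "cinner e f * cinner f (\<rho> e) = of_real (exp (- l f)) * (cinner e f * cinner f e)"
          unfolding eigenbasis_coeff[OF \<rho>_pos \<rho>_eig[OF that]] by (simp only: mult_ac)
        then show ?thesis by (simp only: cinner_mult_commute of_real_mult[symmetric] Re_complex_of_real)
      qed
      then show ?thesis using has_sum_Re[OF parseval[OF F, of e "\<rho> e"]] by (simp cong: has_sum_cong)
    qed
    \<comment> \<open>The weights sum to the squared norm of \<open>e\<close>, which is 1, so the
      average over \<open>F\<close> returns the entropy term unchanged and turns exp(-l) into the
      expectation of \<open>\<rho>\<close>.\<close>
    have "((\<lambda>f. entropy_fun (\<mu> e) * (cmod (cinner f e))\<^sup>2 + \<mu> e * (l f * (cmod (cinner f e))\<^sup>2)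
        + exp (- l f) * (cmod (cinner f e))\<^sup>2) has_sum (entropy_fun (\<mu> e) * (norm e)\<^sup>2 + \<mu> e * x + Re (cinner e (\<rho> e)))) F"
      by (intro has_sum_add has_sum_cmult_right parseval_norm F x(1) r)
    then have "0 \<le> entropy_fun (\<mu> e) * (norm e)\<^sup>2 + \<mu> e * x + Re (cinner e (\<rho> e))"
    proof (rule has_sum_nonneg)
      fix f assume "f \<in> F"
      have "0 \<le> (entropy_fun (\<mu> e) + \<mu> e * l f + exp (- l f)) * (cmod (cinner f e))\<^sup>2"
        by (intro mult_nonneg_nonneg entropy_fun_tangent \<mu>) simp
      then show "0 \<le> entropy_fun (\<mu> e) * (cmod (cinner f e))\<^sup>2 + \<mu> e * (l f * (cmod (cinner f e))\<^sup>2) + exp (- l f) * (cmod (cinner f e))\<^sup>2"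
        by (simp add: algebra_simps)
    qed
    moreover have "\<mu> e * x \<le> \<mu> e * (\<tau> e + Re (cinner e (mult_op W e)))" by (intro mult_left_mono x \<mu>)
    ultimately show ?thesis by (simp add: a_def nE[OF e] algebra_simps)
  qed
  define M where "M = infsum \<mu> E"
  \<comment> \<open>From below by \<open>le\<close>, from above by the square of the eigenvalue,
    \<open>M\<close> dominating each of them. The resulting absolute summability is what gives the
    entropy trace its value.\<close>
  have bound: "\<bar>entropy_fun (\<mu> e)\<bar> \<le> \<bar>a e\<bar> + M * \<mu> e" if e: "e \<in> E" for e
  proof -
    have "\<mu> e \<le> M" unfolding M_def using finite_sum_le_infsum[OF \<mu>(2), of "{e}"] e \<mu>(1) by simp
    then have "\<mu> e * \<mu> e \<le> M * \<mu> e" by (rule mult_right_mono) (rule \<mu>)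
    moreover note le[OF e] entropy_fun_le_square[OF \<mu>(1), of e] mult_nonneg_nonneg[OF \<mu>(1) \<mu>(1), of e e]
    ultimately show ?thesis using abs_ge_self[of "a e"] by (intro abs_leI) linarith+
  qed
  have abs: "(\<lambda>e. \<bar>entropy_fun (\<mu> e)\<bar>) summable_on E"
  proof (rule summable_on_comparison_test)
    have "(\<lambda>e. \<bar>a e\<bar>) summable_on E"
      using has_sum_imp_summable[OF a] summable_on_iff_abs_summable_on_real[of a E] by simp
    then show "(\<lambda>e. \<bar>a e\<bar> + M * \<mu> e) summable_on E" by (intro summable_on_add summable_on_cmult_right \<mu>)
  qed (use bound in auto)
  have "op_trace (graph_apply (fun_calc entropy_fun (op_graph P))) = of_real (\<Sum>\<^sub>\<infinity>e\<in>E. entropy_fun (\<mu> e))"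
    by (rule op_trace_fun_calc[OF P' E P_eig abs])
  moreover have "- (s + t + (\<Sum>\<^sub>\<infinity>f\<in>F. exp (- l f))) \<le> (\<Sum>\<^sub>\<infinity>e\<in>E. entropy_fun (\<mu> e))"
  proof (rule has_sum_mono[OF has_sum_uminusI[OF a] has_sum_infsum])
    show "(\<lambda>e. entropy_fun (\<mu> e)) summable_on E" by (rule abs_summable_summable) (use abs in simp)
  qed (rule le)
  ultimately show ?thesis using s t' op_trace_\<rho> by simp
qed

end

section \<open>From the entropy estimates to the free energy gap\<close>

lemma L2_fun_mult_integrable:
  fixes f g :: "real \<Rightarrow> real"
  assumes f: "f \<in> L2_fun" and g: "g \<in> L2_fun"
  shows "integrable Omega (\<lambda>x. f x * g x)"
proof -
  have "integrable Omega (\<lambda>x. ((f x + g x)\<^sup>2 - (f x)\<^sup>2 - (g x)\<^sup>2) / 2)"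
    using f g L2_fun_add[OF f g] by (simp add: L2_fun_def)
  then show ?thesis by (simp add: power2_sum)
qed

lemma L2_norm_square: "(L2_norm f)\<^sup>2 = (LINT x|Omega. (norm (f x))\<^sup>2)"
  by (simp add: L2_norm_def)

lemma mult_op_one: "mult_op (\<lambda>x. 1) u = u"
  by (simp add: mult_op_def)

lemma is_density_trace:
  assumes "is_density P n" shows "op_trace P = of_real (LINT x|Omega. n x)"
proof -
  have "(\<lambda>x. 1) \<in> Linf_fun" by (auto simp: Linf_fun_def)
  then have "op_trace (\<lambda>u. mult_op (\<lambda>x. 1) (P u)) = of_real (LINT x|Omega. 1 * n x)"
    using assms unfolding is_density_def by blast
  then show ?thesis by (simp add: mult_op_one)
qed

lemma Linf_fun_add:
  assumes "f \<in> Linf_fun" "g \<in> Linf_fun" shows "(\<lambda>x. f x + g x) \<in> Linf_fun"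
proof -
  obtain C D where "AE x in Omega. \<bar>f x\<bar> \<le> C" "AE x in Omega. \<bar>g x\<bar> \<le> D"
    using assms by (auto simp: Linf_fun_def)
  then have "AE x in Omega. \<bar>f x + g x\<bar> \<le> C + D" by eventually_elim auto
  then show ?thesis using assms by (auto simp: Linf_fun_def)
qed

text \<open>\<open>fun_calc\<close> hides an eigenbasis in its existential; since the graph of
  \<open>\<rho>\<close> is all of it, the basis vectors themselves can be inserted and give the
  eigenvalues of \<open>\<rho>\<close>.\<close>

lemma gibbs_stateI:
  assumes W: "W \<in> Linf_fun" and \<rho>: "\<rho> \<in> energy_space_pos"
    and graph: "op_graph \<rho> = fun_calc (\<lambda>x. exp (- x)) (schroedinger W)"
  obtains l F where "gibbs_state W l F \<rho>"
proof -
  \<comment> \<open>Any point of the graph carries an eigenbasis; the one at 0 serves.\<close>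
  have "(0, \<rho> 0) \<in> fun_calc (\<lambda>x. exp (- x)) (schroedinger W)"
    unfolding graph[symmetric] op_graph_iff by (rule refl)
  then obtain F l where F: "onb F" "\<And>f. f \<in> F \<Longrightarrow> (f, l f *\<^sub>R f) \<in> schroedinger W"
    unfolding fun_calc_def by blast
  have "\<rho> f = exp (- l f) *\<^sub>R f" if f: "f \<in> F" for f
  proof -
    have "(f, exp (- l f) *\<^sub>R f) \<in> fun_calc (\<lambda>x. exp (- x)) (schroedinger W)"
      unfolding fun_calc_def
    proof (intro CollectI case_prodI exI conjI ballI)
      fix e assume "e \<in> F"
      then show "cinner e (exp (- l f) *\<^sub>R f) = of_real (exp (- l e)) * cinner e f"
        using F(1) f by (cases "e = f") (auto simp: onb_def cinner_scaleR_right)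
    qed (use F in auto)
    then show ?thesis unfolding graph[symmetric] op_graph_iff by simp
  qed
  then show ?thesis using that[of l F] W \<rho> F by (simp add: gibbs_state_def)
qed

text \<open>
  The integration by parts has no boundary terms: \<open>A - V\<close> takes the same value at both end points, and
  subtracting that constant is harmless because both densities have the same mass.
\<close>

lemma free_energy_gap:
  fixes Vext n A V :: "real \<Rightarrow> real"
  assumes Vext: "Vext \<in> Linf_fun" and A: "A \<in> H1_per"
    and \<rho>: "\<rho> \<in> energy_space_pos" "op_graph \<rho> = fun_calc (\<lambda>x. exp (- x)) (schroedinger (\<lambda>x. Vext x + A x))"
    and n: "is_density \<rho> n" and V: "poisson_solution n V"
    and P: "P \<in> energy_space_pos" "op_trace P = op_trace \<rho>"
  shows "free_energy Vext \<rho> - free_energy Vext P \<le> 1/2 * (L2_norm (grad (A - V)))\<^sup>2"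
proof -
  have A1: "A \<in> H1" using A by (simp add: H1_per_def)
  have AL: "A \<in> Linf_fun" by (rule H1_bounded[OF A1])
  obtain l F where "gibbs_state (\<lambda>x. Vext x + A x) l F \<rho>"
    using gibbs_stateI[OF Linf_fun_add[OF Vext AL] \<rho>] by blast
  then interpret gibbs_state "\<lambda>x. Vext x + A x" l F \<rho> .
  have P': "positive_op P" using P(1) by (simp add: energy_space_pos_def)
  obtain nP where nP: "is_density P nP"
    using density_exists[OF P'] energy_space_pos_eigenbasis[OF P(1)] by metis
  have i: "integrable Omega n" "integrable Omega nP" using n nP by (auto simp: is_density_def)
  obtain VP where VP: "poisson_solution nP VP" using poisson_exists[OF i(2)] by blast
  have mass: "(LINT x|Omega. n x) = (LINT x|Omega. nP x)"
    using P(2) is_density_trace[OF n] is_density_trace[OF nP] by simp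
  have H: "V \<in> H1_0" "VP \<in> H1_0" using V VP by (auto simp: poisson_solution_def)
  then have H': "V \<in> H1" "VP \<in> H1" by (auto simp: H1_0_def)
  define a where "a = grad A"
  define v where "v = grad V"
  define w where "w = grad VP"
  have L: "a \<in> L2_fun" "v \<in> L2_fun" "w \<in> L2_fun" using A1 H' H1_grad(1) by (auto simp: a_def v_def w_def)
  have avi: "integrable Omega (\<lambda>x. a x - v x)" "integrable Omega v"
    using L by (auto intro: L2_fun_integrable)
  obtain C where C: "AE x in Omega. A x = C + primitive a x" and a0: "(LINT x|Omega. a x) = 0"
    using H1_per_rep[OF A] unfolding a_def by blast
  have v: "AE x in Omega. V x = primitive v x" "(LINT x|Omega. v x) = 0"
    using H1_0_rep[OF H(1)] by (simp_all add: v_def)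
  have av0: "(LINT x|Omega. a x - v x) = 0" using a0 v(2) L2_fun_integrable[OF L(1)] avi(2) by simp
  have gap: "AE x in Omega. grad (A - V) x = a x - v x"
    using H1_diff(1)[of A C V 0] C v(1) A1 H'(1) by (simp add: a_def v_def)
  have rep: "AE x in Omega. A x = C + primitive (\<lambda>x. a x - v x) x + primitive v x"
    using C by eventually_elim (simp add: primitive_diff L L2_fun_integrable)
  \<comment> \<open>\<open>A\<close> is written as a constant plus two primitives vanishing at both
    ends, so the Poisson equation for \<open>k\<close> can be tested with each. The same identity
    serves both densities; equal mass cancels the constants.\<close>
  have nA: "(LINT x|Omega. A x * k x) = C * (LINT x|Omega. k x) + (LINT x|Omega. u x * (a x - v x)) + (LINT x|Omega. u x * v x)"
    if k: "integrable Omega k" and u: "poisson_solution k U" "u = grad U" for k U u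
  proof -
    have [measurable]: "A \<in> borel_measurable Omega" "k \<in> borel_measurable Omega"
        "primitive (\<lambda>x. a x - v x) \<in> borel_measurable Omega" "primitive v \<in> borel_measurable Omega"
      using k A1 primitive_Omega_measurable[OF avi(1)] primitive_Omega_measurable[OF avi(2)]
      by (auto simp: H1_def L2_fun_def)
    have "(LINT x|Omega. A x * k x) = (LINT x|Omega. C * k x + (k x * primitive (\<lambda>x. a x - v x) x + k x * primitive v x))"
      by (rule integral_cong_AE) (use rep in \<open>auto elim!: eventually_mono simp: algebra_simps\<close>)
    also have "\<dots> = C * (LINT x|Omega. k x) + ((LINT x|Omega. k x * primitive (\<lambda>x. a x - v x) x) + (LINT x|Omega. k x * primitive v x))"
      using k integrable_continuous_scaleR[OF continuous_primitive[OF avi(1)] k]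
        integrable_continuous_scaleR[OF continuous_primitive[OF avi(2)] k] by (simp add: mult.commute)
    finally show ?thesis
      using poisson_ibp[OF k u(1) avi(1) av0] poisson_ibp[OF k u(1) avi(2) v(2)] by (simp add: u(2))
  qed
  have An: "(LINT x|Omega. A x * nP x) - (LINT x|Omega. A x * n x)
      = (LINT x|Omega. w x * (a x - v x)) + (LINT x|Omega. w x * v x) - (LINT x|Omega. v x * (a x - v x)) - (LINT x|Omega. v x * v x)"
    using nA[OF i(1) V v_def] nA[OF i(2) VP w_def] mass by simp
  have W_split: "(LINT x|Omega. (Vext x + A x) * k x) = (LINT x|Omega. Vext x * k x) + (LINT x|Omega. A x * k x)"
    if "integrable Omega k" for k
    using Linf_mult_integrable[OF Vext that] Linf_mult_integrable[OF AL that] by (simp add: distrib_right)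
  have "free_energy Vext \<rho> - free_energy Vext P
     \<le> (LINT x|Omega. A x * nP x) - (LINT x|Omega. A x * n x) + 1/2 * (L2_norm v)\<^sup>2 - 1/2 * (L2_norm w)\<^sup>2"
    using entropy_eq[OF n] klein_inequality[OF P(1) nP]
    unfolding free_energy_density[OF n V Vext] free_energy_density[OF nP VP Vext] W_split[OF i(1)] W_split[OF i(2)]
    by (simp add: v_def w_def)
  also have "\<dots> = (LINT x|Omega. w x * (a x - v x) + w x * v x - v x * (a x - v x) - v x * v x + 1/2 * (v x * v x) - 1/2 * (w x * w x))"
    unfolding An L2_norm_square using L L2_fun_diff[OF L(1,2)]
    by (simp add: L2_fun_mult_integrable power2_eq_square)
  also have "\<dots> \<le> (LINT x|Omega. 1/2 * ((a x - v x) * (a x - v x)))"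
  proof (rule integral_mono)
    fix x
    \<comment> \<open>Completing the square pointwise: the right side minus the left side is exactly
      this expression.\<close>
    have "0 \<le> 1/2 * (a x - w x)\<^sup>2" by simp
    then show "w x * (a x - v x) + w x * v x - v x * (a x - v x) - v x * v x + 1/2 * (v x * v x) - 1/2 * (w x * w x)
        \<le> 1/2 * ((a x - v x) * (a x - v x))"
      by (simp add: power2_eq_square algebra_simps)
  qed (use L L2_fun_diff[OF L(1,2)] in \<open>simp_all add: L2_fun_mult_integrable\<close>)
  also have "\<dots> = 1/2 * (L2_norm (grad (A - V)))\<^sup>2"
  proof -
    have "A - V \<in> H1" using H1_diff(2)[of A C V 0] C v(1) A1 H'(1) by (simp add: a_def v_def)
    then have [measurable]: "grad (A - V) \<in> borel_measurable Omega" "a \<in> borel_measurable Omega" "v \<in> borel_measurable Omega"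
      using H1_grad(1) L by (auto simp: L2_fun_def)
    have "(L2_norm (grad (A - V)))\<^sup>2 = (LINT x|Omega. (a x - v x) * (a x - v x))"
      unfolding L2_norm_square
      by (rule integral_cong_AE) (use gap in \<open>auto elim!: eventually_mono simp: power2_eq_square\<close>)
    then show ?thesis by simp
  qed
  finally show ?thesis .
qed

lemma weighted_L2_norm_ge:
  fixes n g :: "real \<Rightarrow> real"
  assumes n: "n \<in> Linf_fun" "AE x in Omega. c \<le> n x" "0 < c" and g: "g \<in> L2_fun"
  shows "c * (L2_norm g)\<^sup>2 \<le> (L2_norm (\<lambda>x. sqrt (n x) * g x))\<^sup>2"
proof -
  have g2: "integrable Omega (\<lambda>x. (g x)\<^sup>2)" using g by (simp add: L2_fun_def)
  have [measurable]: "n \<in> borel_measurable Omega" "g \<in> borel_measurable Omega"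
    using n g by (auto simp: Linf_fun_def L2_fun_def)
  have eq: "AE x in Omega. n x * (g x)\<^sup>2 = (norm (sqrt (n x) * g x))\<^sup>2"
    using n(2) by eventually_elim (use n(3) in \<open>simp add: power_mult_distrib abs_mult\<close>)
  have "c * (L2_norm g)\<^sup>2 = (LINT x|Omega. c * (g x)\<^sup>2)" by (simp add: L2_norm_square)
  also have "\<dots> \<le> (LINT x|Omega. n x * (g x)\<^sup>2)"
  proof (rule integral_mono_AE)
    show "AE x in Omega. c * (g x)\<^sup>2 \<le> n x * (g x)\<^sup>2"
      using n(2) by eventually_elim (simp add: mult_right_mono)
  qed (use g2 Linf_mult_integrable[OF n(1) g2] in auto)
  also have "\<dots> = (L2_norm (\<lambda>x. sqrt (n x) * g x))\<^sup>2"
    unfolding L2_norm_square by (rule integral_cong_AE) (use eq in auto)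
  finally show ?thesis .
qed

theorem mainTheorem2:
  fixes Vext n0 :: "real \<Rightarrow> real"
    and T n_low :: real
    and n A V :: "real \<Rightarrow> real \<Rightarrow> real"
    and dn :: "real \<Rightarrow> (real \<Rightarrow> real) \<Rightarrow> real"
    and \<rho> :: "real \<Rightarrow> (L2 \<Rightarrow>\<^sub>L L2)"
    and \<rho>_inf :: "L2 \<Rightarrow>\<^sub>L L2"
  assumes Vext: "Vext \<in> Linf_fun"
    and T: "0 < T"
    and n0: "n0 \<in> H1_per" "AE x in Omega. 0 \<le> n0 x" "0 < L1_norm n0"
    and n_reg: "n \<in> Linf_time T H1_per H1_norm"
    and dn_reg: "dn \<in> L2_time T Hm1_per Hm1_norm"
    and dn: "time_derivative T n dn"
    and init: "has_initial_value T n n0"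
    and A_reg: "A \<in> L2_time T H1_per H1_norm"
    and V_reg: "V \<in> Linf_time T H1_0 H1_norm"
    and rho: "AE t in lebesgue_on {0<..<T}. op_graph (\<rho> t) =
        fun_calc (\<lambda>x. exp (- x)) (schroedinger (\<lambda>x. Vext x + A t x))"
    and rho_reg: "\<rho> \<in> Linf_time T energy_space energy_norm"
        "AE t in lebesgue_on {0<..<T}. \<rho> t \<in> energy_space_pos"
    and continuity_eq: "AE t in lebesgue_on {0<..<T}. \<forall>\<phi>\<in>H1_per.
        dn t \<phi> = (LINT x|Omega. n t x * grad (A t - V t) x * grad \<phi> x)"
    and poisson_eq: "AE t in lebesgue_on {0<..<T}. poisson_solution (n t) (V t)"
    and density_eq: "AE t in lebesgue_on {0<..<T}. is_density (\<rho> t) (n t)"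
    and mass: "AE t in lebesgue_on {0<..<T}. L1_norm (n t) = L1_norm n0"
    and n_low: "0 < n_low" "AE t in lebesgue_on {0<..<T}. AE x in Omega. n_low \<le> n t x"
    and equil: "equilibrium Vext (L1_norm n0) \<rho>_inf"
  shows "\<exists>C. AE t in lebesgue_on {0<..<T}.
    free_energy Vext (\<rho> t) - free_energy Vext \<rho>_inf
      \<le> C * (L2_norm (\<lambda>x. sqrt (n t x) * grad (A t - V t) x))\<^sup>2"
proof (rule exI[of _ "1 / (2 * n_low)"])
  have n_mem: "AE t in lebesgue_on {0<..<T}. n t \<in> H1_per" using n_reg by (simp add: Linf_time_def)
  have A_mem: "AE t in lebesgue_on {0<..<T}. A t \<in> H1_per" using A_reg by (simp add: L2_time_def)
  show "AE t in lebesgue_on {0<..<T}. free_energy Vext (\<rho> t) - free_energy Vext \<rho>_inf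
      \<le> 1 / (2 * n_low) * (L2_norm (\<lambda>x. sqrt (n t x) * grad (A t - V t) x))\<^sup>2"
    using n_mem A_mem rho rho_reg(2) poisson_eq density_eq mass n_low(2)
  proof eventually_elim
    case (elim t)
    have V: "V t \<in> H1" using elim(5) by (simp add: poisson_solution_def H1_0_def)
    have A: "A t \<in> H1" using elim(2) by (simp add: H1_per_def)
    obtain a where "AE x in Omega. A t x = a + primitive (grad (A t)) x" using H1_rep[OF A] by blast
    moreover obtain v where "AE x in Omega. V t x = v + primitive (grad (V t)) x" using H1_rep[OF V] by blast
    ultimately have "A t - V t \<in> H1" by (rule H1_diff(2)[OF _ A _ V])
    then have g: "grad (A t - V t) \<in> L2_fun" by (rule H1_grad(1))
    have nL: "n t \<in> Linf_fun" using elim(1) by (intro H1_bounded) (simp add: H1_per_def)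
    \<comment> \<open>The lower bound on \<open>n\<close> makes the L1 norm an integral, hence the
      trace of \<open>\<rho> t\<close>; conservation of mass then matches it with the trace of the
      equilibrium.\<close>
    have "(LINT x|Omega. n t x) = L1_norm (n t)"
      unfolding L1_norm_def
    proof (rule integral_cong_AE)
      show "AE x in Omega. n t x = \<bar>n t x\<bar>" using elim(8) by eventually_elim (use n_low(1) in simp)
    qed (use nL in \<open>auto simp: Linf_fun_def\<close>)
    then have "op_trace \<rho>_inf = op_trace (\<rho> t)"
      using equil is_density_trace[OF elim(6)] elim(7) by (simp add: equilibrium_def)
    moreover have "\<rho>_inf \<in> energy_space_pos" using equil by (simp add: equilibrium_def)
    ultimately have "free_energy Vext (\<rho> t) - free_energy Vext \<rho>_inf \<le> 1/2 * (L2_norm (grad (A t - V t)))\<^sup>2"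
      by (intro free_energy_gap[OF Vext elim(2,4,3,6,5)])
    also have "\<dots> = 1 / (2 * n_low) * (n_low * (L2_norm (grad (A t - V t)))\<^sup>2)" using n_low(1) by simp
    also have "\<dots> \<le> 1 / (2 * n_low) * (L2_norm (\<lambda>x. sqrt (n t x) * grad (A t - V t) x))\<^sup>2"
      using n_low(1) by (intro mult_left_mono weighted_L2_norm_ge[OF nL elim(8) n_low(1) g]) simp
    finally show ?case .
  qed
qed

end
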